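(* Let $\mathcal P$ be a proper hereditary permutation property and let $\epsilon>0$. Let $\sigma$ be a smallest forbidden subpermutation for $\mathcal P$ (a permutation of minimum length not in $\mathcal P$), let $c(\sigma)$ be its Füredi–Hajnal constant, and let $C=1000\,c(\sigma)$. Let $$M=\left\lceil\frac{2000\,C}{\epsilon}\bigl(\log_2(\epsilon/2)\bigr)^2\right\rceil,\qquad n_0=\frac{32M^5k^*(M)}{\epsilon^3}.$$ Then there is a two-sided tester for $\mathcal P$ with respect to the planar tau distance, with parameter $\epsilon$ and query complexity $M$, for permutations of length at least $n_0$.
   Context: A permutation $\pi$ of length $n=|\pi|\ge1$ is a bijection $[n]\to[n]$, $[n]=\{1,\dots,n\}$. A permutation $\sigma$ of length $k$ is a subpermutation of $\pi$ if there are $i_1<\dots<i_k$ in $[n]$ with $\pi(i_j)<\pi(i_\ell)$ iff $\sigma(j)<\sigma(\ell)$. A permutation property is a family $\mathcal P$ of permutations; it is hereditary if every subpermutation of a member is a member, and proper if it does not contain all permutations. Blow-ups. A permutation $\alpha'$ is a blow-up of $\alpha$ if there are integers $1=k_1<k_2<\dots<k_{|\alpha|+1}=|\alpha'|+1$ such that whenever $k_{j_1}\le i_1<k_{j_1+1}$ and $k_{j_2}\le i_2<k_{j_2+1}$ with $j_1\ne j_2$, one has $\alpha'(i_1)>\alpha'(i_2)$ iff $\alpha(j_1)>\alpha(j_2)$. The $j$-th block has size $k_{j+1}-k_j$; the pattern inside each block is arbitrary. A $k$-blow-up is a blow-up in which every block has size $k$. For a permutation $\alpha$, $k^*(\alpha)$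 is the least positive integer $k$ such that no $k$-blow-up of $\alpha$ is in $\mathcal P$, and $k^*(\alpha)=\infty$ if there is none. For a positive integer $T$, $k^*(T)$ is the maximum of $k^*(\alpha)$ over permutations $\alpha$ of length $T$ with $k^*(\alpha)<\infty$, and $k^*(T)=\infty$ if there is no such $\alpha$. (If $n_0=\infty$ the assertion is vacuous; if $M=0$, put $n_0=0$.) Füredi–Hajnal constant. A $0$-$1$ matrix $A$ contains a $0$-$1$ matrix $B$ if $A$ has a submatrix $A'$ of the same size as $B$ with a one in every position where $B$ has a one. $\mathrm{ex}(n,\sigma)$ is the maximum number of ones in an $n\times n$ $0$-$1$ matrix not containing the permutation matrix of $\sigma$, and $c(\sigma)=\lim_{n\to\infty}\mathrm{ex}(n,\sigma)/n$ (this limit is known to exist and be finite, with $\mathrm{ex}(n,\sigma)\le c(\sigma)n$ for all $n$). Planar tau distance. $\sigma$ is obtained from $\pi$ (both of length $n$) by a planar simple transposition if for some $1\le i\le n-1$ either $\sigma$ equals $\pi$ except $\sigma(i)=\pi(i+1)$, $\sigma(i+1)=\pi(i)$, or $\sigma^{-1}$ equals $\pi^{-1}$ except $\sigma^{-1}(i)=\pi^{-1}(i+1)$, $\sigma^{-1}(i+1)=\pi^{-1}(i)$. $\rho_{\mathrm{PT}}(\pi_1,\pi_2)$ is $1/\binom n2$ times the minimum number of planar simple transpositions transforming $\pi_1$ into $\pi_2$ (and $0$ if $n=1$). The distance of $\pi$ from $\mathcal P$ is $\min\rho_{\mathrm{PT}}(\pi,\pi_0)$ over $\pi_0\in\mathcal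 P$ with $|\pi_0|=|\pi|$, and is $1$ if there is no such $\pi_0$; $\pi$ is $\epsilon$-far from $\mathcal P$ if this distance is greater than $\epsilon$. Testers. A two-sided tester for $\mathcal P$ (with parameter $\epsilon$) of query complexity $q$, for permutations of length at least $n_0$, is a randomized algorithm (which may depend on $\mathcal P$ and $\epsilon$; only queries are counted) that, for each permutation $\pi$ of length $n\ge n_0$, queries at most $q$ positions of $\pi$ and outputs either "$\pi\in\mathcal P$" or "$\pi\notin\mathcal P$", such that: if $\pi\in\mathcal P$ it outputs "$\pi\in\mathcal P$" with probability at least $2/3$, and if $\pi$ is $\epsilon$-far from $\mathcal P$ it outputs "$\pi\notin\mathcal P$" with probability at least $2/3$. *)

theory Defs
  imports
    "HOL-Probability.Probability_Mass_Function"
    "HOL-Combinatorics.Permutations"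
    "Jordan_Normal_Form.DL_Submatrix"
begin

text \<open>A permutation of length \<open>n\<close> is a function that permutes \<open>{1..n}\<close> (and is the identity
  elsewhere). The function alone does not determine its length, so lengths are carried explicitly.
  Lengths are at least 1.\<close>

definition perms_of_length :: "nat \<Rightarrow> (nat \<Rightarrow> nat) set" where
  "perms_of_length n = {\<pi>. 1 \<le> n \<and> \<pi> permutes {1..n}}"

text \<open>\<open>subpermutation k \<sigma> n \<pi>\<close>: the permutation \<open>\<sigma>\<close> of length \<open>k\<close> is a subpermutation of the
  permutation \<open>\<pi>\<close> of length \<open>n\<close>.\<close>

definition subpermutation :: "nat \<Rightarrow> (nat \<Rightarrow> nat) \<Rightarrow> nat \<Rightarrow> (nat \<Rightarrow> nat) \<Rightarrow> bool" where
  "subpermutation k \<sigma> n \<pi> \<longleftrightarrow>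
     (\<exists>i :: nat \<Rightarrow> nat. strict_mono_on {1..k} i \<and> i ` {1..k} \<subseteq> {1..n} \<and>
        (\<forall>j\<in>{1..k}. \<forall>l\<in>{1..k}. \<pi> (i j) < \<pi> (i l) \<longleftrightarrow> \<sigma> j < \<sigma> l))"

text \<open>A family of permutations is given by its members of each length.\<close>

type_synonym perm_family = "nat \<Rightarrow> (nat \<Rightarrow> nat) set"

definition permutation_property :: "perm_family \<Rightarrow> bool" where
  "permutation_property P \<longleftrightarrow> (\<forall>n. P n \<subseteq> perms_of_length n)"

definition hereditary :: "perm_family \<Rightarrow> bool" where
  "hereditary P \<longleftrightarrow>
     (\<forall>n k \<pi> \<sigma>. \<pi> \<in> P n \<and> \<sigma> \<in> perms_of_length k \<and> subpermutation k \<sigma> n \<pi> \<longrightarrow> \<sigma> \<in> P k)"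

definition proper :: "perm_family \<Rightarrow> bool" where
  "proper P \<longleftrightarrow> \<not> (\<forall>n. perms_of_length n \<subseteq> P n)"

definition smallest_forbidden :: "perm_family \<Rightarrow> nat \<Rightarrow> (nat \<Rightarrow> nat) \<Rightarrow> bool" where
  "smallest_forbidden P k \<sigma> \<longleftrightarrow>
     \<sigma> \<in> perms_of_length k \<and> \<sigma> \<notin> P k \<and>
     (\<forall>m \<tau>. \<tau> \<in> perms_of_length m \<and> \<tau> \<notin> P m \<longrightarrow> k \<le> m)"

text \<open>\<open>blowup_with m \<alpha> n \<alpha>' b\<close>: the permutation \<open>\<alpha>'\<close> of length \<open>n\<close> is a blow-up of the permutation
  \<open>\<alpha>\<close> of length \<open>m\<close>, the \<open>j\<close>-th block being \<open>{b j..<b (j + 1)}\<close>.\<close>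

definition blowup_with ::
    "nat \<Rightarrow> (nat \<Rightarrow> nat) \<Rightarrow> nat \<Rightarrow> (nat \<Rightarrow> nat) \<Rightarrow> (nat \<Rightarrow> nat) \<Rightarrow> bool" where
  "blowup_with m \<alpha> n \<alpha>' b \<longleftrightarrow>
     b 1 = 1 \<and> b (m + 1) = n + 1 \<and> strict_mono_on {1..m + 1} b \<and>
     (\<forall>j1\<in>{1..m}. \<forall>j2\<in>{1..m}. j1 \<noteq> j2 \<longrightarrow>
        (\<forall>i1\<in>{b j1..<b (j1 + 1)}. \<forall>i2\<in>{b j2..<b (j2 + 1)}.
           \<alpha>' i1 > \<alpha>' i2 \<longleftrightarrow> \<alpha> j1 > \<alpha> j2))"

definition k_blowup :: "nat \<Rightarrow> nat \<Rightarrow> (nat \<Rightarrow> nat) \<Rightarrow> nat \<Rightarrow> (nat \<Rightarrow> nat) \<Rightarrow> bool" where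
  "k_blowup k m \<alpha> n \<alpha>' \<longleftrightarrow>
     \<alpha>' \<in> perms_of_length n \<and>
     (\<exists>b. blowup_with m \<alpha> n \<alpha>' b \<and> (\<forall>j\<in>{1..m}. b (j + 1) - b j = k))"

definition no_k_blowup_in :: "perm_family \<Rightarrow> nat \<Rightarrow> (nat \<Rightarrow> nat) \<Rightarrow> nat \<Rightarrow> bool" where
  "no_k_blowup_in P m \<alpha> k \<longleftrightarrow> \<not> (\<exists>n \<alpha>'. k_blowup k m \<alpha> n \<alpha>' \<and> \<alpha>' \<in> P n)"

definition kstar_perm :: "perm_family \<Rightarrow> nat \<Rightarrow> (nat \<Rightarrow> nat) \<Rightarrow> enat" where
  "kstar_perm P m \<alpha> =
     (if \<exists>k\<ge>1. no_k_blowup_in P m \<alpha> k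
      then enat (LEAST k. k \<ge> 1 \<and> no_k_blowup_in P m \<alpha> k) else \<infinity>)"

definition kstar :: "perm_family \<Rightarrow> nat \<Rightarrow> enat" where
  "kstar P T =
     (if \<exists>\<alpha>\<in>perms_of_length T. kstar_perm P T \<alpha> < \<infinity>
      then Max {kstar_perm P T \<alpha> | \<alpha>. \<alpha> \<in> perms_of_length T \<and> kstar_perm P T \<alpha> < \<infinity>}
      else \<infinity>)"

definition zero_one_mat :: "nat mat \<Rightarrow> bool" where
  "zero_one_mat A \<longleftrightarrow> elements_mat A \<subseteq> {0, 1}"

definition mat_contains :: "nat mat \<Rightarrow> nat mat \<Rightarrow> bool" where
  "mat_contains A B \<longleftrightarrow>
     (\<exists>I J. dim_row (submatrix A I J) = dim_row B \<and> dim_col (submatrix A I J) = dim_col B \<and>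
        (\<forall>i<dim_row B. \<forall>j<dim_col B. B $$ (i, j) = 1 \<longrightarrow> submatrix A I J $$ (i, j) = 1))"

text \<open>Matrix indices start at 0 whereas permutations act on \<open>{1..k}\<close>, hence the shift.\<close>

definition perm_mat :: "nat \<Rightarrow> (nat \<Rightarrow> nat) \<Rightarrow> nat mat" where
  "perm_mat k \<sigma> = Matrix.mat k k (\<lambda>(i, j). if \<sigma> (i + 1) = j + 1 then 1 else 0)"

definition num_ones :: "nat mat \<Rightarrow> nat" where
  "num_ones A = card {(i, j). i < dim_row A \<and> j < dim_col A \<and> A $$ (i, j) = 1}"

definition ex_perm :: "nat \<Rightarrow> nat \<Rightarrow> (nat \<Rightarrow> nat) \<Rightarrow> nat" where
  "ex_perm n k \<sigma> =
     Max {num_ones A | A. A \<in> carrier_mat n n \<and> zero_one_mat A \<and> \<not> mat_contains A (perm_mat k \<sigma>)}"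

definition Fueredi_Hajnal_constant :: "nat \<Rightarrow> (nat \<Rightarrow> nat) \<Rightarrow> real" where
  "Fueredi_Hajnal_constant k \<sigma> = lim (\<lambda>n. real (ex_perm n k \<sigma>) / real n)"

definition planar_transposition :: "nat \<Rightarrow> (nat \<Rightarrow> nat) \<Rightarrow> (nat \<Rightarrow> nat) \<Rightarrow> bool" where
  "planar_transposition n \<pi> \<sigma> \<longleftrightarrow>
     \<pi> \<in> perms_of_length n \<and> \<sigma> \<in> perms_of_length n \<and>
     (\<exists>i. 1 \<le> i \<and> i \<le> n - 1 \<and>
        (\<sigma> = \<pi>(i := \<pi> (i + 1), i + 1 := \<pi> i) \<or>
         inv_into UNIV \<sigma> =
           (inv_into UNIV \<pi>)(i := inv_into UNIV \<pi> (i + 1), i + 1 := inv_into UNIV \<pi> i)))"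

definition planar_tau :: "nat \<Rightarrow> (nat \<Rightarrow> nat) \<Rightarrow> (nat \<Rightarrow> nat) \<Rightarrow> real" where
  "planar_tau n \<pi>1 \<pi>2 =
     (if n = 1 then 0
      else real (LEAST t. (planar_transposition n ^^ t) \<pi>1 \<pi>2) / real (n choose 2))"

text \<open>A distance is a family of functions, one for each length \<open>n\<close>.\<close>

type_synonym perm_dist = "nat \<Rightarrow> (nat \<Rightarrow> nat) \<Rightarrow> (nat \<Rightarrow> nat) \<Rightarrow> real"

definition dist_from_property :: "perm_dist \<Rightarrow> perm_family \<Rightarrow> nat \<Rightarrow> (nat \<Rightarrow> nat) \<Rightarrow> real" where
  "dist_from_property d P n \<pi> = (if P n = {} then 1 else Min (d n \<pi> ` P n))"

definition far_from :: "perm_dist \<Rightarrow> perm_family \<Rightarrow> real \<Rightarrow> nat \<Rightarrow> (nat \<Rightarrow> nat) \<Rightarrow> bool" where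
  "far_from d P \<epsilon> n \<pi> \<longleftrightarrow> dist_from_property d P n \<pi> > \<epsilon>"

text \<open>A deterministic (adaptive) query algorithm is a decision tree: \<open>Query i f\<close> queries position
  \<open>i\<close> of the input \<open>\<pi>\<close> and continues with \<open>f (\<pi> i)\<close>; \<open>Output True\<close> is the verdict that the input
  is in the property, \<open>Output False\<close> that it is not. A randomized query algorithm, for inputs of
  length \<open>n\<close>, is a probability distribution on decision trees.\<close>

datatype query_tree = Output bool | Query nat "nat \<Rightarrow> query_tree"

primrec verdict :: "query_tree \<Rightarrow> (nat \<Rightarrow> nat) \<Rightarrow> bool" where
  "verdict (Output v) \<pi> = v"
| "verdict (Query i f) \<pi> = verdict (f (\<pi> i)) \<pi>"

primrec queries :: "query_tree \<Rightarrow> (nat \<Rightarrow> nat) \<Rightarrow> nat list" where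
  "queries (Output v) \<pi> = []"
| "queries (Query i f) \<pi> = i # queries (f (\<pi> i)) \<pi>"

definition two_sided_tester ::
    "perm_dist \<Rightarrow> perm_family \<Rightarrow> real \<Rightarrow> nat \<Rightarrow> ereal \<Rightarrow> (nat \<Rightarrow> query_tree pmf) \<Rightarrow> bool" where
  "two_sided_tester d P \<epsilon> q n0 A \<longleftrightarrow>
     (\<forall>n \<pi>. n0 \<le> ereal (real n) \<and> \<pi> \<in> perms_of_length n \<longrightarrow>
        (\<forall>t\<in>set_pmf (A n). length (queries t \<pi>) \<le> q \<and> set (queries t \<pi>) \<subseteq> {1..n}) \<and>
        (\<pi> \<in> P n \<longrightarrow> measure_pmf.prob (A n) {t. verdict t \<pi>} \<ge> 2 / 3) \<and>
        (far_from d P \<epsilon> n \<pi> \<longrightarrow> measure_pmf.prob (A n) {t. \<not> verdict t \<pi>} \<ge> 2 / 3))"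

end

theory Submission
  imports Defs
begin

text \<open>The tester samples \<open>M\<close> positions with replacement and accepts iff the sampled pattern
  \<open>\<alpha>\<close> satisfies \<open>k\<^sup>*(\<alpha>) = \<infinity>\<close>.

  Completeness: if \<open>\<pi>\<close> is long, then with high probability every sample point can be fattened to a
  group of \<open>k\<^sup>*(M)\<close> points of \<open>\<pi>\<close> such that the groups form a blow-up of \<open>\<alpha>\<close>. So for \<open>\<pi>\<close> in the
  property, \<open>k\<^sup>*(\<alpha>) < \<infinity>\<close> is unlikely.

  Soundness: if \<open>k\<^sup>*(\<alpha>) = \<infinity>\<close>, then the property has a member \<open>\<rho>\<close> of the same length as \<open>\<pi>\<close> that is a
  blow-up of \<open>\<alpha>\<close> with any prescribed block sizes, and \<open>\<alpha>\<close> avoids \<open>\<sigma>\<close>. Hence the sample occupies at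
  most \<open>c(\<sigma>) 2\<^sup>j\<close> cells of the \<open>2\<^sup>j \<times> 2\<^sup>j\<close> grid, and by a union bound over such sets of cells all but
  a fraction of order \<open>2\<^sup>j \<epsilon> / log (2 / \<epsilon>)\<close> of the points of \<open>\<pi>\<close> lie in occupied cells, for every
  \<open>2\<^sup>j\<close> up to order \<open>1 / \<epsilon>\<close>. Assign each point to a sample point in its smallest occupied dyadic
  cell and take these classes as blocks of \<open>\<rho>\<close>. Two points can change their relative order only if
  they share a strip at one of their scales, so few adjacent transpositions of positions and values
  transform \<open>\<pi>\<close> into \<open>\<rho>\<close>.\<close>

section \<open>Matrices avoiding a permutation\<close>

text \<open>Why every dyadic scale is used. On a single grid with \<open>N\<close> of order
  \<open>1 / \<epsilon>\<close> strips, all but a fraction of order \<open>\<epsilon>\<close> of the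
  points would have to be covered, against about \<open>N ^ (2 * c * N)\<close> possible sets of
  occupied cells; up to logarithms this takes a sample of order \<open>1 / \<epsilon>\<close>
  squared. But a point missed at scale \<open>2 ^ (j + 1)\<close> and covered at scale
  \<open>2 ^ j\<close> is charged for at most about \<open>n / 2 ^ j\<close> changes of order, so
  the finer the grid, the more points may be missed. The permitted fraction and the logarithm of the
  number of cell sets then both grow like \<open>2 ^ j\<close>, and one sample size serves all
  scales. Of the two logarithms in \<open>M\<close>, one comes from sharing the distance budget
  among about \<open>log (1 / \<epsilon>)\<close> scales, the other from the choice of each occupied
  cell among all cells. The constant \<open>c(\<sigma>)\<close> is written with \<open>lim\<close>,
  which carries information only if the sequence converges. Convergence, and the bound by the limit
  for every length, are proved here from a linear bound and Fekete's lemma.\<close>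

definition pat_contains :: "nat \<Rightarrow> (nat \<Rightarrow> nat) \<Rightarrow> (nat \<times> nat) set \<Rightarrow> bool" where
  "pat_contains k \<sigma> A \<longleftrightarrow> (\<exists>r c. strict_mono_on {1..k} r \<and> strict_mono_on {1..k} c \<and>
     (\<forall>i\<in>{1..k}. (r i, c (\<sigma> i)) \<in> A))"

definition ones :: "nat mat \<Rightarrow> (nat \<times> nat) set" where
  "ones A = {(i, j). i < dim_row A \<and> j < dim_col A \<and> A $$ (i, j) = 1}"

text \<open>A submatrix is given by index sets, an occurrence by increasing maps that enumerate
  them; \<open>pick\<close> translates between the two, with a shift from base 0 to base 1. From
  here on matrices are just sets of positions.\<close>

lemma mat_contains_perm_mat_iff:
  assumes \<sigma>: "\<sigma> permutes {1..k}"
  shows "mat_contains A (perm_mat k \<sigma>) \<longleftrightarrow> pat_contains k \<sigma> (ones A)"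
proof
  assume "mat_contains A (perm_mat k \<sigma>)"
  then obtain I J where
      dr: "card {i. i < dim_row A \<and> i \<in> I} = k" and dc: "card {i. i < dim_col A \<and> i \<in> J} = k"
    and e: "\<And>i j. i < k \<Longrightarrow> j < k \<Longrightarrow> perm_mat k \<sigma> $$ (i, j) = 1 \<Longrightarrow> submatrix A I J $$ (i, j) = 1"
    unfolding mat_contains_def dim_submatrix by (auto simp: perm_mat_def)
  have *: "strict_mono_on {1..k} (\<lambda>i. pick I (i - 1))"
    if "card {i. i < m \<and> i \<in> I} = k" for m :: nat and I
  proof (rule strict_mono_onI)
    fix a b assume "a \<in> {1..k}" "b \<in> {1..k}" "a < b"
    moreover have "finite I \<Longrightarrow> k \<le> card I"
      using that by (metis (no_types, lifting) card_mono mem_Collect_eq subsetI)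
    ultimately show "pick I (a - 1) < pick I (b - 1)"
      by (intro pick_mono) auto
  qed
  show "pat_contains k \<sigma> (ones A)"
    unfolding pat_contains_def
  proof (intro exI conjI ballI)
    show "strict_mono_on {1..k} (\<lambda>i. pick I (i - 1))" using *[OF dr] .
    show "strict_mono_on {1..k} (\<lambda>i. pick J (i - 1))" using *[OF dc] .
    fix i assume i: "i \<in> {1..k}"
    then have si: "\<sigma> i \<in> {1..k}" using permutes_in_image[OF \<sigma>] by blast
    have "perm_mat k \<sigma> $$ (i - 1, \<sigma> i - 1) = 1"
      using i si unfolding perm_mat_def by auto
    then have "submatrix A I J $$ (i - 1, \<sigma> i - 1) = 1" using e i si by auto
    moreover have "i - 1 < card {i. i < dim_row A \<and> i \<in> I}" "\<sigma> i - 1 < card {i. i < dim_col A \<and> i \<in> J}"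
      using dr dc i si by auto
    ultimately show "(pick I (i - 1), pick J (\<sigma> i - 1)) \<in> ones A"
      by (auto simp: ones_def submatrix_index pick_le)
  qed
next
  assume "pat_contains k \<sigma> (ones A)"
  then obtain r c where r: "strict_mono_on {1..k} r" and c: "strict_mono_on {1..k} c"
    and A: "\<And>i. i \<in> {1..k} \<Longrightarrow> (r i, c (\<sigma> i)) \<in> ones A"
    unfolding pat_contains_def by blast
  have pk: "pick (r ` {1..k}) i = r (Suc i)" if r: "strict_mono_on {1..k} r" and "i < k" for r i
  proof -
    have "{a \<in> r ` {1..k}. a < r (Suc i)} = r ` {1..i}"
      using that by (auto simp: strict_mono_on_less)
    moreover have "card (r ` {1..i}) = i"
      using strict_mono_on_imp_inj_on[OF r] that by (subst card_image) (auto elim: inj_on_subset)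
    ultimately show ?thesis
      using pick_card_in_set[of "r (Suc i)" "r ` {1..k}"] that by auto
  qed
  have cr: "c j < dim_col A" if "j \<in> {1..k}" for j
  proof -
    have "j \<in> \<sigma> ` {1..k}" using that permutes_image[OF \<sigma>] by simp
    then obtain i where "i \<in> {1..k}" "j = \<sigma> i" by (elim imageE)
    then show ?thesis using A by (auto simp: ones_def)
  qed
  have rr: "r i < dim_row A" if "i \<in> {1..k}" for i
    using A[OF that] by (auto simp: ones_def)
  have R: "{i. i < dim_row A \<and> i \<in> r ` {1..k}} = r ` {1..k}" using rr by auto
  have C: "{i. i < dim_col A \<and> i \<in> c ` {1..k}} = c ` {1..k}" using cr by auto
  have cR: "card (r ` {1..k}) = k" "card (c ` {1..k}) = k"
    using strict_mono_on_imp_inj_on[OF r] strict_mono_on_imp_inj_on[OF c] by (auto simp: card_image)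
  show "mat_contains A (perm_mat k \<sigma>)"
    unfolding mat_contains_def dim_submatrix
  proof (rule exI[of _ "r ` {1..k}"], rule exI[of _ "c ` {1..k}"], intro conjI allI impI)
    fix i j assume ij: "i < dim_row (perm_mat k \<sigma>)" "j < dim_col (perm_mat k \<sigma>)" "perm_mat k \<sigma> $$ (i, j) = 1"
    then have ij': "i < k" "j < k" "\<sigma> (Suc i) = Suc j"
      by (auto simp: perm_mat_def split: if_splits)
    have "submatrix A (r ` {1..k}) (c ` {1..k}) $$ (i, j) = A $$ (r (Suc i), c (Suc j))"
      using ij' R C cR pk[OF r] pk[OF c] by (subst submatrix_index) (simp_all del: One_nat_def)
    then show "submatrix A (r ` {1..k}) (c ` {1..k}) $$ (i, j) = 1"
      using A[of "Suc i"] ij' by (auto simp: ones_def)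
  qed (use R C cR in \<open>simp_all add: perm_mat_def del: One_nat_def\<close>)
qed

section \<open>The extremal function of a pattern and its superadditivity\<close>

lemma ex_perm_eq_Max:
  assumes \<sigma>: "\<sigma> permutes {1..k}"
  shows "ex_perm n k \<sigma> = Max (card ` {A. A \<subseteq> {..<n} \<times> {..<n} \<and> \<not> pat_contains k \<sigma> A})"
proof -
  have "{num_ones A | A. A \<in> carrier_mat n n \<and> zero_one_mat A \<and> \<not> mat_contains A (perm_mat k \<sigma>)}
      = card ` {A. A \<subseteq> {..<n} \<times> {..<n} \<and> \<not> pat_contains k \<sigma> A}" (is "?L = ?R")
  proof (rule subset_antisym)
    show "?L \<subseteq> ?R"
    proof
      fix x assume "x \<in> ?L"
      then obtain A where A: "x = num_ones A" "A \<in> carrier_mat n n" "\<not> mat_contains A (perm_mat k \<sigma>)"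
        by auto
      then have "x = card (ones A)" "ones A \<subseteq> {..<n} \<times> {..<n}" "\<not> pat_contains k \<sigma> (ones A)"
        using mat_contains_perm_mat_iff[OF \<sigma>] by (auto simp: num_ones_def ones_def)
      then show "x \<in> ?R" by blast
    qed
    show "?R \<subseteq> ?L"
    proof
      fix x assume "x \<in> ?R"
      then obtain S where S: "x = card S" "S \<subseteq> {..<n} \<times> {..<n}" "\<not> pat_contains k \<sigma> S" by auto
      define A :: "nat mat" where "A = Matrix.mat n n (\<lambda>p. if p \<in> S then 1 else 0)"
      have o: "ones A = S" using S(2) by (auto simp: ones_def A_def split: if_splits)
      have 1: "A \<in> carrier_mat n n" by (simp add: A_def)
      have 2: "zero_one_mat A"
        unfolding A_def zero_one_mat_def elements_mat_def by (auto split: if_splits)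
      have 3: "\<not> mat_contains A (perm_mat k \<sigma>)"
        unfolding mat_contains_perm_mat_iff[OF \<sigma>] o by (rule S(3))
      have "x = num_ones A" unfolding S(1) o[symmetric] num_ones_def ones_def ..
      with 1 2 3 show "x \<in> ?L" unfolding mem_Collect_eq by (intro exI[of _ A] conjI)
    qed
  qed
  then show ?thesis unfolding ex_perm_def by simp
qed

lemma finite_avoiders: "finite {A. A \<subseteq> {..<n} \<times> {..<n} \<and> \<not> pat_contains k \<sigma> A}"
proof -
  have "{A. A \<subseteq> {..<n} \<times> {..<n} \<and> \<not> pat_contains k \<sigma> A} \<subseteq> Pow ({..<n} \<times> {..<n})"
    by blast
  then show ?thesis by (rule finite_subset) simp
qed

lemma card_le_ex_perm:
  assumes "\<sigma> permutes {1..k}" "A \<subseteq> {..<n} \<times> {..<n}" "\<not> pat_contains k \<sigma> A"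
  shows "card A \<le> ex_perm n k \<sigma>"
proof -
  have "card A \<in> card ` {A. A \<subseteq> {..<n} \<times> {..<n} \<and> \<not> pat_contains k \<sigma> A}"
    using assms(2,3) by (intro imageI CollectI conjI)
  then show ?thesis
    unfolding ex_perm_eq_Max[OF assms(1)] by (rule Max_ge[OF finite_imageI[OF finite_avoiders]])
qed

text \<open>Length at least 1 makes the empty set an avoider, so the maximum ranges over a nonempty
  family.\<close>

lemma ex_perm_attained:
  assumes "\<sigma> permutes {1..k}" "k \<ge> 1"
  obtains A where "A \<subseteq> {..<n} \<times> {..<n}" "\<not> pat_contains k \<sigma> A" "card A = ex_perm n k \<sigma>"
proof -
  have "\<not> pat_contains k \<sigma> {}"
    using assms(2) unfolding pat_contains_def by (metis atLeastAtMost_iff empty_iff order_refl)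
  then have "card ` {A. A \<subseteq> {..<n} \<times> {..<n} \<and> \<not> pat_contains k \<sigma> A} \<noteq> {}" by blast
  then have "ex_perm n k \<sigma> \<in> card ` {A. A \<subseteq> {..<n} \<times> {..<n} \<and> \<not> pat_contains k \<sigma> A}"
    unfolding ex_perm_eq_Max[OF assms(1)] by (rule Max_in[OF finite_imageI[OF finite_avoiders]])
  then obtain A where "A \<subseteq> {..<n} \<times> {..<n} \<and> \<not> pat_contains k \<sigma> A" "ex_perm n k \<sigma> = card A"
    by (elim imageE) (drule CollectD)
  then show ?thesis by (intro that[of A]) auto
qed

lemma obtain_strict_mono_on:
  assumes "finite S" "k \<le> card S"
  obtains r :: "nat \<Rightarrow> nat" where "strict_mono_on {1..k} r" "r ` {1..k} \<subseteq> S"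
proof
  show "strict_mono_on {1..k} (\<lambda>i. pick S (i - 1))"
    using assms by (intro strict_mono_onI pick_mono) auto
  show "(\<lambda>i. pick S (i - 1)) ` {1..k} \<subseteq> S"
    using assms by (auto intro!: pick_in_set)
qed

lemma pat_contains_shift:
  assumes \<sigma>: "\<sigma> permutes {1..k}" and "pat_contains k \<sigma> ((\<lambda>(i, j). (i + a, j + b)) ` A)"
  shows "pat_contains k \<sigma> A"
proof -
  obtain r c where r: "strict_mono_on {1..k} r" and c: "strict_mono_on {1..k} c"
    and A: "\<And>i. i \<in> {1..k} \<Longrightarrow> (r i, c (\<sigma> i)) \<in> (\<lambda>(i, j). (i + a, j + b)) ` A"
    using assms(2) unfolding pat_contains_def by metis
  have ra: "a \<le> r i" if "i \<in> {1..k}" for i using A[OF that] by auto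
  \<comment> \<open>Every column of the occurrence carries a point because \<open>\<sigma>\<close>
    is onto; hence the truncated subtractions below are genuine ones.\<close>
  have cb: "b \<le> c j" if "j \<in> {1..k}" for j
  proof -
    have "j \<in> \<sigma> ` {1..k}" using that permutes_image[OF \<sigma>] by simp
    then obtain i where "i \<in> {1..k}" "j = \<sigma> i" by (elim imageE)
    then show ?thesis using A[of i] by auto
  qed
  show ?thesis
    unfolding pat_contains_def
  proof (intro exI conjI ballI)
    show "strict_mono_on {1..k} (\<lambda>i. r i - a)"
      using ra strict_mono_onD[OF r] by (intro strict_mono_onI diff_less_mono) blast+
    show "strict_mono_on {1..k} (\<lambda>i. c i - b)"
      using cb strict_mono_onD[OF c] by (intro strict_mono_onI diff_less_mono) blast+
    show "(r i - a, c (\<sigma> i) - b) \<in> A" if "i \<in> {1..k}" for i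
      using A[OF that] by auto
  qed
qed

text \<open>An occurrence that meets both parts has its first point in \<open>A\<close> and its last
  in \<open>B\<close>, since all rows of \<open>A\<close> precede those of \<open>B\<close>. The
  columns of these two points are then ordered oppositely to \<open>\<sigma> 1\<close> and
  \<open>\<sigma> k\<close>, which differ as \<open>k \<ge> 2\<close>.\<close>

lemma not_pat_contains_Un:
  assumes \<sigma>: "\<sigma> permutes {1..k}" and k: "k \<ge> 2"
    and A: "\<not> pat_contains k \<sigma> A" and B: "\<not> pat_contains k \<sigma> B"
    and row: "\<And>x y x' y'. (x, y) \<in> A \<Longrightarrow> (x', y') \<in> B \<Longrightarrow> x < x'"
    and col: "\<And>x y x' y'. (x, y) \<in> A \<Longrightarrow> (x', y') \<in> B \<Longrightarrow> y < y' \<longleftrightarrow> \<sigma> k < \<sigma> 1"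
  shows "\<not> pat_contains k \<sigma> (A \<union> B)"
proof
  assume "pat_contains k \<sigma> (A \<union> B)"
  then obtain r c where r: "strict_mono_on {1..k} r" and c: "strict_mono_on {1..k} c"
    and AB: "\<And>i. i \<in> {1..k} \<Longrightarrow> (r i, c (\<sigma> i)) \<in> A \<union> B"
    unfolding pat_contains_def by metis
  have "\<not> (\<forall>i\<in>{1..k}. (r i, c (\<sigma> i)) \<in> A)" "\<not> (\<forall>i\<in>{1..k}. (r i, c (\<sigma> i)) \<in> B)"
    using A B r c unfolding pat_contains_def by metis+
  then obtain i i' where i: "i \<in> {1..k}" "(r i, c (\<sigma> i)) \<in> A" and i': "i' \<in> {1..k}" "(r i', c (\<sigma> i')) \<in> B"
    using AB by blast
  have k1: "1 \<in> {1..k}" "k \<in> {1..k}" using k by auto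
  have le: "r a \<le> r b" if "a \<in> {1..k}" "b \<in> {1..k}" "a \<le> b" for a b
    using strict_mono_on_leD[OF r that] .
  have "(r 1, c (\<sigma> 1)) \<in> A"
  proof (rule ccontr)
    assume "(r 1, c (\<sigma> 1)) \<notin> A"
    then have "(r 1, c (\<sigma> 1)) \<in> B" using AB[OF k1(1)] by blast
    from row[OF i(2) this] le[OF k1(1) i(1)] i(1) show False by simp
  qed
  moreover have "(r k, c (\<sigma> k)) \<in> B"
  proof (rule ccontr)
    assume "(r k, c (\<sigma> k)) \<notin> B"
    then have "(r k, c (\<sigma> k)) \<in> A" using AB[OF k1(2)] by blast
    from row[OF this i'(2)] le[OF i'(1) k1(2)] i'(1) show False by simp
  qed
  ultimately have "c (\<sigma> 1) < c (\<sigma> k) \<longleftrightarrow> \<sigma> k < \<sigma> 1" by (rule col)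
  moreover have "\<sigma> 1 \<in> {1..k}" "\<sigma> k \<in> {1..k}" using k1 permutes_in_image[OF \<sigma>] by blast+
  then have "c (\<sigma> 1) < c (\<sigma> k) \<longleftrightarrow> \<sigma> 1 < \<sigma> k" by (rule strict_mono_on_less[OF c])
  moreover have "\<sigma> 1 \<noteq> \<sigma> k"
    using injD[OF permutes_inj[OF \<sigma>], of 1 k] k by linarith
  ultimately show False by linarith
qed

text \<open>The diagonal sum of two matrices avoiding \<open>\<sigma>\<close> avoids \<open>\<sigma>\<close> if \<open>\<sigma> 1 > \<sigma> k\<close>,
  and the antidiagonal sum does if \<open>\<sigma> 1 < \<sigma> k\<close>.\<close>

lemma ex_perm_superadditive:
  assumes \<sigma>: "\<sigma> permutes {1..k}" and k: "k \<ge> 2"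
  shows "ex_perm m k \<sigma> + ex_perm n k \<sigma> \<le> ex_perm (m + n) k \<sigma>"
proof -
  have k1: "k \<ge> 1" using k by simp
  obtain A where A: "A \<subseteq> {..<m} \<times> {..<m}" "\<not> pat_contains k \<sigma> A" "card A = ex_perm m k \<sigma>"
    by (rule ex_perm_attained[OF \<sigma> k1])
  obtain B where B: "B \<subseteq> {..<n} \<times> {..<n}" "\<not> pat_contains k \<sigma> B" "card B = ex_perm n k \<sigma>"
    by (rule ex_perm_attained[OF \<sigma> k1])
  define a where "a = (if \<sigma> k < \<sigma> 1 then 0 else n)"
  define b where "b = (if \<sigma> k < \<sigma> 1 then m else 0)"
  define A' where "A' = (\<lambda>(i, j). (i + 0, j + a)) ` A"
  define B' where "B' = (\<lambda>(i, j). (i + m, j + b)) ` B"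
  have fin: "finite A" "finite B" using A(1) B(1) finite_subset by blast+
  have cA: "card A' = card A" unfolding A'_def by (rule card_image) (auto simp: inj_on_def)
  have cB: "card B' = card B" unfolding B'_def by (rule card_image) (auto simp: inj_on_def)
  have "\<not> pat_contains k \<sigma> (A' \<union> B')"
  proof (rule not_pat_contains_Un[OF \<sigma> k])
    show "\<not> pat_contains k \<sigma> A'"
      using A(2) pat_contains_shift[OF \<sigma>, of 0 a A] unfolding A'_def by argo
    show "\<not> pat_contains k \<sigma> B'"
      using B(2) pat_contains_shift[OF \<sigma>, of m b B] unfolding B'_def by argo
    fix x y x' y' assume *: "(x, y) \<in> A'" "(x', y') \<in> B'"
    then show "x < x'" using A(1) by (auto simp: A'_def B'_def)
    show "y < y' \<longleftrightarrow> \<sigma> k < \<sigma> 1"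
      using * A(1) B(1) by (auto simp: A'_def B'_def a_def b_def split: if_splits)
  qed
  moreover have "A' \<union> B' \<subseteq> {..<m + n} \<times> {..<m + n}"
    using A(1) B(1) by (auto simp: A'_def B'_def a_def b_def)
  ultimately have "card (A' \<union> B') \<le> ex_perm (m + n) k \<sigma>"
    using card_le_ex_perm[OF \<sigma>] by blast
  moreover have "A' \<inter> B' = {}" using A(1) by (auto simp: A'_def B'_def)
  then have "card (A' \<union> B') = card A' + card B'"
    using fin by (intro card_Un_disjoint) (auto simp: A'_def B'_def)
  ultimately show ?thesis using cA cB A(3) B(3) by simp
qed

lemma ex_perm_mult_le:
  assumes \<sigma>: "\<sigma> permutes {1..k}" and k: "k \<ge> 2"
  shows "q * ex_perm n k \<sigma> \<le> ex_perm (q * n) k \<sigma>"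
proof (induction q)
  case (Suc q)
  then show ?case using ex_perm_superadditive[OF assms, of n "q * n"] by simp
qed simp

lemma ex_perm_mono:
  assumes \<sigma>: "\<sigma> permutes {1..k}" and k: "k \<ge> 2" and "m \<le> n"
  shows "ex_perm m k \<sigma> \<le> ex_perm n k \<sigma>"
  using ex_perm_superadditive[OF \<sigma> k, of m "n - m"] \<open>m \<le> n\<close> by simp

text \<open>Transposing a matrix inverts the pattern; this lets statements about columns of blocks
  be reused for rows.\<close>

lemma pat_contains_converse:
  assumes \<sigma>: "\<sigma> permutes {1..k}" and "pat_contains k (inv_into UNIV \<sigma>) (A\<inverse>)"
  shows "pat_contains k \<sigma> A"
proof -
  obtain r c where r: "strict_mono_on {1..k} r" and c: "strict_mono_on {1..k} c"
    and A: "\<And>i. i \<in> {1..k} \<Longrightarrow> (r i, c (inv_into UNIV \<sigma> i)) \<in> A\<inverse>"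
    using assms(2) unfolding pat_contains_def by metis
  have "(c j, r (\<sigma> j)) \<in> A" if "j \<in> {1..k}" for j
  proof -
    have "\<sigma> j \<in> {1..k}" using that permutes_in_image[OF \<sigma>] by blast
    from A[OF this] show ?thesis unfolding permutes_inverses(2)[OF \<sigma>] by (rule converseD)
  qed
  with r c show ?thesis unfolding pat_contains_def by blast
qed

section \<open>The block argument of Marcus and Tardos\<close>

definition block :: "nat \<Rightarrow> nat \<times> nat \<Rightarrow> nat \<times> nat" where
  "block s p = (fst p div s, snd p div s)"

lemma div_less_imp_less: "(a::nat) div s < b div s \<Longrightarrow> a < b"
  by (metis div_le_mono not_less)

text \<open>One point of \<open>A\<close> chosen from each block of an occurrence gives an
  occurrence in \<open>A\<close>: blocks in different block rows or block columns force a strict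
  order on the coordinates of their points.\<close>

lemma pat_contains_block:
  assumes \<sigma>: "\<sigma> permutes {1..k}" and "pat_contains k \<sigma> (block s ` A)"
  shows "pat_contains k \<sigma> A"
proof -
  obtain r c where r: "strict_mono_on {1..k} r" and c: "strict_mono_on {1..k} c"
    and A: "\<And>i. i \<in> {1..k} \<Longrightarrow> (r i, c (\<sigma> i)) \<in> block s ` A"
    using assms(2) unfolding pat_contains_def by metis
  have "\<exists>x y. (x, y) \<in> A \<and> x div s = r i \<and> y div s = c (\<sigma> i)" if "i \<in> {1..k}" for i
    using A[OF that] by (force simp: block_def)
  then obtain x y where xy: "\<And>i. i \<in> {1..k} \<Longrightarrow> (x i, y i) \<in> A \<and> x i div s = r i \<and> y i div s = c (\<sigma> i)"
    by metis
  have inv': "inv_into UNIV \<sigma> j \<in> {1..k}" "\<sigma> (inv_into UNIV \<sigma> j) = j" if "j \<in> {1..k}" for j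
    using that permutes_in_image[OF permutes_inv[OF \<sigma>]] permutes_inverses[OF \<sigma>] by blast+
  show ?thesis
    unfolding pat_contains_def
  proof (intro exI conjI ballI)
    show "strict_mono_on {1..k} x"
    proof (rule strict_mono_onI)
      fix i j assume ij: "i \<in> {1..k}" "j \<in> {1..k}" "i < j"
      then have "r i < r j" by (rule strict_mono_onD[OF r])
      then show "x i < x j" using xy[OF ij(1)] xy[OF ij(2)] div_less_imp_less by metis
    qed
    show "strict_mono_on {1..k} (\<lambda>j. y (inv_into UNIV \<sigma> j))"
    proof (rule strict_mono_onI)
      fix i j assume ij: "i \<in> {1..k}" "j \<in> {1..k}" "i < j"
      then have "c i < c j" by (rule strict_mono_onD[OF c])
      moreover have "y (inv_into UNIV \<sigma> i) div s = c i" "y (inv_into UNIV \<sigma> j) div s = c j"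
        using xy[OF inv'(1)] inv'(2) ij by auto
      ultimately show "y (inv_into UNIV \<sigma> i) < y (inv_into UNIV \<sigma> j)" using div_less_imp_less by metis
    qed
    show "(x i, y (inv_into UNIV \<sigma> (\<sigma> i))) \<in> A" if "i \<in> {1..k}" for i
      using xy[OF that] unfolding permutes_inverses(2)[OF \<sigma>] by (rule conjunct1)
  qed
qed

text \<open>Pigeonhole within one column of blocks: attach to each wide block \<open>k\<close> of
  the columns it meets, which leaves \<open>s choose k\<close> possibilities. If \<open>k\<close>
  blocks shared the same \<open>k\<close> columns, they would contain every pattern of length
  \<open>k\<close>. The factor \<open>N\<close> counts the columns of blocks.\<close>

lemma card_wide_blocks_le:
  assumes \<sigma>: "\<sigma> permutes {1..k}" and s: "s > 0" and A: "A \<subseteq> {..<s * N} \<times> {..<s * N}"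
    and av: "\<not> pat_contains k \<sigma> A"
  shows "card {q \<in> block s ` A. k \<le> card (snd ` {p \<in> A. block s p = q})} \<le> N * ((s choose k) * k)"
proof -
  define W where "W = {q \<in> block s ` A. k \<le> card (snd ` {p \<in> A. block s p = q})}"
  have fin: "finite A" using A finite_subset by blast
  have finW: "finite W" using fin by (simp add: W_def)
  have col: "card {q \<in> W. snd q = j} \<le> (s choose k) * k" for j
  proof -
    define V where "V = {q \<in> W. snd q = j}"
    define cols where "cols q = snd ` {p \<in> A. block s p = q}" for q
    have "\<exists>T. T \<subseteq> cols q \<and> card T = k" if "q \<in> V" for q
    proof -
      have "k \<le> card (cols q)" using that by (simp add: V_def W_def cols_def)
      then obtain T where "T \<subseteq> cols q" "card T = k" by (rule obtain_subset_with_card_n)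
      then show ?thesis by blast
    qed
    then obtain f where f: "\<And>q. q \<in> V \<Longrightarrow> f q \<subseteq> cols q \<and> card (f q) = k" by metis
    define X where "X = {s * j..<s * j + s}"
    have sub: "cols q \<subseteq> X" if "q \<in> V" for q
    proof
      fix y assume "y \<in> cols q"
      then have "y div s = j" using that by (auto simp: cols_def V_def block_def)
      then show "y \<in> X"
        using s by (auto simp: X_def) (metis add.commute dividend_less_div_times mult.commute)
    qed
    have fV: "f ` V \<subseteq> {T. T \<subseteq> X \<and> card T = k}" using f sub by fastforce
    have fib: "card {q \<in> V. f q = T} \<le> k" for T
    proof (rule ccontr)
      assume neg: "\<not> card {q \<in> V. f q = T} \<le> k"
      have "card (fst ` {q \<in> V. f q = T}) = card {q \<in> V. f q = T}"
        by (rule card_image) (auto simp: inj_on_def V_def prod_eq_iff)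
      with neg have "k \<le> card (fst ` {q \<in> V. f q = T})" by linarith
      moreover have "finite (fst ` {q \<in> V. f q = T})" using finW by (simp add: V_def)
      ultimately obtain r where r: "strict_mono_on {1..k} r" "r ` {1..k} \<subseteq> fst ` {q \<in> V. f q = T}"
        using obtain_strict_mono_on by metis
      have "{q \<in> V. f q = T} \<noteq> {}" using neg by (metis card.empty le0)
      then obtain q0 where q0: "q0 \<in> V" "f q0 = T" by blast
      then have "card T = k" "T \<subseteq> X" using f[OF q0(1)] sub[OF q0(1)] by auto
      then have "k \<le> card T" "finite T" using finite_subset[of T X] by (simp_all add: X_def)
      then obtain c where c: "strict_mono_on {1..k} c" "c ` {1..k} \<subseteq> T"
        using obtain_strict_mono_on by metis
      \<comment> \<open>Each of the chosen blocks meets all columns of \<open>T\<close>, so the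
        \<open>i\<close>-th block can supply the point in whichever column \<open>\<sigma>\<close>
        asks for.\<close>
      have "\<exists>x. (x, c (\<sigma> i)) \<in> A \<and> x div s = r i" if i: "i \<in> {1..k}" for i
      proof -
        have "r i \<in> fst ` {q \<in> V. f q = T}" using r(2) i by (rule subsetD[OF _ imageI])
        then obtain q where "r i = fst q" "q \<in> {q \<in> V. f q = T}" by (rule imageE)
        then have q: "q \<in> V" "f q = T" "r i = fst q" by simp_all
        from q(1) have "snd q = j" by (simp add: V_def)
        with q(3) have "(r i, j) = q" by (metis prod.collapse)
        with q(1,2) have rj: "(r i, j) \<in> V" "f (r i, j) = T" by simp_all
        have "\<sigma> i \<in> {1..k}" using i permutes_in_image[OF \<sigma>] by simp
        with c(2) have "c (\<sigma> i) \<in> T" by (rule subsetD[OF _ imageI])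
        then have "c (\<sigma> i) \<in> cols (r i, j)" using f[OF rj(1)] rj(2) by blast
        then show ?thesis by (auto simp: cols_def block_def)
      qed
      then obtain x where x: "\<And>i. i \<in> {1..k} \<Longrightarrow> (x i, c (\<sigma> i)) \<in> A \<and> x i div s = r i" by metis
      have "strict_mono_on {1..k} x"
      proof (rule strict_mono_onI)
        fix a b assume ab: "a \<in> {1..k}" "b \<in> {1..k}" "a < b"
        then have "r a < r b" by (rule strict_mono_onD[OF r(1)])
        then show "x a < x b" using x[OF ab(1)] x[OF ab(2)] div_less_imp_less by metis
      qed
      then have "pat_contains k \<sigma> A" using c(1) x unfolding pat_contains_def by blast
      then show False using av by contradiction
    qed
    have "card V \<le> (\<Sum>T\<in>f ` V. card {q \<in> V. f q = T})"
    proof -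
      have "V = (\<Union>T\<in>f ` V. {q \<in> V. f q = T})" by blast
      moreover have "finite V" using finW by (simp add: V_def)
      ultimately show ?thesis using card_UN_le[of "f ` V" "\<lambda>T. {q \<in> V. f q = T}"] by simp
    qed
    also have "\<dots> \<le> card (f ` V) * k"
      using sum_bounded_above[of "f ` V" "\<lambda>T. card {q \<in> V. f q = T}" k] fib by simp
    also have "card (f ` V) \<le> card {T. T \<subseteq> X \<and> card T = k}"
      using fV by (intro card_mono) (auto simp: X_def)
    also have "card {T. T \<subseteq> X \<and> card T = k} = s choose k"
      using n_subsets[of X k] by (simp add: X_def)
    finally show ?thesis by (simp add: V_def)
  qed
  have "W = (\<Union>j<N. {q \<in> W. snd q = j})"
  proof -
    have "snd q < N" if "q \<in> W" for q
      using that A by (auto simp: W_def block_def less_mult_imp_div_less mult.commute)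
    then show ?thesis by blast
  qed
  then have "card W \<le> (\<Sum>j<N. card {q \<in> W. snd q = j})"
    using card_UN_le[of "{..<N}" "\<lambda>j. {q \<in> W. snd q = j}"] by simp
  also have "\<dots> \<le> N * ((s choose k) * k)"
    using sum_bounded_above[of "{..<N}" "\<lambda>j. card {q \<in> W. snd q = j}"] col by simp
  finally show ?thesis by (simp add: W_def)
qed

text \<open>Transposition exchanges tall and wide blocks; the pattern becomes the inverse of
  \<open>\<sigma>\<close>, but the bound depends only on the length.\<close>

lemma card_tall_blocks_le:
  assumes \<sigma>: "\<sigma> permutes {1..k}" and s: "s > 0" and A: "A \<subseteq> {..<s * N} \<times> {..<s * N}"
    and av: "\<not> pat_contains k \<sigma> A"
  shows "card {q \<in> block s ` A. k \<le> card (fst ` {p \<in> A. block s p = q})} \<le> N * ((s choose k) * k)"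
proof -
  let ?T = "{q \<in> block s ` A. k \<le> card (fst ` {p \<in> A. block s p = q})}"
  let ?W = "{q \<in> block s ` (A\<inverse>). k \<le> card (snd ` {p \<in> A\<inverse>. block s p = q})}"
  have swap: "A\<inverse> = prod.swap ` A" by auto
  have blk: "block s (prod.swap p) = prod.swap (block s p)" for p by (simp add: block_def)
  have *: "snd ` {p \<in> A\<inverse>. block s p = prod.swap q} = fst ` {p \<in> A. block s p = q}" for q
  proof -
    have "{p \<in> A\<inverse>. block s p = prod.swap q} = prod.swap ` {p \<in> A. block s p = q}"
    proof (intro subset_antisym subsetI)
      fix p assume "p \<in> {p \<in> A\<inverse>. block s p = prod.swap q}"
      then have "prod.swap p \<in> A" "block s (prod.swap p) = q" unfolding blk by auto
      then have "prod.swap p \<in> {p \<in> A. block s p = q}" by simp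
      then have "prod.swap (prod.swap p) \<in> prod.swap ` {p \<in> A. block s p = q}" by (rule imageI)
      then show "p \<in> prod.swap ` {p \<in> A. block s p = q}" by simp
    next
      fix p assume "p \<in> prod.swap ` {p \<in> A. block s p = q}"
      then obtain p' where "p = prod.swap p'" "p' \<in> A" "block s p' = q" by blast
      then show "p \<in> {p \<in> A\<inverse>. block s p = prod.swap q}" by (auto simp: swap blk)
    qed
    then show ?thesis by (simp add: image_image)
  qed
  have blkA: "block s ` (A\<inverse>) = prod.swap ` (block s ` A)"
    unfolding swap image_image blk ..
  have "prod.swap ` ?T \<subseteq> ?W"
  proof
    fix q assume "q \<in> prod.swap ` ?T"
    then obtain q' where q': "q = prod.swap q'" "q' \<in> ?T" by (rule imageE)
    from q'(2) have "q' \<in> block s ` A" by fast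
    then have "q \<in> block s ` (A\<inverse>)" unfolding blkA q'(1) by (rule imageI)
    moreover have "k \<le> card (snd ` {p \<in> A\<inverse>. block s p = q})"
      using q'(2) unfolding q'(1) * by simp
    ultimately show "q \<in> ?W" by simp
  qed
  moreover have fin: "finite A" using A finite_subset by blast
  then have "finite ?W" by simp
  ultimately have "card (prod.swap ` ?T) \<le> card ?W" by (intro card_mono)
  moreover have "card (prod.swap ` ?T) = card ?T" by (rule card_image) simp
  moreover have "card ?W \<le> N * ((s choose k) * k)"
  proof (rule card_wide_blocks_le[OF permutes_inv[OF \<sigma>] s])
    show "A\<inverse> \<subseteq> {..<s * N} \<times> {..<s * N}" using A by auto
    show "\<not> pat_contains k (inv_into UNIV \<sigma>) (A\<inverse>)" using pat_contains_converse[OF \<sigma>] av by metis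
  qed
  ultimately show ?thesis by simp
qed

text \<open>Wide and tall blocks are few, and each holds at most \<open>s\<^sup>2\<close> ones. Any
  other nonempty block meets fewer than \<open>k\<close> rows and fewer than \<open>k\<close>
  columns, and there are at most \<open>ex_perm N k \<sigma>\<close> nonempty blocks because
  contraction preserves avoidance.\<close>

lemma ex_perm_block_recursion:
  assumes \<sigma>: "\<sigma> permutes {1..k}" and k: "k \<ge> 1" and s: "s > 0"
  shows "ex_perm (s * N) k \<sigma> \<le> (k - 1)\<^sup>2 * ex_perm N k \<sigma> + 2 * (N * ((s choose k) * k)) * s\<^sup>2"
proof -
  obtain A where A: "A \<subseteq> {..<s * N} \<times> {..<s * N}" "\<not> pat_contains k \<sigma> A" "card A = ex_perm (s * N) k \<sigma>"
    by (rule ex_perm_attained[OF \<sigma> k])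
  define S where "S q = {p \<in> A. block s p = q}" for q
  define W where "W = {q \<in> block s ` A. k \<le> card (snd ` S q)}"
  define T where "T = {q \<in> block s ` A. k \<le> card (fst ` S q)}"
  have fin: "finite A" using A(1) finite_subset by blast
  then have finS: "finite (S q)" for q by (simp add: S_def)
  have finB: "finite (block s ` A)" using fin by simp
  have cW: "card W \<le> N * ((s choose k) * k)"
    using card_wide_blocks_le[OF \<sigma> s A(1,2)] by (simp add: W_def S_def)
  have cT: "card T \<le> N * ((s choose k) * k)"
    using card_tall_blocks_le[OF \<sigma> s A(1,2)] by (simp add: T_def S_def)
  have cB: "card (block s ` A) \<le> ex_perm N k \<sigma>"
  proof (rule card_le_ex_perm[OF \<sigma>])
    show "block s ` A \<subseteq> {..<N} \<times> {..<N}"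
      using A(1) by (auto simp: block_def less_mult_imp_div_less mult.commute)
    show "\<not> pat_contains k \<sigma> (block s ` A)" using pat_contains_block[OF \<sigma>] A(2) by metis
  qed
  have Ssub: "S q \<subseteq> fst ` S q \<times> snd ` S q" for q by force
  have small: "card (S q) \<le> (k - 1)\<^sup>2" if "q \<in> block s ` A" "q \<notin> W" "q \<notin> T" for q
  proof -
    have "card (S q) \<le> card (fst ` S q \<times> snd ` S q)"
      by (rule card_mono[OF _ Ssub]) (simp add: finS)
    also have "\<dots> = card (fst ` S q) * card (snd ` S q)" by (rule card_cartesian_product)
    also have "\<dots> \<le> (k - 1) * (k - 1)"
      using that by (intro mult_mono) (auto simp: W_def T_def)
    finally show ?thesis by (simp add: power2_eq_square)
  qed
  have big: "card (S q) \<le> s\<^sup>2" for q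
  proof -
    have dv: "{x. x div s = m} \<subseteq> {s * m..<s * m + s}" for m
    proof
      fix x assume "x \<in> {x. x div s = m}"
      then have "s * m + x mod s = x" using mult_div_mod_eq[of s x] by simp
      then show "x \<in> {s * m..<s * m + s}" using mod_less_divisor[OF s, of x] by simp
    qed
    have "S q \<subseteq> {s * fst q..<s * fst q + s} \<times> {s * snd q..<s * snd q + s}"
    proof
      fix p assume "p \<in> S q"
      then have "fst p div s = fst q" "snd p div s = snd q" by (auto simp: S_def block_def)
      then show "p \<in> {s * fst q..<s * fst q + s} \<times> {s * snd q..<s * snd q + s}"
        using dv[of "fst q"] dv[of "snd q"] by (auto simp: mem_Times_iff)
    qed
    then have "card (S q) \<le> card ({s * fst q..<s * fst q + s} \<times> {s * snd q..<s * snd q + s})"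
      by (intro card_mono) auto
    then show ?thesis by (simp add: power2_eq_square)
  qed
  have "A = (\<Union>q\<in>block s ` A. S q)" by (auto simp: S_def)
  then have "card A \<le> (\<Sum>q\<in>block s ` A. card (S q))"
    using card_UN_le[OF finB, of S] by simp
  also have "\<dots> = (\<Sum>q\<in>W \<union> T. card (S q)) + (\<Sum>q\<in>block s ` A - (W \<union> T). card (S q))"
    using finB by (subst sum.subset_diff[of "W \<union> T"]) (auto simp: W_def T_def)
  also have "(\<Sum>q\<in>W \<union> T. card (S q)) \<le> card (W \<union> T) * s\<^sup>2"
    using sum_bounded_above[of "W \<union> T" "\<lambda>q. card (S q)" "s\<^sup>2"] big by simp
  also have "card (W \<union> T) \<le> 2 * (N * ((s choose k) * k))"
    using card_Un_le[of W T] cW cT by simp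
  also have "(\<Sum>q\<in>block s ` A - (W \<union> T). card (S q)) \<le> card (block s ` A - (W \<union> T)) * (k - 1)\<^sup>2"
    using sum_bounded_above[of "block s ` A - (W \<union> T)" "\<lambda>q. card (S q)" "(k - 1)\<^sup>2"] small by simp
  also have "card (block s ` A - (W \<union> T)) \<le> ex_perm N k \<sigma>"
    using cB card_mono[OF finB, of "block s ` A - (W \<union> T)"] by simp
  finally show ?thesis using A(3) by (simp add: mult.commute)
qed

text \<open>The theorem of Marcus and Tardos, first along powers of \<open>k\<^sup>2\<close>, where the block recursion
  has no remainder terms; superadditivity extends it to all lengths.\<close>

lemma ex_perm_linear_bound:
  assumes \<sigma>: "\<sigma> permutes {1..k}" and k: "k \<ge> 2"
  obtains K where "\<And>n. ex_perm n k \<sigma> \<le> K * n"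
proof -
  \<comment> \<open>With this \<open>s\<close>, \<open>(k - 1)\<^sup>2 + 1 \<le> s\<close>: the
    spare unit absorbs the wide and tall blocks, whose contribution is at most
    \<open>D * s ^ t\<close>. The summand 1 in \<open>D\<close> covers the base case.\<close>
  define s where "s = k\<^sup>2"
  define D where "D = 1 + 2 * ((s choose k) * k) * s\<^sup>2"
  have s: "s > 1" using one_less_power[of k 2] k by (simp add: s_def)
  have k1: "k \<ge> 1" using k by simp
  have pow: "ex_perm (s ^ t) k \<sigma> \<le> D * s ^ t" for t
  proof (induction t)
    case 0
    obtain A where "A \<subseteq> {..<1} \<times> {..<1}" "\<not> pat_contains k \<sigma> A" "card A = ex_perm 1 k \<sigma>"
      by (rule ex_perm_attained[OF \<sigma> k1])
    then have "ex_perm 1 k \<sigma> \<le> 1" using card_mono[of "{..<1::nat} \<times> {..<1::nat}" A] by simp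
    then show ?case by (simp add: D_def)
  next
    case (Suc t)
    have "ex_perm (s * s ^ t) k \<sigma> \<le> (k - 1)\<^sup>2 * ex_perm (s ^ t) k \<sigma> + 2 * (s ^ t * ((s choose k) * k)) * s\<^sup>2"
      using k s by (intro ex_perm_block_recursion[OF \<sigma>]) auto
    also have "\<dots> \<le> (k - 1)\<^sup>2 * (D * s ^ t) + D * s ^ t"
      using Suc.IH by (intro add_mono mult_left_mono) (simp_all add: D_def algebra_simps)
    also have "\<dots> = ((k - 1)\<^sup>2 + 1) * (D * s ^ t)" by simp
    also have "(k - 1)\<^sup>2 + 1 \<le> s"
    proof -
      obtain l where "k = Suc l" using k by (cases k) auto
      then show ?thesis by (simp add: s_def power2_eq_square)
    qed
    finally show ?case by (simp add: algebra_simps)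
  qed
  have "ex_perm n k \<sigma> \<le> (2 * D) * n" for n
  proof (cases "n = 0")
    case True
    obtain A where "A \<subseteq> {..<0} \<times> {..<0}" "\<not> pat_contains k \<sigma> A" "card A = ex_perm 0 k \<sigma>"
      by (rule ex_perm_attained[OF \<sigma> k1])
    then show ?thesis using True by simp
  next
    case False
    \<comment> \<open>\<open>q\<close> diagonal copies of length \<open>n\<close> fit into length
      \<open>s ^ n\<close>, so the bound at the power descends to \<open>n\<close>; rounding
      \<open>s ^ n\<close> up to \<open>(q + 1) * n\<close> costs at most a factor 2.\<close>
    define q where "q = s ^ n div n"
    have "n \<le> s ^ n" using power_gt_expt[of s n] s by simp
    then have q: "q \<ge> 1" using False by (simp add: q_def div_greater_zero_iff Suc_le_eq)
    have "q * ex_perm n k \<sigma> \<le> ex_perm (q * n) k \<sigma>" by (rule ex_perm_mult_le[OF \<sigma> k])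
    also have "\<dots> \<le> ex_perm (s ^ n) k \<sigma>" by (rule ex_perm_mono[OF \<sigma> k]) (simp add: q_def)
    also have "\<dots> \<le> D * s ^ n" by (rule pow)
    also have "s ^ n \<le> (q + 1) * n"
      using False dividend_less_div_times[of n "s ^ n"] by (simp add: q_def)
    also have "(q + 1) * n \<le> (2 * q) * n" using q by (intro mult_right_mono) auto
    finally have "q * ex_perm n k \<sigma> \<le> q * (2 * D * n)" by (simp add: algebra_simps)
    then show ?thesis using q by simp
  qed
  then show ?thesis by (rule that)
qed

section \<open>Fekete's lemma and the Fueredi-Hajnal constant\<close>

lemma superadditive_mult_le:
  fixes u :: "nat \<Rightarrow> real"
  assumes "\<And>m n. u m + u n \<le> u (m + n)" and "\<And>n. 0 \<le> u n"
  shows "real q * u n \<le> u (q * n)"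
proof (induction q)
  case (Suc q)
  then show ?case using assms(1)[of n "q * n"] by (simp add: algebra_simps)
qed (use assms(2)[of 0] in simp)

text \<open>For superadditive sequences the limit of \<open>u n / n\<close> is its supremum, hence
  an upper bound for every single quotient. The linear bound keeps the supremum finite.\<close>

lemma Fekete_superadditive_le_lim:
  fixes u :: "nat \<Rightarrow> real"
  assumes sup: "\<And>m n. u m + u n \<le> u (m + n)" and nn: "\<And>n. 0 \<le> u n" and K: "\<And>n. u n \<le> K * real n"
  shows "u n \<le> lim (\<lambda>n. u n / real n) * real n"
proof -
  define L where "L = (SUP n. u n / real n)"
  have K0: "0 \<le> K" using nn[of 1] K[of 1] by simp
  have le: "u n / real n \<le> K" for n
  proof (cases "n = 0")
    case False
    then show ?thesis using K[of n] by (simp add: divide_le_eq)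
  qed (simp add: K0)
  then have bdd: "bdd_above (range (\<lambda>n. u n / real n))" by (auto intro!: bdd_aboveI)
  have upper: "u n / real n \<le> L" for n unfolding L_def by (rule cSUP_upper[OF UNIV_I bdd])
  have "(\<lambda>n. u n / real n) \<longlonglongrightarrow> L"
  proof (rule LIMSEQ_I)
    fix e :: real assume e: "0 < e"
    have "L - e / 2 < L" using e by simp
    then obtain m where m: "L - e / 2 < u m / real m"
      unfolding L_def using less_cSUP_iff[OF _ bdd] by auto
    have L0: "0 \<le> L" using upper[of 0] by simp
    \<comment> \<open>Beyond \<open>N\<close>, the incomplete last stretch of length below
      \<open>m\<close> costs at most \<open>m * (L + 1)\<close>, which is less than
      \<open>n * e / 2\<close>; the other half of \<open>e\<close> pays for the choice of
      \<open>m\<close>.\<close>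
    obtain N where N: "2 * real m * (L + 1) / e < real N" using reals_Archimedean2 by metis
    show "\<exists>no. \<forall>n\<ge>no. norm (u n / real n - L) < e"
    proof (intro exI[of _ "max N 1"] allI impI)
      fix n assume "max N 1 \<le> n"
      then have n: "N \<le> n" and n0: "0 < real n" by simp_all
      have "L - e < u n / real n"
      proof (cases "m = 0")
        \<comment> \<open>Division by zero makes the quotient at index 0 equal to 0, so this index
          can be the near-optimal one only if \<open>L < e / 2\<close>.\<close>
        case True
        then have "L < e / 2" using m by simp
        then show ?thesis using nn[of n] n0 e by (smt (verit) divide_nonneg_pos field_sum_of_halves)
      next
        case False
        define q where "q = n div m"
        have nq: "real n - real m \<le> real q * real m"
        proof -
          have "n < q * m + m" using False dividend_less_div_times[of m n] by (simp add: q_def)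
          then have "real n < real (q * m + m)" by (rule less_imp_of_nat_less)
          then show ?thesis by simp
        qed
        have mono: "u (q * m) \<le> u n"
          using sup[of "q * m" "n mod m"] nn[of "n mod m"] by (simp add: q_def)
        have "(real n - real m) * (u m / real m) \<le> (real q * real m) * (u m / real m)"
          using nq nn[of m] by (intro mult_right_mono) auto
        also have "\<dots> = real q * u m" using False by simp
        also have "\<dots> \<le> u (q * m)" by (rule superadditive_mult_le[OF sup nn])
        also note mono
        finally have 1: "(real n - real m) * (u m / real m) \<le> u n" .
        have "real m * (u m / real m) \<le> real m * (L + 1)"
          using upper[of m] by (intro mult_left_mono) auto
        moreover have "real n * (u m / real m) \<ge> real n * (L - e / 2)"
          using m by (intro mult_left_mono) auto
        ultimately have 2: "real n * (L - e / 2) - real m * (L + 1) \<le> u n"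
          using 1 unfolding left_diff_distrib[of "real n"] by linarith
        have "2 * real m * (L + 1) / e < real n" using N n by linarith
        then have "real m * (L + 1) < real n * (e / 2)" using e by (simp add: divide_less_eq algebra_simps)
        with 2 have "real n * (L - e) < u n" by (simp add: algebra_simps)
        then show ?thesis using n0 by (simp add: less_divide_eq mult.commute)
      qed
      then show "norm (u n / real n - L) < e" using upper[of n] by (simp add: abs_if)
    qed
  qed
  then have "lim (\<lambda>n. u n / real n) = L" by (rule limI)
  moreover have "u n \<le> L * real n"
  proof (cases "n = 0")
    case True
    then show ?thesis using K[of 0] by simp
  next
    case False
    then show ?thesis using upper[of n] by (simp add: divide_le_eq)
  qed
  ultimately show ?thesis by simp
qed

lemma ex_perm_le_Fueredi_Hajnal:
  assumes \<sigma>: "\<sigma> permutes {1..k}" and k: "k \<ge> 2"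
  shows "real (ex_perm n k \<sigma>) \<le> Fueredi_Hajnal_constant k \<sigma> * real n"
proof -
  obtain K where K: "\<And>n. ex_perm n k \<sigma> \<le> K * n" by (rule ex_perm_linear_bound[OF assms]) blast
  show ?thesis
    unfolding Fueredi_Hajnal_constant_def
  proof (rule Fekete_superadditive_le_lim)
    show "real (ex_perm m k \<sigma>) + real (ex_perm n k \<sigma>) \<le> real (ex_perm (m + n) k \<sigma>)" for m n
      using ex_perm_superadditive[OF assms, of m n] by linarith
    show "real (ex_perm n k \<sigma>) \<le> real K * real n" for n
      using of_nat_mono[OF K[of n], where 'a = real] by simp
  qed simp
qed

text \<open>A single one avoids every pattern of length at least 2. Later this lets additive
  constants be absorbed into multiples of \<open>c\<close>, and it forces
  \<open>M \<ge> 2\<close>.\<close>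

lemma Fueredi_Hajnal_ge_1:
  assumes \<sigma>: "\<sigma> permutes {1..k}" and k: "k \<ge> 2"
  shows "Fueredi_Hajnal_constant k \<sigma> \<ge> 1"
proof -
  have "\<not> pat_contains k \<sigma> {(0, 0)}"
  proof
    assume "pat_contains k \<sigma> {(0, 0)}"
    then obtain r c :: "nat \<Rightarrow> nat" where r: "strict_mono_on {1..k} r" and z: "\<forall>i\<in>{1..k}. (r i, c (\<sigma> i)) \<in> {(0, 0)}"
      unfolding pat_contains_def by blast
    have "r 1 < r 2" using k by (intro strict_mono_onD[OF r]) auto
    moreover have "2 \<in> {1..k}" using k by simp
    ultimately show False using bspec[OF z, of 2] by simp
  qed
  then have "card {(0::nat, 0::nat)} \<le> ex_perm 1 k \<sigma>"
    by (intro card_le_ex_perm[OF \<sigma>]) auto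
  then show ?thesis using ex_perm_le_Fueredi_Hajnal[OF assms, of 1] by simp
qed

section \<open>Inversions and the planar tau distance\<close>

definition inversions :: "nat \<Rightarrow> (nat \<Rightarrow> nat) \<Rightarrow> (nat \<times> nat) set" where
  "inversions n w = {(x, y). x \<in> {1..n} \<and> y \<in> {1..n} \<and> x < y \<and> w y < w x}"

lemma finite_inversions [simp]: "finite (inversions n w)"
  by (rule finite_subset[of _ "{1..n} \<times> {1..n}"]) (auto simp: inversions_def)

text \<open>Growth by at least one per step gives \<open>i \<le> w i\<close>; as both sides have the
  same sum over \<open>{1..n}\<close>, no inequality can be strict.\<close>

lemma permutes_increasing_eq_id:
  assumes w: "w permutes {1..n}" and inc: "\<And>i. 1 \<le> i \<Longrightarrow> i < n \<Longrightarrow> w i < w (Suc i)"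
  shows "w = id"
proof
  fix x
  have ge: "1 \<le> i \<Longrightarrow> i \<le> n \<Longrightarrow> i \<le> w i" for i
  proof (induction i rule: nat_induct_at_least)
    case base
    then show ?case using permutes_in_image[OF w, of 1] by simp
  next
    case (Suc i)
    then show ?case using inc[of i] by simp
  qed
  show "w x = id x"
  proof (cases "x \<in> {1..n}")
    case True
    have "(\<Sum>i\<in>{1..n}. w i) = (\<Sum>i\<in>{1..n}. i)"
      using sum.permute[OF w, of "\<lambda>i. i"] by simp
    then have "w x = x" if "x \<noteq> w x"
    proof -
      have "(\<Sum>i\<in>{1..n}. i) < (\<Sum>i\<in>{1..n}. w i)"
      proof (rule sum_strict_mono_ex1)
        show "\<forall>i\<in>{1..n}. i \<le> w i" using ge by simp
        show "\<exists>i\<in>{1..n}. i < w i" using that ge[of x] True by (intro bexI[of _ x]) auto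
      qed simp
      with \<open>(\<Sum>i\<in>{1..n}. w i) = (\<Sum>i\<in>{1..n}. i)\<close> show ?thesis by linarith
    qed
    then show ?thesis by fastforce
  next
    case False
    then show ?thesis using permutes_not_in[OF w] by simp
  qed
qed

text \<open>Relabelling pairs by the transposition embeds the new inversions into the old ones. Only
  the pair \<open>(i, Suc i)\<close> would change its orientation, and it is an inversion before the
  swap but not after.\<close>

lemma card_inversions_transpose_less:
  assumes i: "1 \<le> i" "i < n" and desc: "w (Suc i) < w i"
  shows "card (inversions n (w \<circ> Transposition.transpose i (Suc i))) < card (inversions n w)"
proof -
  let ?\<tau> = "Transposition.transpose i (Suc i)"
  have sub: "map_prod ?\<tau> ?\<tau> ` inversions n (w \<circ> ?\<tau>) \<subseteq> inversions n w - {(i, Suc i)}"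
  proof
    fix p assume "p \<in> map_prod ?\<tau> ?\<tau> ` inversions n (w \<circ> ?\<tau>)"
    then obtain x y where p: "p = (?\<tau> x, ?\<tau> y)" and xy: "x \<in> {1..n}" "y \<in> {1..n}" "x < y" "w (?\<tau> y) < w (?\<tau> x)"
      by (auto simp: inversions_def)
    have "\<not> (x = i \<and> y = Suc i)" using xy(4) desc by auto
    then have "?\<tau> x < ?\<tau> y" using xy(3) by (auto simp: Transposition.transpose_def)
    moreover have "?\<tau> x \<in> {1..n}" "?\<tau> y \<in> {1..n}" using xy(1,2) i by (auto simp: Transposition.transpose_def)
    moreover have "(?\<tau> x, ?\<tau> y) \<noteq> (i, Suc i)" using xy(3) by (auto simp: Transposition.transpose_def split: if_splits)
    ultimately show "p \<in> inversions n w - {(i, Suc i)}" using p xy(4) by (simp add: inversions_def)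
  qed
  have "card (map_prod ?\<tau> ?\<tau> ` inversions n (w \<circ> ?\<tau>)) = card (inversions n (w \<circ> ?\<tau>))"
  proof (rule card_image)
    from prod.inj_map[OF inj_transpose inj_transpose] show "inj_on (map_prod ?\<tau> ?\<tau>) (inversions n (w \<circ> ?\<tau>))"
      by (rule inj_on_subset[OF _ subset_UNIV])
  qed
  then have "card (inversions n (w \<circ> ?\<tau>)) \<le> card (inversions n w - {(i, Suc i)})"
    using card_mono[OF _ sub] by simp
  also have "(i, Suc i) \<in> inversions n w" using i desc by (simp add: inversions_def)
  then have "card (inversions n w - {(i, Suc i)}) < card (inversions n w)"
    by (rule card_Diff1_less[OF finite_inversions])
  finally show ?thesis .
qed

lemma planar_transposition_comp_transpose:
  assumes \<pi>: "\<pi> \<in> perms_of_length n" and i: "1 \<le> i" "i < n"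
  shows "planar_transposition n \<pi> (\<pi> \<circ> Transposition.transpose i (Suc i))"
proof -
  have "Transposition.transpose i (Suc i) permutes {1..n}" using i by (intro permutes_swap_id) auto
  then have "\<pi> \<circ> Transposition.transpose i (Suc i) \<in> perms_of_length n"
    using \<pi> permutes_compose by (auto simp: perms_of_length_def)
  moreover have "\<pi> \<circ> Transposition.transpose i (Suc i) = \<pi>(i := \<pi> (i + 1), i + 1 := \<pi> i)"
    by (auto simp: Transposition.transpose_def fun_eq_iff)
  ultimately show ?thesis
    using \<pi> i unfolding planar_transposition_def by auto
qed

text \<open>Bubble sort: a permutation other than the identity has a descent, and swapping it costs
  one move and removes at least one inversion.\<close>

lemma relpowp_comp_inversions:
  assumes \<pi>: "\<pi> \<in> perms_of_length n" and w: "w permutes {1..n}"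
  shows "\<exists>t\<le>card (inversions n w). (planar_transposition n ^^ t) \<pi> (\<pi> \<circ> w)"
  using w
proof (induction "card (inversions n w)" arbitrary: w rule: less_induct)
  case less
  show ?case
  proof (cases "w = id")
    case True
    then show ?thesis by (intro exI[of _ 0]) auto
  next
    case False
    then obtain i where i: "1 \<le> i" "i < n" "\<not> w i < w (Suc i)"
      using permutes_increasing_eq_id[OF less.prems] by metis
    moreover have "w i \<noteq> w (Suc i)" using permutes_inj[OF less.prems] by (metis injD n_not_Suc_n)
    ultimately have desc: "w (Suc i) < w i" by linarith
    define w' where "w' = w \<circ> Transposition.transpose i (Suc i)"
    have \<tau>: "Transposition.transpose i (Suc i) permutes {1..n}" using i by (intro permutes_swap_id) auto
    have w': "w' permutes {1..n}" unfolding w'_def by (rule permutes_compose[OF \<tau> less.prems])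
    have lt: "card (inversions n w') < card (inversions n w)"
      unfolding w'_def using i(1,2) desc by (rule card_inversions_transpose_less)
    from less.hyps[OF lt w'] obtain t where t: "t \<le> card (inversions n w')"
      "(planar_transposition n ^^ t) \<pi> (\<pi> \<circ> w')" by blast
    have "\<pi> \<circ> w' \<in> perms_of_length n"
      using \<pi> permutes_compose[OF w'] by (auto simp: perms_of_length_def)
    then have "planar_transposition n (\<pi> \<circ> w') (\<pi> \<circ> w' \<circ> Transposition.transpose i (Suc i))"
      using i(1,2) by (rule planar_transposition_comp_transpose)
    moreover have "\<pi> \<circ> w' \<circ> Transposition.transpose i (Suc i) = \<pi> \<circ> w"
      by (simp add: w'_def comp_assoc)
    ultimately have "(planar_transposition n ^^ Suc t) \<pi> (\<pi> \<circ> w)"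
      using t(2) by auto
    then show ?thesis using t(1) lt by (intro exI[of _ "Suc t"]) auto
  qed
qed

lemma inv_in_perms_of_length: "\<pi> \<in> perms_of_length n \<Longrightarrow> inv_into UNIV \<pi> \<in> perms_of_length n"
  by (auto simp: perms_of_length_def intro: permutes_inv)

text \<open>Taking inverses exchanges moves of adjacent positions with moves of adjacent values, so
  the sorting bound for positions also serves for values.\<close>

lemma planar_transposition_inv:
  assumes "planar_transposition n \<pi> \<sigma>"
  shows "planar_transposition n (inv_into UNIV \<pi>) (inv_into UNIV \<sigma>)"
proof -
  have p: "\<pi> \<in> perms_of_length n" "\<sigma> \<in> perms_of_length n"
    using assms by (auto simp: planar_transposition_def)
  then have "inv_into UNIV (inv_into UNIV \<pi>) = \<pi>" "inv_into UNIV (inv_into UNIV \<sigma>) = \<sigma>"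
    by (auto simp: perms_of_length_def intro: permutes_inv_inv)
  then show ?thesis
    using assms p[THEN inv_in_perms_of_length] unfolding planar_transposition_def by metis
qed

lemma relpowp_planar_transposition_inv:
  "(planar_transposition n ^^ t) \<pi> \<sigma> \<Longrightarrow>
    (planar_transposition n ^^ t) (inv_into UNIV \<pi>) (inv_into UNIV \<sigma>)"
proof (induction t arbitrary: \<sigma>)
  case (Suc t)
  then obtain \<rho> where \<rho>: "(planar_transposition n ^^ t) \<pi> \<rho>" "planar_transposition n \<rho> \<sigma>" by auto
  from Suc.IH[OF \<rho>(1)] planar_transposition_inv[OF \<rho>(2)] show ?case
    unfolding relpowp.simps relcompp_apply by (intro exI[of _ "inv_into UNIV \<rho>"] conjI)
qed simp

text \<open>The values are rearranged by \<open>u\<close>, then the positions by \<open>w\<close>.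
  Seen on inverses, the first stage is a rearrangement of positions by the inverse of
  \<open>u\<close>, which is why that inverse is counted.\<close>

lemma planar_tau_le_inversions:
  assumes \<pi>: "\<pi> \<in> perms_of_length n" and u: "u permutes {1..n}" and w: "w permutes {1..n}"
  shows "planar_tau n \<pi> (u \<circ> \<pi> \<circ> w) \<le>
    (real (card (inversions n w)) + real (card (inversions n (inv_into UNIV u)))) / real (n choose 2)"
proof (cases "n = 1")
  case True
  then show ?thesis by (simp add: planar_tau_def)
next
  case False
  have p: "\<pi> permutes {1..n}" using \<pi> by (simp add: perms_of_length_def)
  have u': "inv_into UNIV u permutes {1..n}" using u by (rule permutes_inv)
  have up: "u \<circ> \<pi> permutes {1..n}" using permutes_compose[OF p u] .
  obtain t1 where t1: "t1 \<le> card (inversions n (inv_into UNIV u))"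
    "(planar_transposition n ^^ t1) (inv_into UNIV \<pi>) (inv_into UNIV \<pi> \<circ> inv_into UNIV u)"
    using relpowp_comp_inversions[OF inv_in_perms_of_length[OF \<pi>] u'] by blast
  have e: "inv_into UNIV (inv_into UNIV \<pi>) = \<pi>" using permutes_inv_inv[OF p] .
  have "inv_into UNIV (u \<circ> \<pi>) = inv_into UNIV \<pi> \<circ> inv_into UNIV u"
    using o_inv_distrib[OF permutes_bij[OF u] permutes_bij[OF p]] .
  then have "inv_into UNIV (inv_into UNIV \<pi> \<circ> inv_into UNIV u) = u \<circ> \<pi>"
    using permutes_inv_inv[OF up] by simp
  with relpowp_planar_transposition_inv[OF t1(2)] e
  have 1: "(planar_transposition n ^^ t1) \<pi> (u \<circ> \<pi>)" by simp
  have "u \<circ> \<pi> \<in> perms_of_length n" using up \<pi> by (simp add: perms_of_length_def)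
  from relpowp_comp_inversions[OF this w] obtain t2 where t2: "t2 \<le> card (inversions n w)"
    "(planar_transposition n ^^ t2) (u \<circ> \<pi>) (u \<circ> \<pi> \<circ> w)" by blast
  have "(planar_transposition n ^^ (t1 + t2)) \<pi> (u \<circ> \<pi> \<circ> w)"
    using 1 t2(2) by (auto simp: relpowp_add)
  then have "(LEAST t. (planar_transposition n ^^ t) \<pi> (u \<circ> \<pi> \<circ> w)) \<le> t1 + t2" by (rule Least_le)
  also have "\<dots> \<le> card (inversions n w) + card (inversions n (inv_into UNIV u))"
    using t1(1) t2(1) by simp
  finally show ?thesis
    using False unfolding planar_tau_def by (simp add: divide_right_mono flip: of_nat_add)
qed

lemma card_inversions_le: "card (inversions n w) \<le> n choose 2"
proof -
  have "card (inversions n w) = card ((\<lambda>(x, y). {x, y}) ` inversions n w)"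
    by (rule card_image[symmetric]) (auto simp: inj_on_def inversions_def doubleton_eq_iff)
  also have "\<dots> \<le> card {B. B \<subseteq> {1..n} \<and> card B = 2}"
    by (rule card_mono) (auto simp: inversions_def)
  also have "\<dots> = n choose 2" using n_subsets[of "{1..n}" 2] by simp
  finally show ?thesis .
qed

text \<open>Moves of positions alone already reach any permutation, with at most one move per pair.
  Hence nothing is far from a property once \<open>\<epsilon> \<ge> 1\<close>.\<close>

lemma planar_tau_le_1:
  assumes \<pi>: "\<pi> \<in> perms_of_length n" and \<rho>: "\<rho> \<in> perms_of_length n"
  shows "planar_tau n \<pi> \<rho> \<le> 1"
proof -
  have p: "\<pi> permutes {1..n}" and r: "\<rho> permutes {1..n}" using \<pi> \<rho> by (simp_all add: perms_of_length_def)
  define w where "w = inv_into UNIV \<pi> \<circ> \<rho>"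
  have w: "w permutes {1..n}" unfolding w_def by (rule permutes_compose[OF r permutes_inv[OF p]])
  have "id \<circ> \<pi> \<circ> w = \<rho>" using permutes_inv_o(1)[OF p] by (simp add: w_def flip: comp_assoc)
  moreover have "inversions n (inv_into UNIV id) = {}" by (auto simp: inversions_def)
  ultimately have "planar_tau n \<pi> \<rho> \<le> real (card (inversions n w)) / real (n choose 2)"
    using planar_tau_le_inversions[OF \<pi> permutes_id w] by simp
  also have "\<dots> \<le> 1"
  proof -
    have "real a / real b \<le> 1" if "a \<le> b" for a b :: nat
      using that by (cases "b = 0") (auto simp: divide_le_eq)
    then show ?thesis using card_inversions_le by blast
  qed
  finally show ?thesis .
qed

lemma finite_perms_of_length: "finite (perms_of_length n)"
  by (rule finite_subset[of _ "{p. p permutes {1..n}}"]) (auto simp: perms_of_length_def finite_permutations)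

lemma dist_from_property_le:
  assumes "permutation_property P" "\<rho> \<in> P n"
  shows "dist_from_property d P n \<pi> \<le> d n \<pi> \<rho>"
proof -
  have "finite (P n)"
    using assms(1) finite_subset[OF _ finite_perms_of_length] unfolding permutation_property_def by blast
  then show ?thesis using assms(2) by (auto simp: dist_from_property_def)
qed

lemma not_far_from_ge_1:
  assumes "permutation_property P" "\<epsilon> \<ge> 1" "\<pi> \<in> perms_of_length n"
  shows "\<not> far_from planar_tau P \<epsilon> n \<pi>"
proof (cases "P n = {}")
  case True
  then show ?thesis using assms(2) by (simp add: far_from_def dist_from_property_def)
next
  case False
  then obtain \<rho> where \<rho>: "\<rho> \<in> P n" by blast
  then have "\<rho> \<in> perms_of_length n" using assms(1) by (auto simp: permutation_property_def)
  with dist_from_property_le[OF assms(1) \<rho>, of planar_tau \<pi>] planar_tau_le_1[OF assms(3)] assms(2)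
  show ?thesis by (fastforce simp: far_from_def)
qed

section \<open>Patterns and blow-ups\<close>

text \<open>The standardization of the word \<open>g 1, ..., g m\<close>, extended by the identity
  so that it permutes \<open>{1..m}\<close>.\<close>

definition rank_perm :: "nat \<Rightarrow> (nat \<Rightarrow> nat) \<Rightarrow> nat \<Rightarrow> nat" where
  "rank_perm m g j = (if j \<in> {1..m} then card {l \<in> {1..m}. g l \<le> g j} else j)"

lemma rank_perm_less_iff:
  assumes "j \<in> {1..m}" "l \<in> {1..m}"
  shows "rank_perm m g j < rank_perm m g l \<longleftrightarrow> g j < g l"
proof -
  have mono: "rank_perm m g a \<le> rank_perm m g b" if "a \<in> {1..m}" "b \<in> {1..m}" "g a \<le> g b" for a b
    using that unfolding rank_perm_def by (auto intro!: card_mono)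
  have "rank_perm m g j < rank_perm m g l" if "g j < g l"
  proof -
    have "{i \<in> {1..m}. g i \<le> g j} \<subset> {i \<in> {1..m}. g i \<le> g l}"
    proof (rule psubsetI)
      have "l \<in> {i \<in> {1..m}. g i \<le> g l}" "l \<notin> {i \<in> {1..m}. g i \<le> g j}" using that assms by simp_all
      then show "{i \<in> {1..m}. g i \<le> g j} \<noteq> {i \<in> {1..m}. g i \<le> g l}" by metis
    qed (use that in auto)
    then show ?thesis using assms by (simp add: rank_perm_def psubset_card_mono)
  qed
  then show ?thesis using mono[OF assms(2,1)] by (meson not_le)
qed

lemma rank_perm_permutes:
  assumes "inj_on g {1..m}"
  shows "rank_perm m g permutes {1..m}"
proof (rule bij_imp_permutes)
  have "inj_on (rank_perm m g) {1..m}"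
  proof (rule inj_onI)
    fix a b assume ab: "a \<in> {1..m}" "b \<in> {1..m}" "rank_perm m g a = rank_perm m g b"
    then have "g a = g b"
      using rank_perm_less_iff[OF ab(1,2), of g] rank_perm_less_iff[OF ab(2,1), of g] by simp
    then show "a = b" using assms ab by (simp add: inj_on_eq_iff)
  qed
  moreover have "rank_perm m g ` {1..m} \<subseteq> {1..m}"
  proof
    fix y assume "y \<in> rank_perm m g ` {1..m}"
    then obtain j where j: "j \<in> {1..m}" "y = card {l \<in> {1..m}. g l \<le> g j}"
      by (auto simp: rank_perm_def)
    have "card {l \<in> {1..m}. g l \<le> g j} \<le> card {1..m}" by (rule card_mono) auto
    moreover have "card {l \<in> {1..m}. g l \<le> g j} > 0" using j by (auto simp: card_gt_0_iff)
    ultimately show "y \<in> {1..m}" using j(2) by simp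
  qed
  ultimately show "bij_betw (rank_perm m g) {1..m} {1..m}"
    by (simp add: bij_betw_def endo_inj_surj)
  show "rank_perm m g x = x" if "x \<notin> {1..m}" for x
    using that unfolding rank_perm_def by (rule if_not_P)
qed

text \<open>Since \<open>e\<close> may list positions in any order, the point labelled
  \<open>t\<close> has position rank \<open>rank_perm m e t\<close> and value rank
  \<open>rank_perm m (\<pi> \<circ> e) t\<close>; the composition is the pattern of
  \<open>\<pi>\<close> on the image of \<open>e\<close>.\<close>

lemma hereditary_rank_perm:
  assumes P: "hereditary P" and \<pi>: "\<pi> \<in> P n" and m: "m \<ge> 1" and perm: "\<pi> permutes {1..n}"
    and e: "inj_on e {1..m}" "e ` {1..m} \<subseteq> {1..n}"
  shows "rank_perm m (\<pi> \<circ> e) \<circ> inv_into UNIV (rank_perm m e) \<in> P m"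
proof -
  let ?r = "rank_perm m e" and ?v = "inv_into UNIV (rank_perm m e)"
  have r: "?r permutes {1..m}" by (rule rank_perm_permutes[OF e(1)])
  then have v: "?v permutes {1..m}" by (rule permutes_inv)
  have rv: "?r (?v t) = t" for t by (rule permutes_inverses(1)[OF r])
  have vin: "?v t \<in> {1..m}" if "t \<in> {1..m}" for t using that permutes_in_image[OF v] by simp
  have "inj_on (\<pi> \<circ> e) {1..m}"
    by (rule comp_inj_on[OF e(1) inj_on_subset[OF permutes_inj[OF perm] subset_UNIV]])
  then have g: "rank_perm m (\<pi> \<circ> e) permutes {1..m}" by (rule rank_perm_permutes)
  have "rank_perm m (\<pi> \<circ> e) \<circ> ?v \<in> perms_of_length m"
    using permutes_compose[OF v g] m by (simp add: perms_of_length_def)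
  moreover have "subpermutation m (rank_perm m (\<pi> \<circ> e) \<circ> ?v) n \<pi>"
    unfolding subpermutation_def
  proof (intro exI[of _ "e \<circ> ?v"] conjI ballI)
    show "strict_mono_on {1..m} (e \<circ> ?v)"
    proof (rule strict_mono_onI)
      fix a b assume ab: "a \<in> {1..m}" "b \<in> {1..m}" "a < b"
      then have "?r (?v a) < ?r (?v b)" by (simp add: rv)
      then show "(e \<circ> ?v) a < (e \<circ> ?v) b"
        using rank_perm_less_iff[OF vin[OF ab(1)] vin[OF ab(2)]] by simp
    qed
    show "(e \<circ> ?v) ` {1..m} \<subseteq> {1..n}" using e(2) vin by auto
    fix j l assume jl: "j \<in> {1..m}" "l \<in> {1..m}"
    show "\<pi> ((e \<circ> ?v) j) < \<pi> ((e \<circ> ?v) l) \<longleftrightarrow>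
        (rank_perm m (\<pi> \<circ> e) \<circ> ?v) j < (rank_perm m (\<pi> \<circ> e) \<circ> ?v) l"
      using rank_perm_less_iff[OF vin[OF jl(1)] vin[OF jl(2)], of "\<pi> \<circ> e"] by simp
  qed
  ultimately show ?thesis using P \<pi> unfolding hereditary_def by metis
qed

text \<open>The pattern formed by \<open>k\<close> points from each group is a
  \<open>k\<close>-blow-up of \<open>\<alpha>\<close>, and heredity puts it into the
  property.\<close>

lemma k_blowup_from_groups:
  assumes P: "hereditary P" and \<pi>: "\<pi> \<in> P n" and perm: "\<pi> permutes {1..n}"
    and \<alpha>: "\<alpha> permutes {1..m}" and m: "m \<ge> 1" and k: "k \<ge> 1"
    and H: "\<And>j. j \<in> {1..m} \<Longrightarrow> H j \<subseteq> {1..n} \<and> k \<le> card (H j)"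
    and pos: "\<And>j l x y. j \<in> {1..m} \<Longrightarrow> l \<in> {1..m} \<Longrightarrow> j < l \<Longrightarrow> x \<in> H j \<Longrightarrow> y \<in> H l \<Longrightarrow> x < y"
    and val: "\<And>j l x y. j \<in> {1..m} \<Longrightarrow> l \<in> {1..m} \<Longrightarrow> \<alpha> j < \<alpha> l \<Longrightarrow> x \<in> H j \<Longrightarrow> y \<in> H l \<Longrightarrow> \<pi> x < \<pi> y"
  shows "\<not> no_k_blowup_in P m \<alpha> k"
proof -
  have "\<exists>r. strict_mono_on {1..k} r \<and> r ` {1..k} \<subseteq> H j" if "j \<in> {1..m}" for j
  proof -
    have "finite (H j)" "k \<le> card (H j)" using H[OF that] finite_subset by auto
    then obtain r where "strict_mono_on {1..k} r" "r ` {1..k} \<subseteq> H j" by (rule obtain_strict_mono_on)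
    then show ?thesis by blast
  qed
  then obtain r where r: "\<And>j. j \<in> {1..m} \<Longrightarrow> strict_mono_on {1..k} (r j) \<and> r j ` {1..k} \<subseteq> H j"
    by metis
  \<comment> \<open>Division with remainder, counted from 1: \<open>blk p\<close> is the group and
    \<open>off p\<close> the place within it.\<close>
  define blk where "blk p = (p - 1) div k + 1" for p
  define off where "off p = (p - 1) mod k + 1" for p
  define e where "e p = r (blk p) (off p)" for p
  have blk: "blk p \<in> {1..m}" if "p \<in> {1..m * k}" for p
  proof -
    have "(p - 1) div k < m" using that k by (intro less_mult_imp_div_less) auto
    then show ?thesis by (simp add: blk_def)
  qed
  have off: "off p \<in> {1..k}" for p
    using k mod_less_divisor[of k "p - 1"] by (simp add: off_def Suc_le_eq)
  have eH: "e p \<in> H (blk p)" if "p \<in> {1..m * k}" for p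
    unfolding e_def using r[OF blk[OF that]] off by blast
  have eq: "p - 1 = (blk p - 1) * k + (off p - 1)" for p
    by (simp add: blk_def off_def)
  have e: "strict_mono_on {1..m * k} e"
  proof (rule strict_mono_onI)
    fix a b assume ab: "a \<in> {1..m * k}" "b \<in> {1..m * k}" "a < b"
    have "blk a \<le> blk b" using ab(3) by (simp add: blk_def div_le_mono)
    then consider "blk a < blk b" | "blk a = blk b" by linarith
    then show "e a < e b"
    proof cases
      case 1
      then show ?thesis using pos[OF blk[OF ab(1)] blk[OF ab(2)] 1 eH[OF ab(1)] eH[OF ab(2)]] by simp
    next
      case 2
      have "a - 1 < b - 1" using ab by auto
      then have "(blk a - 1) * k + (off a - 1) < (blk b - 1) * k + (off b - 1)" unfolding eq[symmetric] .
      then have "off a < off b" using 2 by simp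
      moreover have "strict_mono_on {1..k} (r (blk b))" using r[OF blk[OF ab(2)]] by simp
      ultimately show ?thesis unfolding e_def 2 using strict_mono_onD off by metis
    qed
  qed
  let ?N = "m * k"
  define \<beta> where "\<beta> = rank_perm ?N (\<pi> \<circ> e)"
  have einj: "inj_on e {1..?N}" by (rule strict_mono_on_imp_inj_on[OF e])
  have eimg: "e ` {1..?N} \<subseteq> {1..n}" using eH H blk by blast
  have N: "?N \<ge> 1" using m k by simp
  have ginj: "inj_on (\<pi> \<circ> e) {1..?N}"
    by (rule comp_inj_on[OF einj inj_on_subset[OF permutes_inj[OF perm] subset_UNIV]])
  have \<beta>p: "\<beta> \<in> perms_of_length ?N"
    using rank_perm_permutes[OF ginj] N by (simp add: perms_of_length_def \<beta>_def)
  have less: "\<beta> a < \<beta> b \<longleftrightarrow> \<pi> (e a) < \<pi> (e b)" if "a \<in> {1..?N}" "b \<in> {1..?N}" for a b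
    using rank_perm_less_iff[OF that, of "\<pi> \<circ> e"] by (simp add: \<beta>_def)
  have "subpermutation ?N \<beta> n \<pi>"
    unfolding subpermutation_def using e eimg less by (intro exI[of _ e]) simp
  then have \<beta>P: "\<beta> \<in> P ?N" using P \<pi> \<beta>p unfolding hereditary_def by metis
  have "blowup_with m \<alpha> ?N \<beta> (\<lambda>j. (j - 1) * k + 1)"
    unfolding blowup_with_def
  proof (intro conjI ballI impI)
    show "strict_mono_on {1..m + 1} (\<lambda>j. (j - 1) * k + 1)"
      using k by (intro strict_mono_onI) auto
    fix j1 j2 i1 i2
    assume j: "j1 \<in> {1..m}" "j2 \<in> {1..m}" "j1 \<noteq> j2"
      and i: "i1 \<in> {(j1 - 1) * k + 1..<(j1 + 1 - 1) * k + 1}" "i2 \<in> {(j2 - 1) * k + 1..<(j2 + 1 - 1) * k + 1}"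
    have in_blk: "i \<in> {1..?N} \<and> blk i = j" if jm: "j \<in> {1..m}" and ib: "i \<in> {(j - 1) * k + 1..<(j + 1 - 1) * k + 1}" for i j
    proof -
      have "j * k \<le> m * k" using jm by (intro mult_le_mono1) simp
      moreover have "i \<le> j * k" "1 \<le> i" using ib by simp_all
      ultimately have "i \<in> {1..?N}" unfolding atLeastAtMost_iff by linarith
      obtain j' where j': "j = Suc j'" using jm by (cases j) auto
      have "j' * k \<le> i - 1" "i - 1 < Suc j' * k" using ib by (auto simp: j')
      then have "(i - 1) div k = j'" using k by (intro div_nat_eqI) (auto simp: mult.commute)
      then show ?thesis using \<open>i \<in> {1..?N}\<close> j' by (simp add: blk_def)
    qed
    have "\<pi> (e i2) < \<pi> (e i1)" if "\<alpha> j2 < \<alpha> j1"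
      using val[OF j(2,1) that] eH in_blk[OF j(1) i(1)] in_blk[OF j(2) i(2)] by metis
    moreover have "\<pi> (e i1) < \<pi> (e i2)" if "\<alpha> j1 < \<alpha> j2"
      using val[OF j(1,2) that] eH in_blk[OF j(1) i(1)] in_blk[OF j(2) i(2)] by metis
    moreover have "\<alpha> j1 \<noteq> \<alpha> j2" using j(3) permutes_inj[OF \<alpha>] by (simp add: inj_eq)
    ultimately show "\<beta> i2 < \<beta> i1 \<longleftrightarrow> \<alpha> j2 < \<alpha> j1"
      using less in_blk[OF j(1) i(1)] in_blk[OF j(2) i(2)] by (metis less_asym linorder_neqE_nat)
  qed simp_all
  moreover have "\<forall>j\<in>{1..m}. (j + 1 - 1) * k + 1 - ((j - 1) * k + 1) = k"
  proof
    fix j assume "j \<in> {1..m}"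
    then obtain j' where "j = Suc j'" by (cases j) auto
    then show "(j + 1 - 1) * k + 1 - ((j - 1) * k + 1) = k" by simp
  qed
  ultimately have "k_blowup k m \<alpha> ?N \<beta>" using \<beta>p unfolding k_blowup_def by blast
  then show ?thesis using \<beta>P unfolding no_k_blowup_in_def by blast
qed

section \<open>Moving points within dyadic strips\<close>

lemma card_inversions_inv_le:
  assumes w: "w permutes {1..n}"
  shows "card (inversions n (inv_into UNIV w)) \<le> card (inversions n w)"
proof -
  let ?v = "inv_into UNIV w"
  have v: "?v permutes {1..n}" using w by (rule permutes_inv)
  have wv: "w (?v x) = x" for x by (rule permutes_inverses(1)[OF w])
  have "inj_on (\<lambda>(x, y). (?v y, ?v x)) (inversions n ?v)"
    by (rule inj_onI) (simp add: case_prod_unfold prod_eq_iff inj_eq[OF permutes_inj[OF v]])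
  moreover have "(\<lambda>(x, y). (?v y, ?v x)) ` inversions n ?v \<subseteq> inversions n w"
  proof
    fix p assume "p \<in> (\<lambda>(x, y). (?v y, ?v x)) ` inversions n ?v"
    then obtain r where r: "p = (\<lambda>(x, y). (?v y, ?v x)) r" "r \<in> inversions n ?v" by (rule imageE)
    obtain x y where "r = (x, y)" by (cases r)
    with r have xy: "(x, y) \<in> inversions n ?v" "p = (?v y, ?v x)" by simp_all
    then have "?v y \<in> {1..n}" "?v x \<in> {1..n}" "x < y" "?v y < ?v x"
      unfolding permutes_in_image[OF v] by (simp_all add: inversions_def)
    then show "p \<in> inversions n w" by (simp add: inversions_def xy(2) wv)
  qed
  ultimately show ?thesis by (intro card_inj_on_le[of "\<lambda>(x, y). (?v y, ?v x)"]) simp_all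
qed

text \<open>Multiplying before dividing makes the strips of finer grids nest exactly in those of
  coarser ones even when \<open>N\<close> does not divide \<open>n\<close>.\<close>

definition grid_col :: "nat \<Rightarrow> nat \<Rightarrow> nat \<Rightarrow> nat" where
  "grid_col n N a = ((a - 1) * N) div n"

lemma grid_col_mono: "a \<le> b \<Longrightarrow> grid_col n N a \<le> grid_col n N b"
  unfolding grid_col_def by (intro div_le_mono mult_le_mono1 diff_le_mono)

lemma grid_col_less: "a \<in> {1..n} \<Longrightarrow> grid_col n N a < N" if "N > 0"
  using that unfolding grid_col_def
  by (intro less_mult_imp_div_less) (auto simp: mult.commute)

lemma grid_col_coarsen:
  assumes "l > 0"
  shows "grid_col n (N * l) a div l = grid_col n N a"
proof -
  have "(a - 1) * (N * l) div n div l = ((a - 1) * N * l) div (n * l)"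
    by (simp add: div_mult2_eq mult.assoc)
  also have "\<dots> = (a - 1) * N div n" using assms by simp
  finally show ?thesis by (simp add: grid_col_def)
qed

text \<open>A member \<open>a\<close> of a strip satisfies \<open>(a - a0) * N < n\<close>, where
  \<open>a0\<close> is the first member; the summand 1 counts \<open>a0\<close> itself.\<close>

lemma card_grid_col_le:
  assumes N: "N > 0" and n: "n > 0"
  shows "card {a \<in> {1..n}. grid_col n N a = c} \<le> n div N + 1"
proof -
  let ?S = "{a \<in> {1..n}. grid_col n N a = c}"
  show ?thesis
  proof (cases "?S = {}")
    case False
    define a0 where "a0 = Min ?S"
    have fin: "finite ?S" by simp
    have a0: "a0 \<in> ?S" unfolding a0_def using Min_in[OF fin False] .
    have "?S \<subseteq> {a0..a0 + n div N}"
    proof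
      fix a assume a: "a \<in> ?S"
      have le: "a0 \<le> a" unfolding a0_def using Min_le[OF fin a] .
      have "(a - 1) * N < c * n + n" "c * n \<le> (a0 - 1) * N"
        using a a0 n dividend_less_div_times[of n "(a - 1) * N"] div_times_less_eq_dividend[of "(a0 - 1) * N" n]
        by (auto simp: grid_col_def)
      moreover have "(a - 1) * N = (a0 - 1) * N + (a - a0) * N"
        using le a0 by (simp flip: add_mult_distrib)
      ultimately have "(a - a0) * N < n" by linarith
      then have "a - a0 \<le> n div N" using N by (simp add: less_eq_div_iff_mult_less_eq)
      then show "a \<in> {a0..a0 + n div N}" using le by simp
    qed
    from card_mono[OF _ this] show ?thesis by simp
  next
    case True
    show ?thesis unfolding True by simp
  qed
qed

text \<open>A pair whose order along \<open>q\<close> is not preserved by \<open>z\<close> lies in a common strip at the coarser of its two levels.\<close>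

lemma card_disordered_pairs_le:
  assumes n: "n > 0" and q: "q permutes {1..n}"
    and z: "\<And>x. x \<in> {1..n} \<Longrightarrow> grid_col n (2 ^ lev x) (q (z x)) = grid_col n (2 ^ lev x) (q x)"
  shows "card {(x, y). x \<in> {1..n} \<and> y \<in> {1..n} \<and> q x < q y \<and> \<not> q (z x) < q (z y)}
    \<le> 2 * (\<Sum>x\<in>{1..n}. n div 2 ^ lev x + 1)"
proof -
  define S where "S x = {y \<in> {1..n}. grid_col n (2 ^ lev x) (q y) = grid_col n (2 ^ lev x) (q x)}" for x
  have same: "grid_col n (2 ^ j) (q x) = grid_col n (2 ^ j) (q y)"
    if "x \<in> {1..n}" "y \<in> {1..n}" "q x < q y" "\<not> q (z x) < q (z y)" "j \<le> lev x" "j \<le> lev y" for x y j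
  proof -
    have eq: "grid_col n (2 ^ j) (q (z u)) = grid_col n (2 ^ j) (q u)" if u: "u \<in> {1..n}" "j \<le> lev u" for u
    proof -
      have "2 ^ lev u = (2 ^ j * 2 ^ (lev u - j) :: nat)" using u(2) by (simp flip: power_add)
      then have "grid_col n (2 ^ j) a = grid_col n (2 ^ lev u) a div 2 ^ (lev u - j)" for a
        by (simp add: grid_col_coarsen)
      then show ?thesis using z[OF u(1)] by simp
    qed
    \<comment> \<open>At the coarser level \<open>z\<close> leaves both strips unchanged, so the two
      opposite orders give inequalities of strips in both directions.\<close>
    have "grid_col n (2 ^ j) (q x) \<le> grid_col n (2 ^ j) (q y)" using that(3) by (intro grid_col_mono) simp
    moreover have "grid_col n (2 ^ j) (q (z y)) \<le> grid_col n (2 ^ j) (q (z x))"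
      using that(4) by (intro grid_col_mono) simp
    ultimately show ?thesis using eq[OF that(1,5)] eq[OF that(2,6)] by simp
  qed
  have cS: "card (S x) \<le> n div 2 ^ lev x + 1" for x
  proof -
    have "q ` S x \<subseteq> {a \<in> {1..n}. grid_col n (2 ^ lev x) a = grid_col n (2 ^ lev x) (q x)}"
      using permutes_in_image[OF q] by (auto simp: S_def)
    then have "card (q ` S x) \<le> card {a \<in> {1..n}. grid_col n (2 ^ lev x) a = grid_col n (2 ^ lev x) (q x)}"
      by (intro card_mono) auto
    also have "\<dots> \<le> n div 2 ^ lev x + 1" using n by (intro card_grid_col_le) auto
    also have "card (q ` S x) = card (S x)"
      by (rule card_image[OF inj_on_subset[OF permutes_inj[OF q] subset_UNIV]])
    finally show ?thesis .
  qed
  \<comment> \<open>Each pair is charged to its member of smaller level, which may be the first or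
    the second; hence the mirror image and the factor 2.\<close>
  let ?A = "SIGMA x:{1..n}. S x"
  have "{(x, y). x \<in> {1..n} \<and> y \<in> {1..n} \<and> q x < q y \<and> \<not> q (z x) < q (z y)} \<subseteq> ?A \<union> prod.swap ` ?A"
  proof
    fix p assume "p \<in> {(x, y). x \<in> {1..n} \<and> y \<in> {1..n} \<and> q x < q y \<and> \<not> q (z x) < q (z y)}"
    then obtain x y where p: "p = (x, y)" and xy: "x \<in> {1..n}" "y \<in> {1..n}" "q x < q y" "\<not> q (z x) < q (z y)"
      by blast
    show "p \<in> ?A \<union> prod.swap ` ?A"
    proof (cases "lev x \<le> lev y")
      case True
      then have "(x, y) \<in> ?A" using same[OF xy, of "lev x"] xy(1,2) by (simp add: S_def)
      then show ?thesis using p by blast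
    next
      case False
      then have "(y, x) \<in> ?A" using same[OF xy, of "lev y"] xy(1,2) by (simp add: S_def)
      then have "prod.swap (y, x) \<in> prod.swap ` ?A" by (rule imageI)
      then show ?thesis using p by simp
    qed
  qed
  moreover have finA: "finite ?A" by (rule finite_SigmaI) (auto simp: S_def)
  ultimately have "card {(x, y). x \<in> {1..n} \<and> y \<in> {1..n} \<and> q x < q y \<and> \<not> q (z x) < q (z y)} \<le> card (?A \<union> prod.swap ` ?A)"
    by (intro card_mono) simp_all
  also have "\<dots> \<le> card ?A + card (prod.swap ` ?A)" by (rule card_Un_le)
  also have "\<dots> \<le> 2 * card ?A" using card_image_le[OF finA, of prod.swap] by simp
  also have "card ?A = (\<Sum>x\<in>{1..n}. card (S x))" by (rule card_SigmaI) (auto simp: S_def)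
  also have "\<dots> \<le> (\<Sum>x\<in>{1..n}. n div 2 ^ lev x + 1)" using cS by (rule sum_mono)
  finally show ?thesis by simp
qed

text \<open>Blocks of size \<open>n\<close> have room for any assignment: \<open>x\<close> takes the
  \<open>x\<close>-th place of block \<open>s x\<close>, and heredity discards the other places,
  which leaves length exactly \<open>n\<close>. Points of different blocks inherit the order of
  their representatives in position and value; within a block positions keep their order and values
  are arbitrary. So an order can change only for pairs whose representatives do not have the old
  order strictly, equal representatives included, and such pairs are counted by
  \<open>card_disordered_pairs_le\<close>.\<close>

lemma exists_close_member:
  assumes P: "hereditary P" "permutation_property P" and \<pi>: "\<pi> \<in> perms_of_length n"
    and h: "strict_mono_on {1..m} h" and \<alpha>: "\<alpha> permutes {1..m}"
    and \<alpha>h: "\<And>j l. j \<in> {1..m} \<Longrightarrow> l \<in> {1..m} \<Longrightarrow> \<pi> (h j) < \<pi> (h l) \<longleftrightarrow> \<alpha> j < \<alpha> l"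
    and blow: "\<not> no_k_blowup_in P m \<alpha> n"
    and s: "\<And>x. x \<in> {1..n} \<Longrightarrow> s x \<in> {1..m}"
    and col: "\<And>x. x \<in> {1..n} \<Longrightarrow> grid_col n (2 ^ lev x) (h (s x)) = grid_col n (2 ^ lev x) x"
    and row: "\<And>x. x \<in> {1..n} \<Longrightarrow> grid_col n (2 ^ lev x) (\<pi> (h (s x))) = grid_col n (2 ^ lev x) (\<pi> x)"
  shows "\<exists>\<rho>\<in>P n. planar_tau n \<pi> \<rho> \<le> real (4 * (\<Sum>x\<in>{1..n}. n div 2 ^ lev x + 1)) / real (n choose 2)"
proof -
  have n: "n \<ge> 1" and perm: "\<pi> permutes {1..n}" using \<pi> by (auto simp: perms_of_length_def)
  obtain N \<beta> b where \<beta>P: "\<beta> \<in> P N" and \<beta>: "\<beta> permutes {1..N}" and bw: "blowup_with m \<alpha> N \<beta> b"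
    and size: "\<And>j. j \<in> {1..m} \<Longrightarrow> b (j + 1) - b j = n"
    using blow unfolding no_k_blowup_in_def k_blowup_def perms_of_length_def by blast
  have b: "b 1 = 1" "b (m + 1) = N + 1" "strict_mono_on {1..m + 1} b"
    using bw unfolding blowup_with_def by auto
  have b_le: "b i \<le> b j" if "i \<in> {1..m + 1}" "j \<in> {1..m + 1}" "i \<le> j" for i j
    using strict_mono_on_leD[OF b(3) that] .
  have bsuc: "b (j + 1) = b j + n" if "j \<in> {1..m}" for j
    using size[OF that] b_le[of j "j + 1"] that n by simp
  define e where "e x = b (s x) + (x - 1)" for x
  have eblk: "e x \<in> {b (s x)..<b (s x + 1)}" if "x \<in> {1..n}" for x
    using that bsuc[OF s[OF that]] by (auto simp: e_def)
  have eN: "e x \<in> {1..N}" if "x \<in> {1..n}" for x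
    using eblk[OF that] b_le[of 1 "s x"] b_le[of "s x + 1" "m + 1"] s[OF that] b(1,2) by auto
  have e_less: "e x < e y" if "x \<in> {1..n}" "y \<in> {1..n}" "s x < s y" for x y
    using eblk[OF that(1)] eblk[OF that(2)] b_le[of "s x + 1" "s y"] s[OF that(1)] s[OF that(2)] that(3) by auto
  have einj: "inj_on e {1..n}"
  proof (rule inj_onI)
    fix x y assume xy: "x \<in> {1..n}" "y \<in> {1..n}" "e x = e y"
    then have "s x = s y" using e_less[of x y] e_less[of y x] by (metis less_irrefl linorder_neqE_nat)
    then show "x = y" using xy by (auto simp: e_def)
  qed
  have eimg: "e ` {1..n} \<subseteq> {1..N}" using eN by blast
  define g where "g = \<beta> \<circ> e"
  have ginj: "inj_on g {1..n}"
    unfolding g_def by (rule comp_inj_on[OF einj inj_on_subset[OF permutes_inj[OF \<beta>] subset_UNIV]])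
  have g_less: "g x < g y" if "x \<in> {1..n}" "y \<in> {1..n}" "\<pi> (h (s x)) < \<pi> (h (s y))" for x y
  proof -
    have \<alpha>s: "\<alpha> (s x) < \<alpha> (s y)" using \<alpha>h[OF s[OF that(1)] s[OF that(2)]] that(3) by simp
    then have "s y \<noteq> s x" by auto
    then have "\<beta> (e y) > \<beta> (e x) \<longleftrightarrow> \<alpha> (s y) > \<alpha> (s x)"
      using bw s[OF that(1)] s[OF that(2)] eblk[OF that(1)] eblk[OF that(2)] unfolding blowup_with_def by blast
    then show ?thesis using \<alpha>s by (simp add: g_def)
  qed
  \<comment> \<open>Point \<open>x\<close> has coordinates \<open>(x, \<pi> x)\<close> in
    \<open>\<pi>\<close> and \<open>(re x, rg x)\<close> in \<open>\<rho>\<close>; \<open>re\<close>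
    moves the positions and \<open>u\<close> below moves the values.\<close>
  define re where "re = rank_perm n e"
  define rg where "rg = rank_perm n g"
  have re: "re permutes {1..n}" unfolding re_def by (rule rank_perm_permutes[OF einj])
  have rg: "rg permutes {1..n}" unfolding rg_def by (rule rank_perm_permutes[OF ginj])
  define \<rho> where "\<rho> = rg \<circ> inv_into UNIV re"
  have \<rho>P: "\<rho> \<in> P n"
    unfolding \<rho>_def rg_def re_def g_def by (rule hereditary_rank_perm[OF P(1) \<beta>P n \<beta> einj eimg])
  define u where "u = rg \<circ> inv_into UNIV \<pi>"
  have u: "u permutes {1..n}" unfolding u_def by (rule permutes_compose[OF permutes_inv[OF perm] rg])
  have "u \<circ> \<pi> \<circ> inv_into UNIV re = \<rho>"
    by (simp add: u_def \<rho>_def comp_assoc permutes_inv_o(2)[OF perm])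
  moreover have "inv_into UNIV re permutes {1..n}" using re by (rule permutes_inv)
  ultimately have tau: "planar_tau n \<pi> \<rho> \<le>
      (real (card (inversions n (inv_into UNIV re))) + real (card (inversions n (inv_into UNIV u)))) / real (n choose 2)"
    using planar_tau_le_inversions[OF \<pi> u] by metis
  let ?S = "\<Sum>x\<in>{1..n}. n div 2 ^ lev x + 1"
  have "card (inversions n re) \<le> 2 * ?S"
  proof -
    have "inversions n re \<subseteq> {(x, y). x \<in> {1..n} \<and> y \<in> {1..n} \<and> id x < id y \<and> \<not> id (h (s x)) < id (h (s y))}"
    proof
      fix p assume "p \<in> inversions n re"
      then obtain x y where p: "p = (x, y)" and xy: "x \<in> {1..n}" "y \<in> {1..n}" "x < y" "re y < re x"
        unfolding inversions_def by blast
      then have "e y < e x" using rank_perm_less_iff[OF xy(2,1), of e] by (simp add: re_def)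
      then have "\<not> s x < s y" using e_less[OF xy(1,2)] by auto
      then have "\<not> h (s x) < h (s y)" using strict_mono_on_less[OF h s[OF xy(1)] s[OF xy(2)]] by simp
      then show "p \<in> {(x, y). x \<in> {1..n} \<and> y \<in> {1..n} \<and> id x < id y \<and> \<not> id (h (s x)) < id (h (s y))}"
        using p xy by simp
    qed
    moreover have "finite {(x, y). x \<in> {1..n} \<and> y \<in> {1..n} \<and> id x < id y \<and> \<not> id (h (s x)) < id (h (s y))}"
      by (rule finite_subset[of _ "{1..n} \<times> {1..n}"]) auto
    ultimately have "card (inversions n re) \<le>
        card {(x, y). x \<in> {1..n} \<and> y \<in> {1..n} \<and> id x < id y \<and> \<not> id (h (s x)) < id (h (s y))}"
      by (intro card_mono)
    also have "\<dots> \<le> 2 * ?S"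
      using n col by (intro card_disordered_pairs_le[of n id lev "\<lambda>x. h (s x)"] permutes_id) simp_all
    finally show ?thesis .
  qed
  moreover have "card (inversions n u) \<le> 2 * ?S"
  proof -
    let ?D = "{(x, y). x \<in> {1..n} \<and> y \<in> {1..n} \<and> \<pi> x < \<pi> y \<and> \<not> \<pi> (h (s x)) < \<pi> (h (s y))}"
    have finD: "finite ?D" by (rule finite_subset[of _ "{1..n} \<times> {1..n}"]) auto
    have "inversions n u \<subseteq> map_prod \<pi> \<pi> ` ?D"
    proof
      fix p assume "p \<in> inversions n u"
      then obtain a c where p: "p = (a, c)" and ac: "a \<in> {1..n}" "c \<in> {1..n}" "a < c" "u c < u a"
        unfolding inversions_def by blast
      define x y where "x = inv_into UNIV \<pi> a" and "y = inv_into UNIV \<pi> c"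
      have \<pi>xy: "\<pi> x = a" "\<pi> y = c" unfolding x_def y_def by (rule permutes_inverses(1)[OF perm])+
      have xy: "x \<in> {1..n}" "y \<in> {1..n}"
        unfolding x_def y_def using ac permutes_in_image[OF permutes_inv[OF perm]] by simp_all
      have "rg y < rg x" using ac(4) by (simp add: u_def x_def y_def)
      then have "g y < g x" using rank_perm_less_iff[OF xy(2,1), of g] by (simp add: rg_def)
      then have "\<not> \<pi> (h (s x)) < \<pi> (h (s y))" using g_less[OF xy] by auto
      then have "(x, y) \<in> ?D" using xy \<pi>xy ac(3) by simp
      then have "map_prod \<pi> \<pi> (x, y) \<in> map_prod \<pi> \<pi> ` ?D" by (rule imageI)
      then show "p \<in> map_prod \<pi> \<pi> ` ?D" by (simp add: p \<pi>xy)
    qed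
    then have "card (inversions n u) \<le> card (map_prod \<pi> \<pi> ` ?D)" using finD by (intro card_mono) simp_all
    also have "\<dots> \<le> card ?D" using finD by (rule card_image_le)
    also have "\<dots> \<le> 2 * ?S"
      using n row perm by (intro card_disordered_pairs_le[of n \<pi> lev "\<lambda>x. h (s x)"]) simp_all
    finally show ?thesis .
  qed
  ultimately have "card (inversions n (inv_into UNIV re)) + card (inversions n (inv_into UNIV u)) \<le> 4 * ?S"
    using card_inversions_inv_le[OF re] card_inversions_inv_le[OF u] by linarith
  then have "real (card (inversions n (inv_into UNIV re))) + real (card (inversions n (inv_into UNIV u))) \<le> real (4 * ?S)"
    unfolding of_nat_add[symmetric] by (rule of_nat_mono)
  then have "planar_tau n \<pi> \<rho> \<le> real (4 * ?S) / real (n choose 2)"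
    by (intro order_trans[OF tau] divide_right_mono) simp_all
  then show ?thesis using \<rho>P by (intro bexI[of _ \<rho>])
qed

section \<open>The tester and its completeness\<close>

primrec query_all :: "nat list \<Rightarrow> (nat list \<Rightarrow> bool) \<Rightarrow> query_tree" where
  "query_all [] D = Output (D [])"
| "query_all (p # ps) D = Query p (\<lambda>v. query_all ps (\<lambda>vs. D (v # vs)))"

lemma queries_query_all [simp]: "queries (query_all ps D) \<pi> = ps"
  by (induction ps arbitrary: D) simp_all

lemma verdict_query_all [simp]: "verdict (query_all ps D) \<pi> = D (map \<pi> ps)"
  by (induction ps arbitrary: D) simp_all

text \<open>Here \<open>f\<close> gives the sampled positions, \<open>g\<close> their values, and
  \<open>\<tau>\<close> sorts the sample by position. Strict monotonicity makes every sample with a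
  repeated position a rejected one; this can hurt only completeness, where collisions are counted
  among the bad events.\<close>

definition accepts :: "perm_family \<Rightarrow> nat \<Rightarrow> (nat \<Rightarrow> nat) \<Rightarrow> (nat \<Rightarrow> nat) \<Rightarrow> bool" where
  "accepts P m f g \<longleftrightarrow> (\<exists>\<alpha>\<in>perms_of_length m. \<exists>\<tau>. \<tau> permutes {1..m} \<and> strict_mono_on {1..m} (f \<circ> \<tau>) \<and>
     (\<forall>j\<in>{1..m}. \<forall>l\<in>{1..m}. g (\<tau> j) < g (\<tau> l) \<longleftrightarrow> \<alpha> j < \<alpha> l) \<and> kstar_perm P m \<alpha> = \<infinity>)"

lemma accepts_cong:
  assumes "\<And>i. i \<in> {1..m} \<Longrightarrow> g i = g' i"
  shows "accepts P m f g = accepts P m f g'"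
proof -
  have *: "accepts P m f g'" if eq: "\<And>i. i \<in> {1..m} \<Longrightarrow> g i = g' i" and acc: "accepts P m f g" for g g'
  proof -
    obtain \<alpha> \<tau> where \<alpha>: "\<alpha> \<in> perms_of_length m" "\<tau> permutes {1..m}" "strict_mono_on {1..m} (f \<circ> \<tau>)"
      "\<forall>j\<in>{1..m}. \<forall>l\<in>{1..m}. g (\<tau> j) < g (\<tau> l) \<longleftrightarrow> \<alpha> j < \<alpha> l" "kstar_perm P m \<alpha> = \<infinity>"
      using acc unfolding accepts_def by blast
    have "g (\<tau> j) = g' (\<tau> j)" if "j \<in> {1..m}" for j
      using that permutes_in_image[OF \<alpha>(2)] by (intro eq) simp
    with \<alpha> show ?thesis unfolding accepts_def by (intro bexI[of _ \<alpha>] exI[of _ \<tau>]) simp_all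
  qed
  show ?thesis using *[of g g'] *[of g' g] assms by metis
qed

definition samples :: "nat \<Rightarrow> nat \<Rightarrow> (nat \<Rightarrow> nat) set" where
  "samples m n = {1..m} \<rightarrow>\<^sub>E {1..n}"

lemma samples_in: "f \<in> samples m n \<Longrightarrow> a \<in> {1..m} \<Longrightarrow> f a \<in> {1..n}"
  unfolding samples_def by (rule PiE_mem)

lemma card_samples [simp]: "card (samples m n) = n ^ m"
  unfolding samples_def by (simp add: card_PiE)

lemma finite_samples [simp]: "finite (samples m n)"
  unfolding samples_def by (intro finite_PiE) simp_all

definition sampling_tester :: "perm_family \<Rightarrow> nat \<Rightarrow> nat \<Rightarrow> query_tree pmf" where
  "sampling_tester P m n = map_pmf
     (\<lambda>f. query_all (map f [1..<m + 1]) (\<lambda>vs. accepts P m f (\<lambda>i. vs ! (i - 1))))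
     (pmf_of_set (samples m n))"

text \<open>The sample is uniform on \<open>n ^ m\<close> functions, so both error bounds become
  counts: at most one third of the samples may err.\<close>

lemma two_sided_tester_sampling_tester:
  assumes yes: "\<And>n \<pi>. n0 \<le> ereal (real n) \<Longrightarrow> \<pi> \<in> perms_of_length n \<Longrightarrow> \<pi> \<in> P n \<Longrightarrow>
      3 * card {f \<in> samples m n. \<not> accepts P m f (\<pi> \<circ> f)} \<le> n ^ m"
    and no: "\<And>n \<pi>. n0 \<le> ereal (real n) \<Longrightarrow> \<pi> \<in> perms_of_length n \<Longrightarrow> far_from d P \<epsilon> n \<pi> \<Longrightarrow>
      3 * card {f \<in> samples m n. accepts P m f (\<pi> \<circ> f)} \<le> n ^ m"
  shows "two_sided_tester d P \<epsilon> m n0 (sampling_tester P m)"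
  unfolding two_sided_tester_def
proof (intro allI impI, elim conjE)
  fix n \<pi> assume n0: "n0 \<le> ereal (real n)" and \<pi>: "\<pi> \<in> perms_of_length n"
  have n: "n \<ge> 1" using \<pi> by (simp add: perms_of_length_def)
  let ?F = "samples m n"
  let ?t = "\<lambda>f. query_all (map f [1..<m + 1]) (\<lambda>vs. accepts P m f (\<lambda>i. vs ! (i - 1)))"
  have "card ?F > 0" unfolding card_samples using n by simp
  then have ne: "?F \<noteq> {}" by (metis card.empty less_irrefl)
  have verdict: "verdict (?t f) \<pi> = accepts P m f (\<pi> \<circ> f)" for f
  proof -
    have "map \<pi> (map f [1..<m + 1]) ! (i - 1) = (\<pi> \<circ> f) i" if "i \<in> {1..m}" for i
    proof -
      obtain i' where "i = Suc i'" using \<open>i \<in> {1..m}\<close> by (cases i) auto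
      then show ?thesis using \<open>i \<in> {1..m}\<close> by (simp del: upt_Suc)
    qed
    then have "accepts P m f (\<lambda>i. map \<pi> (map f [1..<m + 1]) ! (i - 1)) = accepts P m f (\<pi> \<circ> f)"
      by (rule accepts_cong)
    then show ?thesis by (simp only: verdict_query_all)
  qed
  have prob: "measure_pmf.prob (sampling_tester P m n) {t. Q (verdict t \<pi>)} =
      real (card {f \<in> ?F. Q (accepts P m f (\<pi> \<circ> f))}) / real (n ^ m)" for Q
  proof -
    have "measure_pmf.prob (sampling_tester P m n) {t. Q (verdict t \<pi>)} =
        measure_pmf.prob (pmf_of_set ?F) {f. Q (accepts P m f (\<pi> \<circ> f))}"
      unfolding sampling_tester_def measure_map_pmf vimage_def mem_Collect_eq verdict ..
    also have "\<dots> = real (card (?F \<inter> {f. Q (accepts P m f (\<pi> \<circ> f))})) / real (card ?F)"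
      using ne by (intro measure_pmf_of_set) simp_all
    also have "?F \<inter> {f. Q (accepts P m f (\<pi> \<circ> f))} = {f \<in> ?F. Q (accepts P m f (\<pi> \<circ> f))}" by blast
    finally show ?thesis by (simp only: card_samples)
  qed
  have compl: "card {f \<in> ?F. Q f} + card {f \<in> ?F. \<not> Q f} = n ^ m" for Q
  proof -
    have "card ({f \<in> ?F. Q f} \<union> {f \<in> ?F. \<not> Q f}) = card {f \<in> ?F. Q f} + card {f \<in> ?F. \<not> Q f}"
      by (rule card_Un_disjoint) auto
    moreover have "{f \<in> ?F. Q f} \<union> {f \<in> ?F. \<not> Q f} = ?F" by blast
    ultimately show ?thesis by (simp only: card_samples)
  qed
  have two_thirds: "2 / 3 \<le> real a / real (n ^ m)" if "a + b = n ^ m" "3 * b \<le> n ^ m" for a b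
  proof -
    have "2 * n ^ m \<le> 3 * a" using that by linarith
    then have "real (2 * n ^ m) \<le> real (3 * a)" by (rule of_nat_mono)
    moreover have "0 < real (n ^ m)" using n by simp
    ultimately show ?thesis by (simp add: le_divide_eq del: of_nat_power)
  qed
  show "(\<forall>t\<in>set_pmf (sampling_tester P m n). length (queries t \<pi>) \<le> m \<and> set (queries t \<pi>) \<subseteq> {1..n}) \<and>
    (\<pi> \<in> P n \<longrightarrow> 2 / 3 \<le> measure_pmf.prob (sampling_tester P m n) {t. verdict t \<pi>}) \<and>
    (far_from d P \<epsilon> n \<pi> \<longrightarrow> 2 / 3 \<le> measure_pmf.prob (sampling_tester P m n) {t. \<not> verdict t \<pi>})"
  proof (intro conjI ballI impI)
    fix t assume "t \<in> set_pmf (sampling_tester P m n)"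
    then obtain f where f: "f \<in> ?F" "t = ?t f"
      unfolding sampling_tester_def set_map_pmf set_pmf_of_set[OF ne finite_samples] by (rule imageE)
    show "length (queries t \<pi>) \<le> m" by (simp add: f(2) del: upt_Suc)
    show "set (queries t \<pi>) \<subseteq> {1..n}"
    proof -
      have eq: "set (map f [1..<m + 1]) = f ` {1..m}" by auto
      show ?thesis
        unfolding f(2) queries_query_all eq using samples_in[OF f(1)] by (rule image_subsetI)
    qed
  next
    assume "\<pi> \<in> P n"
    show "2 / 3 \<le> measure_pmf.prob (sampling_tester P m n) {t. verdict t \<pi>}"
      unfolding prob[of "\<lambda>b. b"] using compl yes[OF n0 \<pi> \<open>\<pi> \<in> P n\<close>] by (rule two_thirds)
  next
    assume "far_from d P \<epsilon> n \<pi>"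
    show "2 / 3 \<le> measure_pmf.prob (sampling_tester P m n) {t. \<not> verdict t \<pi>}"
      unfolding prob[of Not] using compl[of "\<lambda>f. \<not> accepts P m f (\<pi> \<circ> f)"] no[OF n0 \<pi> \<open>far_from d P \<epsilon> n \<pi>\<close>]
      unfolding not_not by (rule two_thirds)
  qed
qed

section \<open>The parameter \<open>k*\<close> and the samples rejected for a member\<close>

lemma kstar_perm_eq_infinity_iff: "kstar_perm P m \<alpha> = \<infinity> \<longleftrightarrow> (\<forall>k\<ge>1. \<not> no_k_blowup_in P m \<alpha> k)"
  by (auto simp: kstar_perm_def)

lemma finite_kstar_perm_obtain:
  assumes "kstar_perm P m \<alpha> \<noteq> \<infinity>"
  obtains k where "k \<ge> 1" "no_k_blowup_in P m \<alpha> k" "kstar_perm P m \<alpha> = enat k"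
proof -
  let ?Q = "\<lambda>k. k \<ge> 1 \<and> no_k_blowup_in P m \<alpha> k"
  have ex: "\<exists>k. ?Q k" using assms unfolding kstar_perm_eq_infinity_iff by blast
  then have "?Q (LEAST k. ?Q k)" by (rule LeastI_ex)
  moreover have "kstar_perm P m \<alpha> = enat (LEAST k. ?Q k)"
    unfolding kstar_perm_def by (rule if_P[OF ex])
  ultimately show ?thesis using that[of "LEAST k. ?Q k"] by (elim conjE)
qed

lemma kstar_perm_le_kstar:
  assumes "\<alpha> \<in> perms_of_length m" "kstar_perm P m \<alpha> \<noteq> \<infinity>"
  shows "kstar_perm P m \<alpha> \<le> kstar P m"
proof -
  let ?K = "{kstar_perm P m \<alpha> | \<alpha>. \<alpha> \<in> perms_of_length m \<and> kstar_perm P m \<alpha> < \<infinity>}"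
  have "?K \<subseteq> kstar_perm P m ` perms_of_length m" by blast
  then have fin: "finite ?K" using finite_perms_of_length by (meson finite_imageI finite_subset)
  have lt: "kstar_perm P m \<alpha> < \<infinity>" using assms(2) by (simp add: less_top[symmetric] top_enat_def[symmetric])
  then have "kstar P m = Max ?K" using assms(1) unfolding kstar_def by (intro if_P) blast
  moreover have "kstar_perm P m \<alpha> \<in> ?K" using assms(1) lt by blast
  ultimately show ?thesis using Max_ge[OF fin] by simp
qed

lemma kstar_ge_1: "kstar P m \<ge> 1"
proof (cases "\<exists>\<alpha>\<in>perms_of_length m. kstar_perm P m \<alpha> < \<infinity>")
  case True
  then obtain \<alpha> where \<alpha>: "\<alpha> \<in> perms_of_length m" "kstar_perm P m \<alpha> \<noteq> \<infinity>" by auto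
  obtain k where "k \<ge> 1" "kstar_perm P m \<alpha> = enat k" using \<alpha>(2) by (rule finite_kstar_perm_obtain)
  then have "1 \<le> kstar_perm P m \<alpha>" by (simp add: one_enat_def)
  also have "\<dots> \<le> kstar P m" using \<alpha> by (rule kstar_perm_le_kstar)
  finally show ?thesis .
next
  case False
  then have "kstar P m = \<infinity>" unfolding kstar_def by (rule if_not_P)
  then show ?thesis by simp
qed

text \<open>Independence of the coordinates: once the others are fixed, coordinate \<open>a\<close>
  has to hit a set of at most \<open>D\<close> positions. Erasing \<open>f a\<close> in the argument
  of \<open>T\<close> expresses that this set depends only on the others.\<close>

lemma card_samples_coordinate_le:
  assumes a: "a \<in> {1..m}" and T: "\<And>g. card (T g) \<le> D" "\<And>g. finite (T g)"
  shows "card {f \<in> samples m n. f a \<in> T (f(a := undefined))} \<le> n ^ (m - 1) * D"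
proof -
  let ?R = "({1..m} - {a}) \<rightarrow>\<^sub>E {1..n}"
  let ?S = "{f \<in> samples m n. f a \<in> T (f(a := undefined))}"
  have fin: "finite ?R" by (intro finite_PiE) simp_all
  have "inj_on (\<lambda>f. (f(a := undefined), f a)) ?S"
  proof (rule inj_onI)
    fix f f' :: "nat \<Rightarrow> nat" assume "(f(a := undefined), f a) = (f'(a := undefined), f' a)"
    then have eq: "f(a := undefined) = f'(a := undefined)" "f a = f' a" by (simp_all only: prod.inject)
    show "f = f'"
    proof
      fix x
      show "f x = f' x" using fun_cong[OF eq(1), of x] eq(2) by (cases "x = a") simp_all
    qed
  qed
  moreover have "(\<lambda>f. (f(a := undefined), f a)) ` ?S \<subseteq> (SIGMA g:?R. T g)"
  proof
    fix p assume "p \<in> (\<lambda>f. (f(a := undefined), f a)) ` ?S"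
    then obtain f where f: "p = (f(a := undefined), f a)" "f \<in> ?S" by (rule imageE)
    then have "f(a := undefined) \<in> ?R" by (auto simp: samples_def PiE_iff extensional_def)
    then show "p \<in> (SIGMA g:?R. T g)" using f by simp
  qed
  moreover have "finite (SIGMA g:?R. T g)" using fin T(2) by (intro finite_SigmaI)
  ultimately have "card ?S \<le> card (SIGMA g:?R. T g)" by (rule card_inj_on_le)
  also have "\<dots> = (\<Sum>g\<in>?R. card (T g))" using fin T(2) by (intro card_SigmaI) auto
  also have "\<dots> \<le> card ?R * D" using sum_bounded_above[of ?R "\<lambda>g. card (T g)" D] T(1) by simp
  also have "card ?R = n ^ (m - 1)" using a by (simp add: card_PiE)
  finally show ?thesis .
qed

text \<open>The obstruction to fattening. With \<open>v < \<pi> x\<close>, a point \<open>x\<close>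
  outside this set has at least \<open>k\<close> points of its own strip, itself included, with
  values above \<open>v\<close> and up to \<open>\<pi> x\<close>.\<close>

definition shallow :: "nat \<Rightarrow> (nat \<Rightarrow> nat) \<Rightarrow> nat \<Rightarrow> nat \<Rightarrow> nat \<Rightarrow> nat set" where
  "shallow n \<pi> N k v = {x \<in> {1..n}. v < \<pi> x \<and>
     card {z \<in> {1..n}. grid_col n N z = grid_col n N x \<and> v < \<pi> z \<and> \<pi> z \<le> \<pi> x} < k}"

text \<open>Within a strip the number of points in the window grows strictly with
  \<open>\<pi> x\<close>, so it identifies the point; a count below \<open>k\<close> leaves at most
  \<open>k\<close> points per strip.\<close>

lemma card_shallow_le:
  assumes N: "N > 0" and \<pi>: "\<pi> permutes {1..n}"
  shows "card (shallow n \<pi> N k v) \<le> N * k"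
proof -
  let ?F = "shallow n \<pi> N k v"
  define G where "G x = {z \<in> {1..n}. grid_col n N z = grid_col n N x \<and> v < \<pi> z \<and> \<pi> z \<le> \<pi> x}" for x
  let ?d = "\<lambda>x. card (G x)"
  have lt: "?d x < ?d y" if "x \<in> ?F" "y \<in> ?F" "grid_col n N x = grid_col n N y" "\<pi> x < \<pi> y" for x y
  proof (rule psubset_card_mono)
    have y: "y \<in> G y" "y \<notin> G x" using that(2,4) by (simp_all add: shallow_def G_def)
    have "G x \<subseteq> G y" using that(3,4) by (auto simp: G_def)
    then show "G x \<subset> G y" using y by blast
  qed (simp add: G_def)
  have "inj_on (\<lambda>x. (grid_col n N x, ?d x)) ?F"
  proof (rule inj_onI)
    fix x y assume xy: "x \<in> ?F" "y \<in> ?F" "(grid_col n N x, ?d x) = (grid_col n N y, ?d y)"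
    have c: "grid_col n N x = grid_col n N y" using xy(3) by (rule Pair_inject)
    have d: "?d x = ?d y" using xy(3) by (rule Pair_inject)
    have "\<not> \<pi> x < \<pi> y"
    proof
      assume "\<pi> x < \<pi> y"
      from lt[OF xy(1,2) c this] show False unfolding d by simp
    qed
    moreover have "\<not> \<pi> y < \<pi> x"
    proof
      assume "\<pi> y < \<pi> x"
      from lt[OF xy(2,1) c[symmetric] this] show False unfolding d by simp
    qed
    ultimately have "\<pi> x = \<pi> y" by linarith
    then show "x = y" using permutes_inj[OF \<pi>] by (simp add: inj_eq)
  qed
  moreover have "(\<lambda>x. (grid_col n N x, ?d x)) ` ?F \<subseteq> {..<N} \<times> {..<k}"
  proof
    fix p assume "p \<in> (\<lambda>x. (grid_col n N x, ?d x)) ` ?F"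
    then obtain x where x: "p = (grid_col n N x, ?d x)" "x \<in> ?F" by (rule imageE)
    then have "?d x < k" "x \<in> {1..n}" unfolding shallow_def G_def by simp_all
    then show "p \<in> {..<N} \<times> {..<k}" using grid_col_less[OF N] x(1) by simp
  qed
  ultimately have "card ?F \<le> card ({..<N} \<times> {..<k})" by (intro card_inj_on_le) simp_all
  then show ?thesis by simp
qed

text \<open>The groups of the blow-up consist, for each sample point, of the points of its strip that lie
  above the next lower sample value and not above the sample point.\<close>

lemma accepts_if_no_shallow:
  assumes P: "hereditary P" and \<pi>P: "\<pi> \<in> P n" and \<pi>: "\<pi> permutes {1..n}" and m: "m \<ge> 1"
    and f: "f \<in> samples m n" and K: "kstar P m = enat K"
    and cols: "\<And>a b. a \<in> {1..m} \<Longrightarrow> b \<in> {1..m} \<Longrightarrow> a \<noteq> b \<Longrightarrow> grid_col n N (f a) \<noteq> grid_col n N (f b)"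
    and sh: "\<And>a b. a \<in> {1..m} \<Longrightarrow> b \<in> {1..m} \<Longrightarrow> a \<noteq> b \<Longrightarrow> f a \<notin> shallow n \<pi> N K (\<pi> (f b))"
    and sh0: "\<And>a. a \<in> {1..m} \<Longrightarrow> f a \<notin> shallow n \<pi> N K 0"
  shows "accepts P m f (\<pi> \<circ> f)"
proof -
  have finj: "inj_on f {1..m}" using cols by (intro inj_onI) metis
  define \<tau> where "\<tau> = inv_into UNIV (rank_perm m f)"
  have r: "rank_perm m f permutes {1..m}" by (rule rank_perm_permutes[OF finj])
  have \<tau>: "\<tau> permutes {1..m}" unfolding \<tau>_def by (rule permutes_inv[OF r])
  have \<tau>in: "\<tau> j \<in> {1..m}" if "j \<in> {1..m}" for j using that permutes_in_image[OF \<tau>] by simp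
  define h where "h = f \<circ> \<tau>"
  have h: "strict_mono_on {1..m} h"
  proof (rule strict_mono_onI)
    fix a b assume ab: "a \<in> {1..m}" "b \<in> {1..m}" "a < b"
    then have "rank_perm m f (\<tau> a) < rank_perm m f (\<tau> b)"
      by (simp add: \<tau>_def permutes_inverses(1)[OF r])
    then show "h a < h b" using rank_perm_less_iff[OF \<tau>in[OF ab(1)] \<tau>in[OF ab(2)]] by (simp add: h_def)
  qed
  have hn: "h j \<in> {1..n}" if "j \<in> {1..m}" for j using samples_in[OF f \<tau>in[OF that]] by (simp add: h_def)
  define \<alpha> where "\<alpha> = rank_perm m (\<pi> \<circ> h)"
  have "inj_on (\<pi> \<circ> h) {1..m}"
    by (rule comp_inj_on[OF strict_mono_on_imp_inj_on[OF h] inj_on_subset[OF permutes_inj[OF \<pi>] subset_UNIV]])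
  then have \<alpha>: "\<alpha> permutes {1..m}" unfolding \<alpha>_def by (rule rank_perm_permutes)
  have \<alpha>h: "\<alpha> j < \<alpha> l \<longleftrightarrow> \<pi> (h j) < \<pi> (h l)" if "j \<in> {1..m}" "l \<in> {1..m}" for j l
    using rank_perm_less_iff[OF that, of "\<pi> \<circ> h"] by (simp add: \<alpha>_def)
  have \<alpha>p: "\<alpha> \<in> perms_of_length m" using \<alpha> m by (simp add: perms_of_length_def)
  have "kstar_perm P m \<alpha> = \<infinity>"
  proof (rule ccontr)
    assume ninf: "kstar_perm P m \<alpha> \<noteq> \<infinity>"
    then obtain k where k: "k \<ge> 1" "no_k_blowup_in P m \<alpha> k" "kstar_perm P m \<alpha> = enat k"
      by (rule finite_kstar_perm_obtain)
    have kK: "k \<le> K" using kstar_perm_le_kstar[OF \<alpha>p ninf] k(3) K by simp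
    \<comment> \<open>The value 0 lies below all values of \<open>\<pi>\<close> and is the threshold
      of the lowest sample point.\<close>
    define V where "V j = insert 0 {\<pi> (h l) | l. l \<in> {1..m} \<and> \<pi> (h l) < \<pi> (h j)}" for j
    have finV: "finite (V j)" for j
    proof -
      have "V j \<subseteq> insert 0 ((\<lambda>l. \<pi> (h l)) ` {1..m})" unfolding V_def by blast
      then show ?thesis by (rule finite_subset) simp
    qed
    define v where "v j = Max (V j)" for j
    have vV: "v j \<in> V j" for j unfolding v_def by (rule Max_in[OF finV]) (simp add: V_def)
    define H where "H j = {z \<in> {1..n}. grid_col n N z = grid_col n N (h j) \<and> v j < \<pi> z \<and> \<pi> z \<le> \<pi> (h j)}" for j
    have "\<not> no_k_blowup_in P m \<alpha> k"
    proof (rule k_blowup_from_groups[OF P \<pi>P \<pi> \<alpha> m k(1), where H = H])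
      fix j assume j: "j \<in> {1..m}"
      have "\<pi> (h j) \<in> {1..n}" using hn[OF j] permutes_in_image[OF \<pi>] by simp
      then have vlt: "v j < \<pi> (h j)" using vV[of j] by (auto simp: V_def)
      have "h j \<notin> shallow n \<pi> N K (v j)"
      proof (cases "v j = 0")
        case True
        then show ?thesis using sh0[OF \<tau>in[OF j]] by (simp add: h_def)
      next
        case False
        then obtain l where l: "l \<in> {1..m}" "v j = \<pi> (h l)" using vV[of j] by (auto simp: V_def)
        then have "l \<noteq> j" using vlt by auto
        then have "\<tau> l \<noteq> \<tau> j" using permutes_inj[OF \<tau>] by (simp add: inj_eq)
        then show ?thesis using sh[OF \<tau>in[OF j] \<tau>in[OF l(1)]] l(2) by (simp add: h_def)
      qed
      then have "K \<le> card (H j)" using hn[OF j] vlt unfolding shallow_def H_def by simp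
      moreover have "H j \<subseteq> {1..n}" unfolding H_def by blast
      ultimately show "H j \<subseteq> {1..n} \<and> k \<le> card (H j)" using kK by simp
    next
      fix j l x y assume jl: "j \<in> {1..m}" "l \<in> {1..m}" "j < l" and xy: "x \<in> H j" "y \<in> H l"
      have "\<tau> j \<noteq> \<tau> l" using jl(3) permutes_inj[OF \<tau>] by (simp add: inj_eq)
      then have "grid_col n N (h j) \<noteq> grid_col n N (h l)"
        using cols[OF \<tau>in[OF jl(1)] \<tau>in[OF jl(2)]] by (simp add: h_def)
      moreover have "grid_col n N (h j) \<le> grid_col n N (h l)"
        using strict_mono_onD[OF h jl] by (intro grid_col_mono) simp
      ultimately have "grid_col n N x < grid_col n N y" using xy by (simp add: H_def)
      then show "x < y" using grid_col_mono[of y x n N] by (meson not_le)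
    next
      fix j l x y assume jl: "j \<in> {1..m}" "l \<in> {1..m}" "\<alpha> j < \<alpha> l" and xy: "x \<in> H j" "y \<in> H l"
      have "\<pi> (h j) \<in> V l" using \<alpha>h[OF jl(1,2)] jl by (auto simp: V_def)
      then have "\<pi> (h j) \<le> v l" unfolding v_def using finV by (intro Max_ge)
      then show "\<pi> x < \<pi> y" using xy by (simp add: H_def)
    qed
    then show False using k(2) by contradiction
  qed
  then show ?thesis
    unfolding accepts_def using \<alpha>p \<tau> h \<alpha>h by (intro bexI[of _ \<alpha>] exI[of _ \<tau>]) (simp_all add: h_def comp_def)
qed

lemma card_not_accepts_le:
  assumes P: "hereditary P" and \<pi>P: "\<pi> \<in> P n" and \<pi>: "\<pi> permutes {1..n}" and m: "m \<ge> 2"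
    and K: "kstar P m = enat K" and n: "32 * m ^ 5 * K \<le> n"
  shows "3 * card {f \<in> samples m n. \<not> accepts P m f (\<pi> \<circ> f)} \<le> n ^ m"
proof -
  \<comment> \<open>A compromise: few strips make sample points share one, many strips make many
    points shallow. With this \<open>N\<close>, three times the collision terms costs at most
    \<open>n / 4 + 3 * m\<^sup>2\<close> and the shallow points cost \<open>36 * m ^ 4 * K\<close>;
    both fit since \<open>64 * m ^ 4 * K \<le> n\<close>.\<close>
  define N where "N = 12 * m\<^sup>2"
  have N: "N > 0" using m by (simp add: N_def)
  have K1: "K \<ge> 1" using kstar_ge_1[of P m] K by (simp add: one_enat_def)
  have m5: "m ^ 5 \<ge> 1" using m by simp
  have n1: "n \<ge> 1" using n K1 m5 by (metis One_nat_def Suc_leI le_trans mult_is_0 not_gr_zero not_one_le_zero zero_neq_numeral)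
  define S where "S c = {x \<in> {1..n}. grid_col n N x = c}" for c
  have cS: "card (S c) \<le> n div N + 1" for c
    unfolding S_def using card_grid_col_le[OF N] n1 by simp
  \<comment> \<open>For \<open>b = a\<close> the entry \<open>g a\<close> has been erased, and this
    slot holds the condition for threshold 0 instead.\<close>
  define U where "U a g b = (if b = a then shallow n \<pi> N K 0
      else S (grid_col n N (g b)) \<union> shallow n \<pi> N K (\<pi> (g b)))" for a :: nat and g :: "nat \<Rightarrow> nat" and b
  define T where "T a g = (\<Union>b\<in>{1..m}. U a g b)" for a g
  define D where "D = m * (n div N + 1 + N * K)"
  have cU: "card (U a g b) \<le> n div N + 1 + N * K" for a g b
  proof (cases "b = a")
    case True
    then show ?thesis using card_shallow_le[OF N \<pi>, of K 0] by (simp add: U_def)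
  next
    case False
    then have "card (U a g b) \<le> card (S (grid_col n N (g b))) + card (shallow n \<pi> N K (\<pi> (g b)))"
      unfolding U_def using card_Un_le by simp
    then show ?thesis using cS[of "grid_col n N (g b)"] card_shallow_le[OF N \<pi>, of K "\<pi> (g b)"] by linarith
  qed
  have finU: "finite (U a g b)" for a g b by (simp add: U_def S_def shallow_def)
  have cT: "card (T a g) \<le> D" for a g
  proof -
    have "card (T a g) \<le> (\<Sum>b\<in>{1..m}. card (U a g b))" unfolding T_def by (rule card_UN_le) simp
    also have "\<dots> \<le> of_nat (card {1..m}) * (n div N + 1 + N * K)" by (intro sum_bounded_above cU)
    also have "\<dots> = D" by (simp add: D_def)
    finally show ?thesis .
  qed
  have finT: "finite (T a g)" for a g using finU by (simp add: T_def)
  let ?B = "\<lambda>a. {f \<in> samples m n. f a \<in> T a (f(a := undefined))}"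
  have "{f \<in> samples m n. \<not> accepts P m f (\<pi> \<circ> f)} \<subseteq> (\<Union>a\<in>{1..m}. ?B a)"
  proof (rule subsetI, rule ccontr)
    fix f assume f: "f \<in> {f \<in> samples m n. \<not> accepts P m f (\<pi> \<circ> f)}" and nB: "f \<notin> (\<Union>a\<in>{1..m}. ?B a)"
    then have fs: "f \<in> samples m n" by blast
    have nU: "f a \<notin> U a (f(a := undefined)) b" if "a \<in> {1..m}" "b \<in> {1..m}" for a b
      using nB fs that unfolding T_def by blast
    have fn: "f a \<in> {1..n}" if "a \<in> {1..m}" for a using fs that by (rule samples_in)
    have "accepts P m f (\<pi> \<circ> f)"
    proof (rule accepts_if_no_shallow[OF P \<pi>P \<pi> _ fs K])
      show "m \<ge> 1" using m by simp
      show "f a \<notin> shallow n \<pi> N K 0" if "a \<in> {1..m}" for a using nU[OF that that] by (simp add: U_def)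
      show "grid_col n N (f a) \<noteq> grid_col n N (f b)" if "a \<in> {1..m}" "b \<in> {1..m}" "a \<noteq> b" for a b
        using nU[OF that(1,2)] fn[OF that(1)] that(3) by (auto simp: U_def S_def)
      show "f a \<notin> shallow n \<pi> N K (\<pi> (f b))" if "a \<in> {1..m}" "b \<in> {1..m}" "a \<noteq> b" for a b
        using nU[OF that(1,2)] that(3) by (auto simp: U_def)
    qed
    then show False using f by blast
  qed
  moreover have "finite (\<Union>a\<in>{1..m}. ?B a)" by simp
  ultimately have "card {f \<in> samples m n. \<not> accepts P m f (\<pi> \<circ> f)} \<le> card (\<Union>a\<in>{1..m}. ?B a)"
    by (intro card_mono)
  also have "\<dots> \<le> (\<Sum>a\<in>{1..m}. card (?B a))" by (rule card_UN_le) simp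
  also have "\<dots> \<le> of_nat (card {1..m}) * (n ^ (m - 1) * D)"
    by (intro sum_bounded_above card_samples_coordinate_le cT finT)
  finally have "3 * card {f \<in> samples m n. \<not> accepts P m f (\<pi> \<circ> f)} \<le> n ^ (m - 1) * (3 * m * D)"
    by (simp add: mult.left_commute)
  also have "3 * m * D \<le> n"
  proof -
    have "N * (n div N) \<le> n" by simp
    then have 1: "12 * (m\<^sup>2 * (n div N)) \<le> n" by (simp add: N_def mult.assoc)
    have "m\<^sup>2 \<le> m ^ 4" using m by (intro power_increasing) auto
    then have 2: "m\<^sup>2 \<le> m ^ 4 * K" using K1 by (metis le_trans mult_le_mono2 mult.right_neutral)
    have "2 * (m ^ 4 * K) \<le> m * (m ^ 4 * K)" using m by (rule mult_le_mono1)
    moreover have "32 * (m * (m ^ 4 * K)) \<le> n" using n by (simp add: power_numeral_reduce algebra_simps)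
    ultimately have 3: "64 * (m ^ 4 * K) \<le> n" by linarith
    have "3 * m * D = 3 * (m\<^sup>2 * (n div N)) + 3 * m\<^sup>2 + 36 * (m ^ 4 * K)"
      by (simp add: D_def N_def algebra_simps power2_eq_square power_numeral_reduce)
    then show ?thesis using 1 2 3 by linarith
  qed
  also have "n ^ (m - 1) * n = n ^ m" using m by (intro power_minus_mult) simp
  finally show ?thesis by simp
qed

section \<open>Soundness\<close>

definition cell :: "nat \<Rightarrow> (nat \<Rightarrow> nat) \<Rightarrow> nat \<Rightarrow> nat \<Rightarrow> nat \<times> nat" where
  "cell n \<pi> N p = (grid_col n N p, grid_col n N (\<pi> p))"

lemma cell_in_grid:
  assumes "\<pi> permutes {1..n}" "p \<in> {1..n}" "N > 0"
  shows "cell n \<pi> N p \<in> {..<N} \<times> {..<N}"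
proof -
  have "\<pi> p \<in> {1..n}" using assms(2) permutes_in_image[OF assms(1)] by simp
  then show ?thesis using grid_col_less[OF assms(3)] assms(2) by (simp add: cell_def)
qed

text \<open>An occurrence of \<open>\<sigma>\<close> among the occupied cells lifts to sample points
  and so to \<open>\<alpha>\<close>. The first points of the blocks embed \<open>\<alpha>\<close>
  into any of its blow-ups, and one of these is a member, which cannot contain
  \<open>\<sigma>\<close>.\<close>

lemma card_occupied_cells_le:
  assumes P: "hereditary P" and \<sigma>: "\<sigma> \<in> perms_of_length k" "\<sigma> \<notin> P k" and \<pi>: "\<pi> permutes {1..n}"
    and h: "strict_mono_on {1..m} h" "h ` {1..m} \<subseteq> {1..n}"
    and \<alpha>: "\<alpha> permutes {1..m}" and N: "N > 0"
    and \<alpha>h: "\<And>j l. j \<in> {1..m} \<Longrightarrow> l \<in> {1..m} \<Longrightarrow> \<pi> (h j) < \<pi> (h l) \<longleftrightarrow> \<alpha> j < \<alpha> l"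
    and blow: "\<not> no_k_blowup_in P m \<alpha> K"
  shows "card (cell n \<pi> N ` h ` {1..m}) \<le> ex_perm N k \<sigma>"
proof (rule card_le_ex_perm)
  show \<sigma>p: "\<sigma> permutes {1..k}" using \<sigma>(1) by (simp add: perms_of_length_def)
  show "cell n \<pi> N ` h ` {1..m} \<subseteq> {..<N} \<times> {..<N}"
    using cell_in_grid[OF \<pi> _ N] h(2) by (intro image_subsetI) blast
  show "\<not> pat_contains k \<sigma> (cell n \<pi> N ` h ` {1..m})"
  proof
    assume "pat_contains k \<sigma> (cell n \<pi> N ` h ` {1..m})"
    then obtain r c where r: "strict_mono_on {1..k} r" and c: "strict_mono_on {1..k} c"
      and A: "\<And>i. i \<in> {1..k} \<Longrightarrow> (r i, c (\<sigma> i)) \<in> cell n \<pi> N ` h ` {1..m}"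
      unfolding pat_contains_def by metis
    have "\<exists>t. t \<in> {1..m} \<and> grid_col n N (h t) = r i \<and> grid_col n N (\<pi> (h t)) = c (\<sigma> i)" if "i \<in> {1..k}" for i
    proof -
      from A[OF that] obtain q where q: "(r i, c (\<sigma> i)) = cell n \<pi> N q" "q \<in> h ` {1..m}" by (rule imageE)
      from q(2) obtain t where t: "q = h t" "t \<in> {1..m}" by (rule imageE)
      from q(1) have "r i = grid_col n N (h t) \<and> c (\<sigma> i) = grid_col n N (\<pi> (h t))"
        unfolding cell_def t(1) prod.inject .
      with t(2) show ?thesis by metis
    qed
    then obtain t where t: "\<And>i. i \<in> {1..k} \<Longrightarrow>
        t i \<in> {1..m} \<and> grid_col n N (h (t i)) = r i \<and> grid_col n N (\<pi> (h (t i))) = c (\<sigma> i)"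
      by metis
    have grid_less: "a < b" if "grid_col n N a < grid_col n N b" for a b
      using that grid_col_mono[of b a n N] by (meson not_le)
    have tm: "strict_mono_on {1..k} t"
    proof (rule strict_mono_onI)
      fix a b assume ab: "a \<in> {1..k}" "b \<in> {1..k}" "a < b"
      then have "r a < r b" by (rule strict_mono_onD[OF r])
      then have "grid_col n N (h (t a)) < grid_col n N (h (t b))" using t[OF ab(1)] t[OF ab(2)] by simp
      then have "h (t a) < h (t b)" by (rule grid_less)
      then show "t a < t b" using strict_mono_on_less[OF h(1)] t[OF ab(1)] t[OF ab(2)] by blast
    qed
    have one: "\<alpha> (t a) < \<alpha> (t b)" if ab: "a \<in> {1..k}" "b \<in> {1..k}" "\<sigma> a < \<sigma> b" for a b
    proof -
      have "\<sigma> a \<in> {1..k}" "\<sigma> b \<in> {1..k}" using ab(1,2) permutes_in_image[OF \<sigma>p] by simp_all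
      then have "c (\<sigma> a) < c (\<sigma> b)" using ab(3) by (rule strict_mono_onD[OF c])
      then have "grid_col n N (\<pi> (h (t a))) < grid_col n N (\<pi> (h (t b)))"
        using t[OF ab(1)] t[OF ab(2)] by simp
      then have "\<pi> (h (t a)) < \<pi> (h (t b))" by (rule grid_less)
      then show ?thesis using \<alpha>h t[OF ab(1)] t[OF ab(2)] by blast
    qed
    have iff: "\<alpha> (t a) < \<alpha> (t b) \<longleftrightarrow> \<sigma> a < \<sigma> b" if ab: "a \<in> {1..k}" "b \<in> {1..k}" for a b
    proof (cases "a = b")
      case False
      then have "\<sigma> a \<noteq> \<sigma> b" using permutes_inj[OF \<sigma>p] by (simp add: inj_eq)
      then show ?thesis using one[OF ab] one[OF ab(2,1)] by linarith
    qed simp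
    obtain N' \<beta> b where \<beta>P: "\<beta> \<in> P N'" and bw: "blowup_with m \<alpha> N' \<beta> b"
      using blow unfolding no_k_blowup_in_def k_blowup_def by blast
    have b: "b 1 = 1" "b (m + 1) = N' + 1" "strict_mono_on {1..m + 1} b"
      using bw unfolding blowup_with_def by auto
    have \<beta>: "\<beta> (b i) < \<beta> (b j) \<longleftrightarrow> \<alpha> i < \<alpha> j" if ij: "i \<in> {1..m}" "j \<in> {1..m}" for i j
    proof (cases "i = j")
      case False
      have mem: "b l \<in> {b l..<b (l + 1)}" if "l \<in> {1..m}" for l
        using that strict_mono_onD[OF b(3), of l "l + 1"] by simp
      show ?thesis
        using bw ij False mem[OF ij(1)] mem[OF ij(2)] unfolding blowup_with_def by metis
    qed simp
    have "subpermutation k \<sigma> N' \<beta>"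
      unfolding subpermutation_def
    proof (intro exI[of _ "b \<circ> t"] conjI ballI)
      have t1: "t i \<in> {1..m}" if "i \<in> {1..k}" for i using t[OF that] by simp
      show "strict_mono_on {1..k} (b \<circ> t)"
      proof (rule strict_mono_onI)
        fix x y assume xy: "x \<in> {1..k}" "y \<in> {1..k}" "x < y"
        then have "t x < t y" by (rule strict_mono_onD[OF tm])
        then show "(b \<circ> t) x < (b \<circ> t) y"
          using strict_mono_onD[OF b(3), of "t x" "t y"] t1[OF xy(1)] t1[OF xy(2)] by simp
      qed
      show "(b \<circ> t) ` {1..k} \<subseteq> {1..N'}"
      proof (rule image_subsetI)
        fix i assume "i \<in> {1..k}"
        note ti = t1[OF this]
        have "b 1 \<le> b (t i)" using ti by (intro strict_mono_on_leD[OF b(3)]) auto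
        moreover have "b (t i) < b (m + 1)" using ti by (intro strict_mono_onD[OF b(3)]) auto
        ultimately show "(b \<circ> t) i \<in> {1..N'}" using b(1,2) by simp
      qed
      show "\<beta> ((b \<circ> t) j) < \<beta> ((b \<circ> t) l) \<longleftrightarrow> \<sigma> j < \<sigma> l" if "j \<in> {1..k}" "l \<in> {1..k}" for j l
        using \<beta>[OF t1[OF that(1)] t1[OF that(2)]] iff[OF that] by simp
    qed
    then have "\<sigma> \<in> P k" using P \<beta>P \<sigma>(1) unfolding hereditary_def by metis
    then show False using \<sigma>(2) by contradiction
  qed
qed

definition unoccupied :: "nat \<Rightarrow> (nat \<Rightarrow> nat) \<Rightarrow> nat \<Rightarrow> nat set \<Rightarrow> nat set" where
  "unoccupied n \<pi> N X = {x \<in> {1..n}. cell n \<pi> N x \<notin> cell n \<pi> N ` X}"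

lemma acceptsE:
  assumes acc: "accepts P m f (\<pi> \<circ> f)" and f: "f \<in> samples m n"
  obtains \<alpha> h where "\<alpha> permutes {1..m}" "strict_mono_on {1..m} h" "h ` {1..m} = f ` {1..m}"
    "h ` {1..m} \<subseteq> {1..n}"
    "\<And>j l. j \<in> {1..m} \<Longrightarrow> l \<in> {1..m} \<Longrightarrow> \<pi> (h j) < \<pi> (h l) \<longleftrightarrow> \<alpha> j < \<alpha> l"
    "\<And>K. K \<ge> 1 \<Longrightarrow> \<not> no_k_blowup_in P m \<alpha> K"
proof -
  obtain \<alpha> \<tau> where \<alpha>: "\<alpha> \<in> perms_of_length m" and \<tau>: "\<tau> permutes {1..m}" and h: "strict_mono_on {1..m} (f \<circ> \<tau>)"
    and \<alpha>h: "\<forall>j\<in>{1..m}. \<forall>l\<in>{1..m}. (\<pi> \<circ> f) (\<tau> j) < (\<pi> \<circ> f) (\<tau> l) \<longleftrightarrow> \<alpha> j < \<alpha> l"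
    and k: "kstar_perm P m \<alpha> = \<infinity>"
    using acc unfolding accepts_def by blast
  have img: "(f \<circ> \<tau>) ` {1..m} = f ` {1..m}"
    unfolding image_comp[symmetric] permutes_image[OF \<tau>] ..
  show ?thesis
  proof (rule that[OF _ h img])
    show "\<alpha> permutes {1..m}" using \<alpha> by (simp add: perms_of_length_def)
    show "(f \<circ> \<tau>) ` {1..m} \<subseteq> {1..n}" unfolding img using samples_in[OF f] by (rule image_subsetI)
    show "\<pi> ((f \<circ> \<tau>) j) < \<pi> ((f \<circ> \<tau>) l) \<longleftrightarrow> \<alpha> j < \<alpha> l" if "j \<in> {1..m}" "l \<in> {1..m}" for j l
      using \<alpha>h that by simp
    show "\<not> no_k_blowup_in P m \<alpha> K" if "K \<ge> 1" for K
      using k that unfolding kstar_perm_eq_infinity_iff by blast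
  qed
qed

text \<open>Each point is assigned at its finest occupied scale up to \<open>2 ^ J\<close>. The
  first term pays for points occupied at scale \<open>2 ^ J\<close>, the sum for points missed one
  step beyond their scale, and the last term for rounding.\<close>

lemma accepts_imp_close:
  assumes P: "hereditary P" "permutation_property P" and \<pi>: "\<pi> \<in> perms_of_length n" and m: "m \<ge> 1"
    and acc: "accepts P m f (\<pi> \<circ> f)" and f: "f \<in> samples m n"
  obtains \<rho> where "\<rho> \<in> P n" and "planar_tau n \<pi> \<rho> \<le>
    4 * (real n * (real n / 2 ^ J) + (\<Sum>j<J. real n / 2 ^ j * real (card (unoccupied n \<pi> (2 ^ Suc j) (f ` {1..m})))) + real n)
      / real (n choose 2)"
proof -
  have n: "n \<ge> 1" and perm: "\<pi> permutes {1..n}" using \<pi> by (auto simp: perms_of_length_def)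
  obtain \<alpha> h where \<alpha>: "\<alpha> permutes {1..m}" and h: "strict_mono_on {1..m} h" and img: "h ` {1..m} = f ` {1..m}"
    and hn: "h ` {1..m} \<subseteq> {1..n}"
    and \<alpha>h: "\<And>j l. j \<in> {1..m} \<Longrightarrow> l \<in> {1..m} \<Longrightarrow> \<pi> (h j) < \<pi> (h l) \<longleftrightarrow> \<alpha> j < \<alpha> l"
    and blow: "\<And>K. K \<ge> 1 \<Longrightarrow> \<not> no_k_blowup_in P m \<alpha> K"
    using acceptsE[OF acc f] by metis
  let ?X = "f ` {1..m}"
  define Lv where "Lv x = {j. j \<le> J \<and> cell n \<pi> (2 ^ j) x \<in> cell n \<pi> (2 ^ j) ` ?X}" for x
  define lev where "lev x = Max (Lv x)" for x
  have finLv: "finite (Lv x)" for x by (rule finite_subset[of _ "{..J}"]) (auto simp: Lv_def)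
  \<comment> \<open>The grid of scale \<open>2 ^ 0\<close> has a single cell, which every nonempty
    sample occupies, so each point has a level.\<close>
  have Lv0: "0 \<in> Lv x" if "x \<in> {1..n}" for x
  proof -
    have c0: "cell n \<pi> (2 ^ 0) y = (0, 0)" if "y \<in> {1..n}" for y
      using cell_in_grid[OF perm that, of 1] by (auto simp: cell_def)
    have "1 \<in> {1..m}" using m by simp
    then have "cell n \<pi> (2 ^ 0) (f 1) \<in> cell n \<pi> (2 ^ 0) ` ?X" "f 1 \<in> {1..n}"
      using samples_in[OF f] by blast+
    then show ?thesis using c0[OF that] c0[of "f 1"] by (simp add: Lv_def)
  qed
  have lev: "lev x \<in> Lv x" if "x \<in> {1..n}" for x
    unfolding lev_def using Lv0[OF that] by (intro Max_in[OF finLv]) blast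
  have "\<exists>j. j \<in> {1..m} \<and> cell n \<pi> (2 ^ lev x) (h j) = cell n \<pi> (2 ^ lev x) x" if "x \<in> {1..n}" for x
  proof -
    have "cell n \<pi> (2 ^ lev x) x \<in> cell n \<pi> (2 ^ lev x) ` h ` {1..m}"
      using lev[OF that] unfolding img Lv_def by simp
    then show ?thesis unfolding image_image by (elim imageE) metis
  qed
  then obtain s where s: "\<And>x. x \<in> {1..n} \<Longrightarrow> s x \<in> {1..m} \<and> cell n \<pi> (2 ^ lev x) (h (s x)) = cell n \<pi> (2 ^ lev x) x"
    by metis
  have "\<exists>\<rho>\<in>P n. planar_tau n \<pi> \<rho> \<le> real (4 * (\<Sum>x\<in>{1..n}. n div 2 ^ lev x + 1)) / real (n choose 2)"
    by (rule exists_close_member[OF P \<pi> h \<alpha> \<alpha>h blow[OF n], of s]) (use s in \<open>simp_all add: cell_def\<close>)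
  then obtain \<rho> where \<rho>: "\<rho> \<in> P n"
    "planar_tau n \<pi> \<rho> \<le> real (4 * (\<Sum>x\<in>{1..n}. n div 2 ^ lev x + 1)) / real (n choose 2)"
    by (elim bexE)
  define U where "U j = unoccupied n \<pi> (2 ^ Suc j) ?X" for j
  \<comment> \<open>If \<open>lev x < J\<close>, maximality leaves \<open>x\<close> unoccupied at
    level \<open>lev x + 1\<close>, so the summand \<open>j = lev x\<close> pays
    \<open>n / 2 ^ lev x\<close>.\<close>
  have pt: "real (n div 2 ^ lev x + 1) \<le> real n / 2 ^ J + (\<Sum>j<J. if x \<in> U j then real n / 2 ^ j else 0) + 1"
    if x: "x \<in> {1..n}" for x
  proof -
    have "real (n div 2 ^ lev x) \<le> real n / 2 ^ lev x"
      using of_nat_div_le_of_nat[of n "2 ^ lev x", where ?'a = real] by simp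
    also have "\<dots> \<le> real n / 2 ^ J + (\<Sum>j<J. if x \<in> U j then real n / 2 ^ j else 0)"
    proof (cases "lev x = J")
      case True
      then show ?thesis by (simp add: sum_nonneg)
    next
      case False
      then have lt: "lev x < J" using lev[OF x] by (simp add: Lv_def)
      have "Suc (lev x) \<notin> Lv x"
      proof
        assume "Suc (lev x) \<in> Lv x"
        then have "Suc (lev x) \<le> lev x" unfolding lev_def by (rule Max_ge[OF finLv])
        then show False by simp
      qed
      then have "x \<in> U (lev x)" using lt x by (simp add: U_def unoccupied_def Lv_def)
      then have "real n / 2 ^ lev x = (if x \<in> U (lev x) then real n / 2 ^ lev x else 0)" by simp
      also have "\<dots> \<le> (\<Sum>j<J. if x \<in> U j then real n / 2 ^ j else 0)"
        using lt by (intro member_le_sum) auto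
      finally show ?thesis by (simp add: add_increasing)
    qed
    finally show ?thesis by simp
  qed
  have "real (\<Sum>x\<in>{1..n}. n div 2 ^ lev x + 1) \<le>
      (\<Sum>x\<in>{1..n}. real n / 2 ^ J + (\<Sum>j<J. if x \<in> U j then real n / 2 ^ j else 0) + 1)"
    unfolding of_nat_sum by (rule sum_mono) (rule pt)
  also have "\<dots> = real n * (real n / 2 ^ J) + (\<Sum>x\<in>{1..n}. \<Sum>j<J. if x \<in> U j then real n / 2 ^ j else 0) + real n"
    by (simp add: sum.distrib)
  also have "(\<Sum>x\<in>{1..n}. \<Sum>j<J. if x \<in> U j then real n / 2 ^ j else 0) =
      (\<Sum>j<J. \<Sum>x\<in>{1..n}. if x \<in> U j then real n / 2 ^ j else 0)"
    by (rule sum.swap)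
  also have "\<dots> = (\<Sum>j<J. real n / 2 ^ j * real (card (U j)))"
  proof (rule sum.cong)
    fix j
    have "{1..n} \<inter> U j = U j" by (auto simp: U_def unoccupied_def)
    then show "(\<Sum>x\<in>{1..n}. if x \<in> U j then real n / 2 ^ j else 0) = real n / 2 ^ j * real (card (U j))"
      by (simp add: sum.If_cases del: atLeastAtMost_iff)
  qed simp
  finally have "real (4 * (\<Sum>x\<in>{1..n}. n div 2 ^ lev x + 1)) \<le>
    4 * (real n * (real n / 2 ^ J) + (\<Sum>j<J. real n / 2 ^ j * real (card (U j))) + real n)"
    by simp
  then have "planar_tau n \<pi> \<rho> \<le>
    4 * (real n * (real n / 2 ^ J) + (\<Sum>j<J. real n / 2 ^ j * real (card (U j))) + real n) / real (n choose 2)"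
    by (intro order_trans[OF \<rho>(2)] divide_right_mono) simp_all
  then show ?thesis using that[OF \<rho>(1)] unfolding U_def by blast
qed

text \<open>A set of at most \<open>r\<close> elements is listed by a word of length exactly
  \<open>r\<close>, padded with \<open>None\<close>.\<close>

lemma card_small_subsets_le:
  assumes "finite S"
  shows "card {Q. Q \<subseteq> S \<and> card Q \<le> r} \<le> (card S + 1) ^ r"
proof -
  let ?L = "{xs. set xs \<subseteq> insert None (Some ` S) \<and> length xs = r}"
  have finL: "finite ?L" using assms by (intro finite_lists_length_eq) simp
  have "{Q. Q \<subseteq> S \<and> card Q \<le> r} \<subseteq> (\<lambda>xs. {x. Some x \<in> set xs}) ` ?L"
  proof
    fix Q assume "Q \<in> {Q. Q \<subseteq> S \<and> card Q \<le> r}"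
    then have Q: "Q \<subseteq> S" "card Q \<le> r" by simp_all
    obtain ys where ys: "set ys = Q" "distinct ys" using finite_distinct_list[OF finite_subset[OF Q(1) assms]] by blast
    have len: "length ys \<le> r" using distinct_card[OF ys(2)] ys(1) Q(2) by simp
    let ?xs = "map Some ys @ replicate (r - length ys) None"
    have "set ?xs \<subseteq> insert None (Some ` S)" using ys(1) Q(1) by auto
    then have "?xs \<in> ?L" using len by simp
    moreover have "Q = {x. Some x \<in> set ?xs}" using ys(1) by auto
    ultimately show "Q \<in> (\<lambda>xs. {x. Some x \<in> set xs}) ` ?L" by (rule rev_image_eqI)
  qed
  then have "card {Q. Q \<subseteq> S \<and> card Q \<le> r} \<le> card ((\<lambda>xs. {x. Some x \<in> set xs}) ` ?L)"
    using finL by (intro card_mono) simp_all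
  also have "\<dots> \<le> card ?L" using finL by (rule card_image_le)
  also have "\<dots> = card (insert None (Some ` S)) ^ r" using assms by (intro card_lists_length_eq) simp
  also have "card (insert None (Some ` S)) = card S + 1" using assms by (simp add: card_image)
  finally show ?thesis .
qed

text \<open>A union bound over the possible sets of occupied cells.\<close>

lemma card_samples_unoccupied_le:
  assumes \<pi>: "\<pi> permutes {1..n}" and N: "N > 0"
  shows "real (card {f \<in> samples m n. card (cell n \<pi> N ` f ` {1..m}) \<le> r \<and>
      \<delta> * real n < real (card (unoccupied n \<pi> N (f ` {1..m})))})
    \<le> real ((N\<^sup>2 + 1) ^ r) * (exp (- \<delta>) * real n) ^ m"
proof -
  let ?B = "{f \<in> samples m n. card (cell n \<pi> N ` f ` {1..m}) \<le> r \<and>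
      \<delta> * real n < real (card (unoccupied n \<pi> N (f ` {1..m})))}"
  define In where "In Q = {x \<in> {1..n}. cell n \<pi> N x \<in> Q}" for Q
  let ?S = "{..<N} \<times> {..<N}"
  \<comment> \<open>Cell sets that miss more than \<open>\<delta> * n\<close> points; by
    \<open>1 - \<delta> \<le> exp (- \<delta>)\<close> they confine every coordinate of the sample
    to at most \<open>exp (- \<delta>) * n\<close> positions.\<close>
  let ?Qs = "{Q. Q \<subseteq> ?S \<and> card Q \<le> r \<and> real (card (In Q)) \<le> exp (- \<delta>) * real n}"
  have finIn: "finite (In Q)" for Q by (simp add: In_def)
  have finOs: "finite ?Qs" by (rule finite_subset[of _ "Pow ?S"]) auto
  have sub: "?B \<subseteq> (\<Union>Q\<in>?Qs. {1..m} \<rightarrow>\<^sub>E In Q)"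
  proof
    fix f assume "f \<in> ?B"
    then have f: "f \<in> samples m n" and r: "card (cell n \<pi> N ` f ` {1..m}) \<le> r"
      and \<delta>: "\<delta> * real n < real (card (unoccupied n \<pi> N (f ` {1..m})))" by simp_all
    define Q where "Q = cell n \<pi> N ` f ` {1..m}"
    have "Q \<subseteq> ?S" unfolding Q_def using cell_in_grid[OF \<pi> _ N] samples_in[OF f] by blast
    moreover have "real (card (In Q)) \<le> exp (- \<delta>) * real n"
    proof -
      have "card (In Q \<union> unoccupied n \<pi> N (f ` {1..m})) = card (In Q) + card (unoccupied n \<pi> N (f ` {1..m}))"
        by (rule card_Un_disjoint) (auto simp: In_def unoccupied_def Q_def)
      moreover have "In Q \<union> unoccupied n \<pi> N (f ` {1..m}) = {1..n}"
        by (auto simp: In_def unoccupied_def Q_def)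
      ultimately have "card (In Q) + card (unoccupied n \<pi> N (f ` {1..m})) = n" by simp
      then have "real (card (In Q)) \<le> (1 - \<delta>) * real n" using \<delta> by (simp add: left_diff_distrib)
      also have "\<dots> \<le> exp (- \<delta>) * real n"
        using exp_ge_add_one_self[of "- \<delta>"] by (intro mult_right_mono) auto
      finally show ?thesis .
    qed
    ultimately have "Q \<in> ?Qs" using r by (simp add: Q_def)
    moreover have "f \<in> {1..m} \<rightarrow>\<^sub>E In Q"
      using f samples_in[OF f] by (auto simp: samples_def In_def Q_def PiE_iff)
    ultimately show "f \<in> (\<Union>Q\<in>?Qs. {1..m} \<rightarrow>\<^sub>E In Q)" by (rule UN_I)
  qed
  have "finite (\<Union>Q\<in>?Qs. {1..m} \<rightarrow>\<^sub>E In Q)"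
    using finOs finIn by (intro finite_UN_I finite_PiE) simp_all
  then have "card ?B \<le> card (\<Union>Q\<in>?Qs. {1..m} \<rightarrow>\<^sub>E In Q)" using sub by (rule card_mono)
  also have "\<dots> \<le> (\<Sum>Q\<in>?Qs. card ({1..m} \<rightarrow>\<^sub>E In Q))" using finOs by (rule card_UN_le)
  finally have "real (card ?B) \<le> (\<Sum>Q\<in>?Qs. real (card ({1..m} \<rightarrow>\<^sub>E In Q)))"
    unfolding of_nat_sum[symmetric] by (rule of_nat_mono)
  also have "\<dots> = (\<Sum>Q\<in>?Qs. real (card (In Q)) ^ m)" by (simp add: card_PiE)
  also have "\<dots> \<le> of_nat (card ?Qs) * (exp (- \<delta>) * real n) ^ m"
    by (intro sum_bounded_above power_mono) auto
  also have "\<dots> \<le> real ((N\<^sup>2 + 1) ^ r) * (exp (- \<delta>) * real n) ^ m"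
  proof (intro mult_right_mono of_nat_mono)
    have "card ?Qs \<le> card {Q. Q \<subseteq> ?S \<and> card Q \<le> r}"
      by (rule card_mono[OF finite_subset[of _ "Pow ?S"]]) auto
    also have "\<dots> \<le> (card ?S + 1) ^ r" by (rule card_small_subsets_le) simp
    also have "card ?S = N\<^sup>2" by (simp add: power2_eq_square)
    finally show "card ?Qs \<le> (N\<^sup>2 + 1) ^ r" .
  qed simp
  finally show ?thesis .
qed

text \<open>The choice of one occupied cell at level \<open>j\<close> contributes at most
  \<open>2 * j\<close> to the exponent. The base 5 links the sides:
  \<open>4 ^ j + 1 \<le> 5 ^ j\<close> from \<open>j = 1\<close> on, and
  \<open>exp 2 \<ge> 5\<close> by the quadratic Taylor bound.\<close>

lemma square_plus_1_le_exp:
  assumes "j \<ge> 1"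
  shows "real ((2 ^ j)\<^sup>2 + 1) \<le> exp (2 * real j)"
proof -
  have "(4::nat) ^ i + 1 \<le> 5 ^ i" if "i \<ge> 1" for i
    using that by (induction i rule: nat_induct_at_least) simp_all
  from this[OF assms] have "4 ^ j + 1 \<le> (5::nat) ^ j" .
  then have "real (4 ^ j + 1) \<le> real (5 ^ j)" by (rule of_nat_mono)
  also have "\<dots> \<le> exp 2 ^ j"
    using exp_lower_Taylor_quadratic[of 2] by (simp add: power_mono)
  also have "\<dots> = exp (2 * real j)" by (simp add: exp_of_nat_mult[symmetric] mult.commute)
  also have "(4::nat) ^ j = (2 ^ j)\<^sup>2" by (simp add: power2_eq_square flip: power_mult_distrib)
  finally show ?thesis .
qed

lemma exp_minus_le_inverse: "0 < y \<Longrightarrow> exp (- y) \<le> 1 / (y :: real)"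
  using exp_ge_add_one_self[of y] by (simp add: exp_minus field_simps del: exp_ge_add_one_self)

text \<open>\<open>B j\<close> collects the samples that occupy few cells at scale
  \<open>2 ^ j\<close> and yet miss too many points. An accepted sample outside all
  \<open>B j\<close> would put \<open>\<pi>\<close> within \<open>\<epsilon>\<close> of the
  property, so for far \<open>\<pi>\<close> acceptance means lying in some \<open>B j\<close>; their
  proportions are bounded by a geometric series with sum at most \<open>1 / 3\<close>.\<close>

lemma card_accepts_le:
  assumes P: "hereditary P" "permutation_property P"
    and \<sigma>: "\<sigma> \<in> perms_of_length k" "\<sigma> \<notin> P k" and k: "k \<ge> 2"
    and \<epsilon>: "0 < \<epsilon>" "\<epsilon> < 1"
    and c: "c = Fueredi_Hajnal_constant k \<sigma>" and L: "L = log 2 (2 / \<epsilon>)"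
    and M: "2000000 * c / \<epsilon> * L\<^sup>2 \<le> real M"
    and n: "40 \<le> \<epsilon> * real n" and \<pi>: "\<pi> \<in> perms_of_length n" and far: "far_from planar_tau P \<epsilon> n \<pi>"
  shows "3 * card {f \<in> samples M n. accepts P M f (\<pi> \<circ> f)} \<le> n ^ M"
proof -
  have perm: "\<pi> permutes {1..n}" and \<sigma>p: "\<sigma> permutes {1..k}"
    using \<pi> \<sigma>(1) by (simp_all add: perms_of_length_def)
  have c1: "c \<ge> 1" unfolding c by (rule Fueredi_Hajnal_ge_1[OF \<sigma>p k])
  have L1: "L \<ge> 1"
  proof -
    have "log 2 2 \<le> log 2 (2 / \<epsilon>)" using \<epsilon> by (subst log_le_cancel_iff) (simp_all add: le_divide_eq)
    then show ?thesis by (simp add: L)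
  qed
  have "0 < 2000000 * c / \<epsilon> * L\<^sup>2" using c1 L1 \<epsilon> by simp
  then have "0 < real M" using M by linarith
  then have M1: "M \<ge> 1" by simp
  have n40: "40 < real n"
  proof -
    have "0 < real n" using n \<epsilon> by (metis not_numeral_le_zero of_nat_0_less_iff gr0I mult_zero_right of_nat_0)
    then have "\<epsilon> * real n < 1 * real n" using \<epsilon> by (intro mult_strict_right_mono)
    then show ?thesis using n by linarith
  qed
  \<comment> \<open>The finest scale: from \<open>2 ^ J \<ge> 32 / \<epsilon>\<close> on, the points
    occupied there cost together at most \<open>\<epsilon> * n\<^sup>2 / 32\<close>, while
    \<open>J < L + 5\<close> keeps the number of scales below \<open>6 * L\<close>.\<close>
  define J where "J = nat \<lceil>log 2 (32 / \<epsilon>)\<rceil>"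
  have log32: "log 2 (32 / \<epsilon>) = L + 4"
  proof -
    have "log 2 (32 / \<epsilon>) = log 2 (2 / \<epsilon> * 2 ^ 4)" by simp
    also have "\<dots> = log 2 (2 / \<epsilon>) + log 2 (2 ^ 4)" using \<epsilon> by (intro log_mult_pos) simp_all
    also have "log 2 (2 ^ 4) = 4" by (simp only: log_pow_cancel)
    finally show ?thesis by (simp add: L)
  qed
  have J6: "real J \<le> 6 * L"
  proof -
    have "real J < log 2 (32 / \<epsilon>) + 1"
      unfolding J_def log32 using L1 by linarith
    then show ?thesis using log32 L1 by linarith
  qed
  have pJ: "1 / 2 ^ J \<le> \<epsilon> / 32"
  proof -
    have "log 2 (32 / \<epsilon>) \<le> real J" unfolding J_def by linarith
    then have "32 / \<epsilon> \<le> 2 powr real J" using \<epsilon> by (subst (asm) log_le_iff) simp_all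
    then show ?thesis using \<epsilon> by (simp add: powr_realpow field_simps)
  qed
  \<comment> \<open>chosen so that every scale \<open>j\<close> contributes the same amount \<open>n\<^sup>2 \<epsilon> / (100 * L)\<close>\<close>
  define \<delta> where "\<delta> j = \<epsilon> * 2 ^ j / (200 * L)" for j
  define r where "r j = nat \<lfloor>c * 2 ^ j\<rfloor>" for j
  define B where "B j = {f \<in> samples M n. card (cell n \<pi> (2 ^ j) ` f ` {1..M}) \<le> r j \<and>
      \<delta> j * real n < real (card (unoccupied n \<pi> (2 ^ j) (f ` {1..M})))}" for j
  have sub: "{f \<in> samples M n. accepts P M f (\<pi> \<circ> f)} \<subseteq> (\<Union>j\<in>{1..J}. B j)"
  proof (rule subsetI, rule ccontr)
    fix f assume "f \<in> {f \<in> samples M n. accepts P M f (\<pi> \<circ> f)}" and nB: "f \<notin> (\<Union>j\<in>{1..J}. B j)"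
    then have f: "f \<in> samples M n" and acc: "accepts P M f (\<pi> \<circ> f)" by simp_all
    obtain \<alpha> h where \<alpha>: "\<alpha> permutes {1..M}" and h: "strict_mono_on {1..M} h" and img: "h ` {1..M} = f ` {1..M}"
      and hn: "h ` {1..M} \<subseteq> {1..n}"
      and \<alpha>h: "\<And>j l. j \<in> {1..M} \<Longrightarrow> l \<in> {1..M} \<Longrightarrow> \<pi> (h j) < \<pi> (h l) \<longleftrightarrow> \<alpha> j < \<alpha> l"
      and blow: "\<And>K. K \<ge> 1 \<Longrightarrow> \<not> no_k_blowup_in P M \<alpha> K"
      using acceptsE[OF acc f] by metis
    have cells: "card (cell n \<pi> (2 ^ j) ` f ` {1..M}) \<le> r j" for j
    proof -
      have "card (cell n \<pi> (2 ^ j) ` h ` {1..M}) \<le> ex_perm (2 ^ j) k \<sigma>"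
        by (rule card_occupied_cells_le[OF P(1) \<sigma> perm h hn \<alpha> _ \<alpha>h blow[of 1]]) simp_all
      then have "real (card (cell n \<pi> (2 ^ j) ` f ` {1..M})) \<le> real (ex_perm (2 ^ j) k \<sigma>)"
        unfolding img by (rule of_nat_mono)
      also have "\<dots> \<le> c * 2 ^ j" using ex_perm_le_Fueredi_Hajnal[OF \<sigma>p k, of "2 ^ j"] by (simp add: c)
      finally show ?thesis unfolding r_def by (rule le_nat_floor)
    qed
    have un: "real (card (unoccupied n \<pi> (2 ^ Suc j) (f ` {1..M}))) \<le> \<delta> (Suc j) * real n" if "j < J" for j
    proof (rule ccontr)
      assume "\<not> real (card (unoccupied n \<pi> (2 ^ Suc j) (f ` {1..M}))) \<le> \<delta> (Suc j) * real n"
      then have "f \<in> B (Suc j)" using f cells[of "Suc j"] by (simp add: B_def)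
      moreover have "Suc j \<in> {1..J}" using that by simp
      ultimately have "f \<in> (\<Union>j\<in>{1..J}. B j)" by (rule UN_I[rotated])
      then show False using nB by contradiction
    qed
    obtain \<rho> where \<rho>: "\<rho> \<in> P n" and tau: "planar_tau n \<pi> \<rho> \<le>
      4 * (real n * (real n / 2 ^ J) + (\<Sum>j<J. real n / 2 ^ j * real (card (unoccupied n \<pi> (2 ^ Suc j) (f ` {1..M})))) + real n)
        / real (n choose 2)"
      by (rule accepts_imp_close[OF P \<pi> M1 acc f])
    let ?n2 = "(real n)\<^sup>2"
    have "(\<Sum>j<J. real n / 2 ^ j * real (card (unoccupied n \<pi> (2 ^ Suc j) (f ` {1..M})))) \<le>
        (\<Sum>j<J. ?n2 * \<epsilon> / (100 * L))"
    proof (rule sum_mono)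
      fix j assume "j \<in> {..<J}"
      then have "real n / 2 ^ j * real (card (unoccupied n \<pi> (2 ^ Suc j) (f ` {1..M}))) \<le>
          real n / 2 ^ j * (\<delta> (Suc j) * real n)"
        using un by (intro mult_left_mono) simp_all
      also have "\<dots> = ?n2 * \<epsilon> / (100 * L)" using L1 by (simp add: \<delta>_def field_simps power2_eq_square)
      finally show "real n / 2 ^ j * real (card (unoccupied n \<pi> (2 ^ Suc j) (f ` {1..M}))) \<le> ?n2 * \<epsilon> / (100 * L)" .
    qed
    also have "\<dots> = real J * (?n2 * \<epsilon> / (100 * L))" by simp
    also have "\<dots> \<le> 6 * L * (?n2 * \<epsilon> / (100 * L))"
      using J6 \<epsilon> L1 by (intro mult_right_mono) simp_all
    also have "\<dots> = 6 / 100 * (?n2 * \<epsilon>)" using L1 by simp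
    finally have S: "(\<Sum>j<J. real n / 2 ^ j * real (card (unoccupied n \<pi> (2 ^ Suc j) (f ` {1..M})))) \<le> 6 / 100 * (?n2 * \<epsilon>)" .
    have "real n * (real n / 2 ^ J) = ?n2 * (1 / 2 ^ J)" by (simp add: power2_eq_square)
    also have "\<dots> \<le> ?n2 * (\<epsilon> / 32)" using pJ by (intro mult_left_mono) simp_all
    finally have T: "real n * (real n / 2 ^ J) \<le> 1 / 32 * (?n2 * \<epsilon>)" by simp
    have choose: "real (n choose 2) = real n * (real n - 1) / 2"
    proof -
      have "even (n * (n - 1))" by (cases n) simp_all
      then have "2 * (n choose 2) = n * (n - 1)" unfolding choose_two by (rule dvd_mult_div_cancel)
      from arg_cong[OF this, of real] have "2 * real (n choose 2) = real (n * (n - 1))" by simp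
      also have "\<dots> = real n * (real n - 1)" using n40 by (simp add: of_nat_diff)
      finally show ?thesis by simp
    qed
    have "40 * real n \<le> \<epsilon> * real n * real n" using n by (intro mult_right_mono) simp_all
    then have nn: "40 * real n \<le> ?n2 * \<epsilon>" by (simp add: power2_eq_square mult_ac)
    \<comment> \<open>With \<open>X = \<epsilon> * n\<^sup>2\<close> the left side is at most
      \<open>4 * (1 / 32 + 6 / 100 + 1 / 40) * X = 0.465 * X\<close>, and the right side is at least
      \<open>(1 - 1 / 40) / 2 * X = 0.4875 * X\<close>.\<close>
    have arith: "4 * (t + s + x) \<le> c"
      if "t \<le> 1 / 32 * X" "s \<le> 6 / 100 * X" "40 * x \<le> X" "0 \<le> x" "y \<le> x" "c = (X - y) / 2" for t s x c X y :: real
      using that by argo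
    have "\<epsilon> * real n \<le> real n" using \<epsilon> by (intro mult_left_le_one_le) simp_all
    moreover have "\<epsilon> * real (n choose 2) = (?n2 * \<epsilon> - \<epsilon> * real n) / 2"
      unfolding choose by (simp add: power2_eq_square algebra_simps)
    ultimately have "4 * (real n * (real n / 2 ^ J) + (\<Sum>j<J. real n / 2 ^ j * real (card (unoccupied n \<pi> (2 ^ Suc j) (f ` {1..M})))) + real n) \<le> \<epsilon> * real (n choose 2)"
      by (rule arith[OF T S nn of_nat_0_le_iff])
    moreover have "0 < real (n choose 2)" unfolding choose using n40 by simp
    ultimately have "planar_tau n \<pi> \<rho> \<le> \<epsilon>"
      by (intro order_trans[OF tau]) (simp add: divide_le_eq)
    then have "dist_from_property planar_tau P n \<pi> \<le> \<epsilon>"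
      using dist_from_property_le[OF P(2) \<rho>, of planar_tau \<pi>] by linarith
    then show False using far by (simp add: far_from_def)
  qed
  have cB: "real (card (B j)) \<le> real n ^ M * (1 / 3 * (1 / 2) ^ j)" if j: "j \<in> {1..J}" for j
  proof -
    have rj: "real (r j) \<le> c * 2 ^ j" unfolding r_def using c1 by simp
    have "real (card (B j)) \<le> real (((2 ^ j)\<^sup>2 + 1) ^ r j) * (exp (- \<delta> j) * real n) ^ M"
      unfolding B_def by (rule card_samples_unoccupied_le[OF perm]) simp
    also have "real (((2 ^ j)\<^sup>2 + 1) ^ r j) \<le> exp (2 * real j) ^ r j"
      unfolding of_nat_power[of "(2 ^ j)\<^sup>2 + 1"] using j by (intro power_mono square_plus_1_le_exp) simp_all
    also have "exp (2 * real j) ^ r j = exp (real (r j) * (2 * real j))" by (rule exp_of_nat_mult[symmetric])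
    also have "\<dots> \<le> exp (c * 2 ^ j * (12 * L))"
    proof -
      have "2 * real j \<le> 12 * L" using j J6 by simp
      from mult_mono[OF rj this] have "real (r j) * (2 * real j) \<le> c * 2 ^ j * (12 * L)"
        using c1 by simp
      then show ?thesis by simp
    qed
    also have "(exp (- \<delta> j) * real n) ^ M = exp (- (real M * \<delta> j)) * real n ^ M"
      by (simp add: power_mult_distrib exp_of_nat_mult[symmetric])
    \<comment> \<open>The size of \<open>M\<close> enters here:
      \<open>2000000 / 200 = 10000\<close>, and one of its two factors \<open>L\<close> is spent on
      the denominator of \<open>\<delta> j\<close>.\<close>
    also have "exp (- (real M * \<delta> j)) \<le> exp (- (10000 * (c * 2 ^ j * L)))"
    proof -
      have "10000 * (c * 2 ^ j * L) = 2000000 * c / \<epsilon> * L\<^sup>2 * \<delta> j"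
        using \<epsilon> L1 by (simp add: \<delta>_def field_simps power2_eq_square)
      also have "\<dots> \<le> real M * \<delta> j" using M \<epsilon> L1 by (intro mult_right_mono) (simp_all add: \<delta>_def)
      finally show ?thesis by simp
    qed
    finally have "real (card (B j)) \<le> exp (c * 2 ^ j * (12 * L)) * (exp (- (10000 * (c * 2 ^ j * L))) * real n ^ M)"
      by (simp add: mult_left_mono mult_right_mono)
    also have "\<dots> = exp (- (9988 * (c * 2 ^ j * L))) * real n ^ M"
      by (simp flip: exp_add mult.assoc add: mult.left_commute)
    \<comment> \<open>What remains after the union bound is \<open>9988 = 10000 - 12\<close>; a
      coefficient 3 suffices for terms \<open>1 / (3 * 2 ^ j)\<close>, whose sum stays below
      \<open>1 / 3\<close>.\<close>
    also have "exp (- (9988 * (c * 2 ^ j * L))) \<le> exp (- (3 * 2 ^ j))"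
    proof -
      have "1 * 2 ^ j * 1 \<le> c * 2 ^ j * L" using c1 L1 by (intro mult_mono) simp_all
      then have "3 * 2 ^ j \<le> 9988 * (c * 2 ^ j * L)" by simp
      then show ?thesis by simp
    qed
    also have "exp (- (3 * 2 ^ j)) \<le> 1 / (3 * 2 ^ j :: real)" by (rule exp_minus_le_inverse) simp
    also have "1 / (3 * 2 ^ j) = 1 / 3 * (1 / 2 :: real) ^ j" by (simp add: power_divide)
    finally show ?thesis by (simp add: mult.commute mult_right_mono)
  qed
  have geo: "(\<Sum>j\<in>{1..i}. (1 / 2 :: real) ^ j) = 1 - (1 / 2) ^ i" for i
    by (induction i) simp_all
  have "card {f \<in> samples M n. accepts P M f (\<pi> \<circ> f)} \<le> card (\<Union>j\<in>{1..J}. B j)"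
    using sub by (rule card_mono[rotated]) (simp add: B_def)
  also have "\<dots> \<le> (\<Sum>j\<in>{1..J}. card (B j))" by (rule card_UN_le) simp
  finally have "real (card {f \<in> samples M n. accepts P M f (\<pi> \<circ> f)}) \<le> (\<Sum>j\<in>{1..J}. real (card (B j)))"
    unfolding of_nat_sum[symmetric] by (rule of_nat_mono)
  also have "\<dots> \<le> (\<Sum>j\<in>{1..J}. real n ^ M * (1 / 3 * (1 / 2) ^ j))" by (rule sum_mono) (rule cB)
  also have "\<dots> = real n ^ M * (1 / 3 * (\<Sum>j\<in>{1..J}. (1 / 2) ^ j))" by (simp only: sum_distrib_left)
  also have "\<dots> \<le> real n ^ M * (1 / 3 * 1)" unfolding geo by (intro mult_left_mono) simp_all
  finally have "real (3 * card {f \<in> samples M n. accepts P M f (\<pi> \<circ> f)}) \<le> real (n ^ M)" by simp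
  then show ?thesis by (simp only: of_nat_le_iff)
qed

section \<open>Degenerate cases and the final assembly\<close>

lemma two_sided_tester_trivial:
  assumes "\<And>n \<pi>. \<pi> \<in> perms_of_length n \<Longrightarrow> \<not> b \<Longrightarrow> \<pi> \<notin> P n"
    and "\<And>n \<pi>. \<pi> \<in> perms_of_length n \<Longrightarrow> b \<Longrightarrow> \<not> far_from d P \<epsilon> n \<pi>"
  shows "two_sided_tester d P \<epsilon> q n0 (\<lambda>_. return_pmf (Output b))"
  using assms unfolding two_sided_tester_def by (cases b) auto

text \<open>The permutation of length 1 is a subpermutation of every permutation, so forbidding it
  empties a hereditary property; constant rejection is then correct.\<close>

lemma smallest_forbidden_length_1_empty:
  assumes "permutation_property P" "hereditary P" "smallest_forbidden P k \<sigma>" "k < 2"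
  shows "P n = {}"
proof (rule ccontr)
  assume "P n \<noteq> {}"
  then obtain \<pi> where \<pi>: "\<pi> \<in> P n" by blast
  then have n: "n \<ge> 1" using assms(1) by (auto simp: permutation_property_def perms_of_length_def)
  have \<sigma>: "\<sigma> \<in> perms_of_length k" "\<sigma> \<notin> P k" using assms(3) by (simp_all add: smallest_forbidden_def)
  then have "k = 1" using assms(4) by (auto simp: perms_of_length_def)
  then have "subpermutation k \<sigma> n \<pi>"
    using n unfolding subpermutation_def by (intro exI[of _ "\<lambda>_. 1"]) (auto intro!: strict_mono_onI)
  then have "\<sigma> \<in> P k" using assms(2) \<pi> \<sigma>(1) unfolding hereditary_def by blast
  then show False using \<sigma>(2) by contradiction
qed

theorem theorem1p7:
  fixes P :: perm_family and \<epsilon> :: real and k :: nat and \<sigma> :: "nat \<Rightarrow> nat"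
    and C :: real and M :: nat and n0 :: ereal
  assumes "permutation_property P" and "hereditary P" and "proper P"
    and "\<epsilon> > 0"
    and "smallest_forbidden P k \<sigma>"
    and "C = 1000 * Fueredi_Hajnal_constant k \<sigma>"
    and "M = nat \<lceil>2000 * C / \<epsilon> * (log 2 (\<epsilon> / 2))\<^sup>2\<rceil>"
    and "n0 = (if M = 0 then 0
               else ereal (32 * real M ^ 5 / \<epsilon> ^ 3) * ereal_of_enat (kstar P M))"
  shows "\<exists>A. two_sided_tester planar_tau P \<epsilon> M n0 A"
proof (cases "k < 2 \<or> \<epsilon> \<ge> 1")
  \<comment> \<open>The bounds on the constant require \<open>k \<ge> 2\<close>, and
    \<open>L \<ge> 1\<close> comes from \<open>\<epsilon> < 1\<close>. Outside this range a tester
    without queries decides correctly.\<close>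
  case True
  then show ?thesis
  proof
    assume "k < 2"
    have "P n = {}" for n by (rule smallest_forbidden_length_1_empty[OF assms(1,2,5) \<open>k < 2\<close>])
    then have "two_sided_tester planar_tau P \<epsilon> M n0 (\<lambda>_. return_pmf (Output False))"
      by (intro two_sided_tester_trivial) simp_all
    then show ?thesis by blast
  next
    assume "\<epsilon> \<ge> 1"
    then have "two_sided_tester planar_tau P \<epsilon> M n0 (\<lambda>_. return_pmf (Output True))"
      using not_far_from_ge_1[OF assms(1)] by (intro two_sided_tester_trivial) simp_all
    then show ?thesis by blast
  qed
next
  case False
  then have k: "k \<ge> 2" and \<epsilon>1: "\<epsilon> < 1" by simp_all
  have \<sigma>: "\<sigma> \<in> perms_of_length k" "\<sigma> \<notin> P k" using assms(5) by (simp_all add: smallest_forbidden_def)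
  define c where "c = Fueredi_Hajnal_constant k \<sigma>"
  define L where "L = log 2 (2 / \<epsilon>)"
  have c1: "c \<ge> 1" unfolding c_def using Fueredi_Hajnal_ge_1 \<sigma>(1) k by (simp add: perms_of_length_def)
  have L1: "L \<ge> 1"
  proof -
    have "log 2 2 \<le> log 2 (2 / \<epsilon>)" using \<open>\<epsilon> > 0\<close> \<epsilon>1 by (subst log_le_cancel_iff) (simp_all add: le_divide_eq)
    then show ?thesis by (simp add: L_def)
  qed
  have "log 2 (\<epsilon> / 2) = - L" using \<open>\<epsilon> > 0\<close> by (simp add: L_def log_divide_pos)
  \<comment> \<open>The square removes the sign of the logarithm, and \<open>2000 * 1000\<close>
    gives the constant.\<close>
  then have Mc: "M = nat \<lceil>2000000 * c / \<epsilon> * L\<^sup>2\<rceil>" using assms(6,7) by (simp add: c_def)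
  then have M: "2000000 * c / \<epsilon> * L\<^sup>2 \<le> real M" by linarith
  have "1 \<le> c / \<epsilon>" using c1 \<epsilon>1 \<open>\<epsilon> > 0\<close> by (simp add: le_divide_eq)
  then have "1 * 1 \<le> c / \<epsilon> * L\<^sup>2" using L1 by (intro mult_mono) simp_all
  then have "2 \<le> real M" using M by simp
  then have M2: "M \<ge> 2" by simp
  have n0: "\<exists>K. kstar P M = enat K \<and> 32 * M ^ 5 * K \<le> n \<and> 40 \<le> \<epsilon> * real n" if "n0 \<le> ereal (real n)" for n
  proof -
    have pos: "0 < 32 * real M ^ 5 / \<epsilon> ^ 3" using M2 \<open>\<epsilon> > 0\<close> by simp
    have le: "ereal (32 * real M ^ 5 / \<epsilon> ^ 3) * ereal_of_enat (kstar P M) \<le> ereal (real n)"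
      using that assms(8) M2 by simp
    \<comment> \<open>The factor in front is positive, so an infinite \<open>k*\<close> would make
      \<open>n0\<close> infinite, and no length reaches that.\<close>
    have "kstar P M \<noteq> \<infinity>"
    proof
      assume "kstar P M = \<infinity>"
      moreover have "ereal a * ereal_of_enat \<infinity> = \<infinity>" if "0 < a" for a using that by simp
      ultimately show False using le pos by (metis ereal_infty_less_eq(1) PInfty_neq_ereal(1))
    qed
    then obtain K where K: "kstar P M = enat K" by auto
    then have K1: "K \<ge> 1" using kstar_ge_1[of P M] by (simp add: one_enat_def)
    have le': "32 * real M ^ 5 / \<epsilon> ^ 3 * real K \<le> real n" using le K by simp
    have e3: "\<epsilon> ^ 3 \<le> \<epsilon>" "\<epsilon> ^ 3 \<le> 1"
      using power_decreasing[of 1 3 \<epsilon>] \<open>\<epsilon> > 0\<close> \<epsilon>1 by (simp_all add: power_le_one)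
    have e3p: "0 < \<epsilon> ^ 3" using \<open>\<epsilon> > 0\<close> by simp
    have *: "32 * real M ^ 5 * real K \<le> \<epsilon> ^ 3 * real n"
      using le' e3p by (simp add: field_simps)
    also have "\<dots> \<le> 1 * real n" using e3(2) by (intro mult_right_mono) simp_all
    finally have "real (32 * M ^ 5 * K) \<le> real n" by simp
    then have 1: "32 * M ^ 5 * K \<le> n" by (simp only: of_nat_le_iff)
    \<comment> \<open>Already \<open>M \<ge> 2\<close> and \<open>K \<ge> 1\<close> lift the
      numerator of \<open>n0\<close> above 40. Of \<open>\<epsilon> ^ 3\<close> a single factor is
      kept, to bound the lower-order terms of the distance.\<close>
    have "(2::nat) ^ 5 * 1 \<le> M ^ 5 * K" using M2 K1 by (intro mult_mono power_mono) simp_all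
    then have "real 32 \<le> real (M ^ 5 * K)" by (intro of_nat_mono) simp
    then have "32 \<le> real M ^ 5 * real K" by simp
    then have "40 \<le> 32 * (real M ^ 5 * real K)" by linarith
    then have "40 \<le> 32 * real M ^ 5 * real K" by (simp only: mult.assoc)
    also note *
    also have "\<epsilon> ^ 3 * real n \<le> \<epsilon> * real n" using e3(1) by (intro mult_right_mono) simp_all
    finally show ?thesis using K 1 by blast
  qed
  have "two_sided_tester planar_tau P \<epsilon> M n0 (sampling_tester P M)"
  proof (rule two_sided_tester_sampling_tester)
    fix n \<pi> assume n: "n0 \<le> ereal (real n)" and \<pi>: "\<pi> \<in> perms_of_length n"
    obtain K where K: "kstar P M = enat K" "32 * M ^ 5 * K \<le> n" "40 \<le> \<epsilon> * real n" using n0[OF n] by blast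
    have perm: "\<pi> permutes {1..n}" using \<pi> by (simp add: perms_of_length_def)
    show "3 * card {f \<in> samples M n. \<not> accepts P M f (\<pi> \<circ> f)} \<le> n ^ M" if "\<pi> \<in> P n"
      by (rule card_not_accepts_le[OF assms(2) that perm M2 K(1,2)])
    show "3 * card {f \<in> samples M n. accepts P M f (\<pi> \<circ> f)} \<le> n ^ M" if "far_from planar_tau P \<epsilon> n \<pi>"
      by (rule card_accepts_le[OF assms(2,1) \<sigma> k \<open>\<epsilon> > 0\<close> \<epsilon>1 c_def L_def M K(3) \<pi> that])
  qed
  then show ?thesis by blast
qed

end
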